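(* Let $\kappa\in(0,8)$, let $N\ge2$ be an integer and let $L$ be an integer with $0\le L\le N/2$. Put $\alpha=\frac1{\sqrt\kappa}$, $\alpha_-=\frac{-2}{\sqrt\kappa}$, $\beta=N\alpha+L\alpha_-=\frac{N-2L}{\sqrt\kappa}$. Let $h$, $U^-$, $v_\beta$, $G_f$ and $\mathcal{A}_I$ be as in the context, and let $\Gamma$ be contours of integration for the variables $w_1,\dots,w_L$ such that $h$ takes the same value at the endpoints. Then for every $I=1,\dots,N$ $$\mathcal{A}_I\Big(G_f\int_\Gamma dw_1\cdots dw_L\;h(x_1,\dots,x_N;w_1,\dots,w_L)\,U^-(x_1,\dots,x_N;w_1,\dots,w_L)\,v_\beta\Big)=0.$$
   Context: Function $h$. $$h(x_1,\dots,x_N;w_1,\dots,w_L)=\prod_{1\le I<J\le N}(x_J-x_I)^{2/\kappa}\prod_{1\le R<S\le L}(w_S-w_R)^{8/\kappa}\prod_{\substack{1\le I\le N\\1\le R\le L}}(x_I-w_R)^{-4/\kappa}.$$ The variables $x_1,\dots,x_N$ are distinct real numbers in a fixed order. The function $h$ is multivalued and is understood by analytic continuation, as a function on the universal covering manifold of the set where all the arguments are distinct. For $L=0$ there is no integration. Fock space. Let $a_n$ ($n\in\mathbb{Z}$) generate the Heisenberg algebra $[a_n,a_m]=2n\,\delta_{n+m,0}$. $F_\beta$ has basis $a_{-n_1}\cdots a_{-n_k}v_\beta$ ($k\ge0$, $1\le n_1\le\dots\le n_k$), with $a_0v_\beta=2\beta v_\beta$ and $a_nv_\beta=0$ for $n>0$.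 With $\alpha_0=\frac12\big(\frac{\sqrt\kappa}2-\frac2{\sqrt\kappa}\big)$, the Virasoro algebra (central charge $1-24\alpha_0^2$) acts on $F_\beta$ by $L_n=\frac14\sum_{j\in\mathbb{Z}}{:}a_{n-j}a_j{:}-\alpha_0(n+1)a_n$, where ${:}a_na_m{:}$ equals $a_na_m$ if $n\le m$ and $a_ma_n$ otherwise. $F_\beta=\bigoplus_{m\ge0}(F_\beta)_m$ is graded by $n_1+\dots+n_k=m$, and $\hat F_\beta=\prod_{m\ge0}(F_\beta)_m$. The expression in parentheses in the claim is $\hat F_\beta$-valued, and its annihilation by $\mathcal{A}_I$ means that each of its coefficients in the basis $a_{-n_1}\cdots a_{-n_k}v_\beta$ is annihilated. Moreover $$U^-(x_1,\dots,x_N;w_1,\dots,w_L)=\exp\Big(\sum_{n=1}^\infty\frac1n\Big(\alpha\sum_{I=1}^Nx_I^n+\alpha_-\sum_{R=1}^Lw_R^n\Big)a_{-n}\Big).$$ The operator $G_f$. Let $f(z)=z+\sum_{m\le-2}f_mz^{1+m}$ with $f_{-2},f_{-3},\dots$ indeterminates, a formal Laurent series at $z=\infty$; $\mathrm{Res}_z$ is the coefficient of $z^{-1}$. $G_f$ is the element of the completion $\overline{\mathcal{U}(\mathfrak{vir}_-)}$ (infinite sums of elements of increasing degree) of the universal enveloping algebra of the span of the $L_k$, $k<0$, with coefficients depending on the $f_m$, determined by $G_{\mathrm{id}}=1$ (value at all $f_m=0$) and $$\frac{\partial}{\partial f_m}G_f=-\sum_{k\le m}\mathrm{Res}_w\Big(w^{1+m}\frac{f'(w)}{f(w)^{2+k}}\Big)\,G_fL_k\qquad(m\le-2).$$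 It acts on $\hat F_\beta$ through the action of the $L_k$. The operators $\mathcal{A}_I$. $$\mathcal{A}_I=\frac\kappa2\frac{\partial^2}{\partial x_I^2}+\sum_{J\ne I}\Big(\frac{2}{x_J-x_I}\frac{\partial}{\partial x_J}+\frac{(\kappa-6)/\kappa}{(x_J-x_I)^2}\Big)+2\sum_{m\le-2}p_m(-x_I,f_{-2},\dots)\frac{\partial}{\partial f_m},$$ $$p_m(-x_I,f_{-2},\dots)=\mathrm{Res}_v\,v^{-2-m}\sum_{j\ge0}f(v)^{-1-j}x_I^j .$$ *)

theory Defs
  imports
    "HOL-Analysis.Analysis"
    "HOL-Library.Multiset"
    "HOL-Computational_Algebra.Formal_Laurent_Series"
begin

section \<open>Parameters\<close>

definition alpha :: "real \<Rightarrow> real" where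
  "alpha \<kappa> = 1 / sqrt \<kappa>"

definition alpha_minus :: "real \<Rightarrow> real" where
  "alpha_minus \<kappa> = - 2 / sqrt \<kappa>"

definition alpha0 :: "real \<Rightarrow> real" where
  "alpha0 \<kappa> = (1 / 2) * (sqrt \<kappa> / 2 - 2 / sqrt \<kappa>)"

definition beta :: "real \<Rightarrow> nat \<Rightarrow> nat \<Rightarrow> real" where
  "beta \<kappa> N L = real N * alpha \<kappa> + real L * alpha_minus \<kappa>"


section \<open>Fock space\<close>

text \<open>
  A vector of the completion (the product of the graded pieces, each of which is finite-dimensional)
  is its family of coefficients: the coefficient of the basis vector
  \<open>a\<^bsub>-n\<^sub>1\<^esub> \<dots> a\<^bsub>-n\<^sub>k\<^esub> v\<^sub>\<beta>\<close> is the value at the multiset \<open>{#n\<^sub>1, \<dots>, n\<^sub>k#}\<close> of positive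
  numbers. Values at multisets containing \<open>0\<close> carry no information.
\<close>

type_synonym fock = "nat multiset \<Rightarrow> complex"

definition vac :: fock where
  "vac p = (if p = {#} then 1 else 0)"

text \<open>
  The action of \<open>a\<^sub>n\<close>. On the basis, \<open>a\<^sub>-\<^sub>n\<close> (for \<open>n > 0\<close>) adds the part \<open>n\<close>, and \<open>a\<^sub>n\<close> removes a part
  \<open>n\<close> of multiplicity \<open>k\<close> with the factor \<open>2 n k\<close> that \<open>[a\<^sub>n, a\<^sub>-\<^sub>n] = 2 n\<close> and \<open>a\<^sub>n v\<^sub>\<beta> = 0\<close> force.
\<close>

definition heis :: "real \<Rightarrow> int \<Rightarrow> fock \<Rightarrow> fock" where
  "heis \<beta> n \<Phi> = (\<lambda>p.
     if n = 0 then of_real (2 * \<beta>) * \<Phi> p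
     else if n > 0 then 2 * of_int n * of_nat (Suc (count p (nat n))) * \<Phi> (add_mset (nat n) p)
     else if nat (- n) \<in># p then \<Phi> (p - {#nat (- n)#}) else 0)"

definition normal_ord :: "real \<Rightarrow> int \<Rightarrow> int \<Rightarrow> fock \<Rightarrow> fock" where
  "normal_ord \<beta> n m \<Phi> =
     (if n \<le> m then heis \<beta> n (heis \<beta> m \<Phi>) else heis \<beta> m (heis \<beta> n \<Phi>))"

text \<open>In each coefficient only finitely many \<open>j\<close> contribute.\<close>

definition vir :: "real \<Rightarrow> real \<Rightarrow> int \<Rightarrow> fock \<Rightarrow> fock" where
  "vir \<kappa> \<beta> n \<Phi> = (\<lambda>p.
     (1 / 4) * (\<Sum>\<^sub>\<infinity>j\<in>(UNIV :: int set). normal_ord \<beta> (n - j) j \<Phi> p)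
     - of_real (alpha0 \<kappa>) * of_int (n + 1) * heis \<beta> n \<Phi> p)"


section \<open>The operator \<open>U\<^sup>-\<close>\<close>

definition U_exponent ::
  "real \<Rightarrow> nat \<Rightarrow> nat \<Rightarrow> (nat \<Rightarrow> real) \<Rightarrow> (nat \<Rightarrow> complex) \<Rightarrow> fock \<Rightarrow> fock" where
  "U_exponent \<kappa> N L x w \<Phi> = (\<lambda>p. \<Sum>\<^sub>\<infinity>n\<in>{1::nat..}.
     (1 / of_nat n) *
       (of_real (alpha \<kappa>) * (\<Sum>i=1..N. of_real (x i) ^ n)
        + of_real (alpha_minus \<kappa>) * (\<Sum>r=1..L. w r ^ n))
     * heis (beta \<kappa> N L) (- int n) \<Phi> p)"

definition U_minus ::
  "real \<Rightarrow> nat \<Rightarrow> nat \<Rightarrow> (nat \<Rightarrow> real) \<Rightarrow> (nat \<Rightarrow> complex) \<Rightarrow> fock \<Rightarrow> fock" where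
  "U_minus \<kappa> N L x w \<Phi> = (\<lambda>p. \<Sum>k. (U_exponent \<kappa> N L x w ^^ k) \<Phi> p / fact k)"


section \<open>The multivalued function \<open>h\<close> and the contours\<close>

definition x_box :: "nat \<Rightarrow> (nat \<Rightarrow> real) \<Rightarrow> real \<Rightarrow> (nat \<Rightarrow> real) set" where
  "x_box N x \<epsilon> = {y. \<forall>i\<in>{1..N}. y i \<in> ball (x i) \<epsilon>}"

definition t_cube :: "nat \<Rightarrow> (nat \<Rightarrow> real) set" where
  "t_cube L = {t. \<forall>r\<in>{1..L}. t r \<in> {0..1}}"

text \<open>
  Let \<open>w\<^sub>r\<close> run through the contour \<open>\<gamma> r\<close>, let \<open>y\<close> vary in a box around \<open>x\<close>, and suppose that all
  arguments stay distinct. The parameter domain \<open>x_box \<times> t_cube\<close> is simply connected, so the map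
  \<open>(y, t) \<mapsto> (y, \<gamma>\<^sub>1(t\<^sub>1), \<dots>, \<gamma>\<^sub>L(t\<^sub>L))\<close> lifts to the universal covering of the set of distinct arguments,
  and \<open>h\<close> along such a lift is obtained from continuous logarithms of its factors. Each factor depends
  on two of the parameters only; hence so does its logarithm. \<open>h_branch\<close> says that \<open>H y t\<close> is the
  value of \<open>h\<close> along some lift.
\<close>

definition h_branch ::
  "real \<Rightarrow> nat \<Rightarrow> nat \<Rightarrow> (nat \<Rightarrow> real) \<Rightarrow> real \<Rightarrow> (nat \<Rightarrow> real \<Rightarrow> complex)
    \<Rightarrow> ((nat \<Rightarrow> real) \<Rightarrow> (nat \<Rightarrow> real) \<Rightarrow> complex) \<Rightarrow> bool" where
  "h_branch \<kappa> N L x \<epsilon> \<gamma> H \<longleftrightarrow>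
    (\<exists>(lxx :: nat \<Rightarrow> nat \<Rightarrow> real \<Rightarrow> real \<Rightarrow> complex)
      (lww :: nat \<Rightarrow> nat \<Rightarrow> real \<Rightarrow> real \<Rightarrow> complex)
      (lxw :: nat \<Rightarrow> nat \<Rightarrow> real \<Rightarrow> real \<Rightarrow> complex).
      (\<forall>i\<in>{1..N}. \<forall>j\<in>{1..N}. i < j \<longrightarrow>
         continuous_on (ball (x i) \<epsilon> \<times> ball (x j) \<epsilon>) (\<lambda>(a, b). lxx i j a b) \<and>
         (\<forall>a\<in>ball (x i) \<epsilon>. \<forall>b\<in>ball (x j) \<epsilon>. exp (lxx i j a b) = of_real b - of_real a)) \<and>
      (\<forall>r\<in>{1..L}. \<forall>s\<in>{1..L}. r < s \<longrightarrow>
         continuous_on ({0..1} \<times> {0..1}) (\<lambda>(u, v). lww r s u v) \<and>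
         (\<forall>u\<in>{0..1}. \<forall>v\<in>{0..1}. exp (lww r s u v) = \<gamma> s v - \<gamma> r u)) \<and>
      (\<forall>i\<in>{1..N}. \<forall>r\<in>{1..L}.
         continuous_on (ball (x i) \<epsilon> \<times> {0..1}) (\<lambda>(a, u). lxw i r a u) \<and>
         (\<forall>a\<in>ball (x i) \<epsilon>. \<forall>u\<in>{0..1}. exp (lxw i r a u) = of_real a - \<gamma> r u)) \<and>
      (\<forall>y\<in>x_box N x \<epsilon>. \<forall>t\<in>t_cube L.
         H y t =
           (\<Prod>j=1..N. \<Prod>i\<in>{1..<j}. exp (of_real (2 / \<kappa>) * lxx i j (y i) (y j)))
         * (\<Prod>s=1..L. \<Prod>r\<in>{1..<s}. exp (of_real (8 / \<kappa>) * lww r s (t r) (t s)))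
         * (\<Prod>i=1..N. \<Prod>r=1..L. exp (of_real (- 4 / \<kappa>) * lxw i r (y i) (t r)))))"

text \<open>
  The value of \<open>h\<close> is compared at the endpoints of the contour of each variable \<open>w\<^sub>r\<close>, as a
  function of the other arguments. Since the dependence on the \<open>y i\<close> determines the endpoint, this
  makes every \<open>\<gamma> r\<close> closed in the plane and \<open>h\<close> return to its initial value along it.
\<close>

definition same_at_endpoints ::
  "nat \<Rightarrow> nat \<Rightarrow> (nat \<Rightarrow> real) \<Rightarrow> real
    \<Rightarrow> ((nat \<Rightarrow> real) \<Rightarrow> (nat \<Rightarrow> real) \<Rightarrow> complex) \<Rightarrow> bool" where
  "same_at_endpoints N L x \<epsilon> H \<longleftrightarrow>
    (\<forall>r\<in>{1..L}. \<forall>y\<in>x_box N x \<epsilon>. \<forall>t\<in>t_cube L. H y (t(r := 0)) = H y (t(r := 1)))"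

text \<open>
  The iterated contour integral over \<open>w\<^sub>1, \<dots>, w\<^sub>L\<close>. The integrand is a function of the parameters
  \<open>t\<^sub>1, \<dots>, t\<^sub>L\<close> instead of the points \<open>\<gamma> r (t r)\<close>, because \<open>h\<close> lives on the covering.
\<close>

primrec iter_integral ::
  "(nat \<Rightarrow> real \<Rightarrow> complex) \<Rightarrow> nat \<Rightarrow> ((nat \<Rightarrow> real) \<Rightarrow> complex) \<Rightarrow> (nat \<Rightarrow> real) \<Rightarrow> complex" where
  "iter_integral \<gamma> 0 F t = F t"
| "iter_integral \<gamma> (Suc L) F t =
     iter_integral \<gamma> L
       (\<lambda>t. integral {0..1} (\<lambda>u. F (t(Suc L := u))
              * vector_derivative (\<gamma> (Suc L)) (at u within {0..1}))) t"

definition screened ::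
  "real \<Rightarrow> nat \<Rightarrow> nat \<Rightarrow> (nat \<Rightarrow> real \<Rightarrow> complex)
    \<Rightarrow> ((nat \<Rightarrow> real) \<Rightarrow> (nat \<Rightarrow> real) \<Rightarrow> complex) \<Rightarrow> (nat \<Rightarrow> real) \<Rightarrow> fock" where
  "screened \<kappa> N L \<gamma> H x = (\<lambda>p.
     iter_integral \<gamma> L (\<lambda>t. H x t * U_minus \<kappa> N L x (\<lambda>r. \<gamma> r (t r)) vac p) (\<lambda>_. 0))"


section \<open>Laurent series at infinity\<close>

text \<open>
  A Laurent series in \<open>z\<close> at \<open>z = \<infinity>\<close> is a formal Laurent series in the variable \<open>1/z\<close>: the
  coefficient of \<open>z\<^sup>n\<close> has index \<open>-n\<close>, and \<open>z\<close> itself is \<open>fls_X_inv\<close>.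
  The indeterminates \<open>f\<^sub>m\<close> are represented by arbitrary complex numbers \<open>f m\<close>, \<open>m \<le> -2\<close>. Everything
  depends polynomially on them, so that (\<open>\<complex>\<close> being infinite) polynomials and their formal partial
  derivatives are polynomial functions and their partial derivatives.
\<close>

definition fseries :: "(int \<Rightarrow> complex) \<Rightarrow> complex fls" where
  "fseries f = fls_X_inv + fps_to_fls (Abs_fps (\<lambda>n. if n = 0 then 0 else f (- 1 - int n)))"

text \<open>The derivative with respect to \<open>z\<close>, by the chain rule from the one with respect to \<open>1/z\<close>.\<close>

definition z_deriv :: "complex fls \<Rightarrow> complex fls" where
  "z_deriv g = - (fls_X ^ 2 * fls_deriv g)"

definition z_res :: "complex fls \<Rightarrow> complex" where
  "z_res g = fls_nth g 1"

definition G_coeff :: "(int \<Rightarrow> complex) \<Rightarrow> int \<Rightarrow> int \<Rightarrow> complex" where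
  "G_coeff f m k =
     z_res (fls_X_inv powi (1 + m) * (z_deriv (fseries f) / fseries f powi (2 + k)))"

text \<open>
  The residue of the formal sum over \<open>j\<close> is taken term by term; only \<open>j \<le> -2 - m\<close> contributes.
\<close>

definition p_poly :: "int \<Rightarrow> real \<Rightarrow> (int \<Rightarrow> complex) \<Rightarrow> complex" where
  "p_poly m x f =
     (\<Sum>j. z_res (fls_X_inv powi (- 2 - m) * fseries f powi (- 1 - int j)) * of_real x ^ j)"


section \<open>The completed enveloping algebra and \<open>G\<^sub>f\<close>\<close>

text \<open>
  The enveloping algebra of the span of the \<open>L\<^sub>k\<close>, \<open>k < 0\<close>, is the free associative algebra on these
  letters modulo \<open>L\<^sub>m L\<^sub>n - L\<^sub>n L\<^sub>m - (m - n) L\<^sub>m\<^sub>+\<^sub>n\<close> (the central term vanishes as \<open>m + n < 0\<close>). The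
  word \<open>[k\<^sub>1, \<dots>, k\<^sub>r]\<close> stands for \<open>L\<^bsub>k\<^sub>1\<^esub> \<dots> L\<^bsub>k\<^sub>r\<^esub>\<close>, of degree \<open>-(k\<^sub>1 + \<dots> + k\<^sub>r)\<close>. There are finitely
  many words in each degree, so an element of the completion is represented by an arbitrary family of
  coefficients of words, and \<open>uvir_eq\<close> is equality of the represented elements: in each
  degree, the difference lies in the ideal of relations. Values at words with a nonnegative letter
  carry no information.
\<close>

type_synonym uvir = "int list \<Rightarrow> complex"

definition neg_words :: "int list set" where
  "neg_words = {w. set w \<subseteq> {..<0}}"

definition word_single :: "int list \<Rightarrow> uvir" where
  "word_single u = (\<lambda>w. if w = u then 1 else 0)"

inductive_set vir_ideal :: "uvir set" where
  zero: "(\<lambda>_. 0) \<in> vir_ideal"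
| step: "\<lbrakk>g \<in> vir_ideal; u \<in> neg_words; v \<in> neg_words; m < 0; n < 0\<rbrakk> \<Longrightarrow>
    (\<lambda>w. g w + c * (word_single (u @ [m, n] @ v) w - word_single (u @ [n, m] @ v) w
                    - of_int (m - n) * word_single (u @ [m + n] @ v) w)) \<in> vir_ideal"

definition uvir_eq :: "uvir \<Rightarrow> uvir \<Rightarrow> bool" where
  "uvir_eq g g' \<longleftrightarrow>
    (\<forall>d. (\<lambda>w. if w \<in> neg_words \<and> - sum_list w = d then g w - g' w else 0) \<in> vir_ideal)"

definition mult_L :: "uvir \<Rightarrow> int \<Rightarrow> uvir" where
  "mult_L g k = (\<lambda>w. if w \<noteq> [] \<and> last w = k then g (butlast w) else 0)"

inductive f_polynomial :: "((int \<Rightarrow> complex) \<Rightarrow> complex) \<Rightarrow> bool" where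
  const: "f_polynomial (\<lambda>_. c)"
| var: "m \<le> - 2 \<Longrightarrow> f_polynomial (\<lambda>f. f m)"
| add: "f_polynomial P \<Longrightarrow> f_polynomial Q \<Longrightarrow> f_polynomial (\<lambda>f. P f + Q f)"
| mult: "f_polynomial P \<Longrightarrow> f_polynomial Q \<Longrightarrow> f_polynomial (\<lambda>f. P f * Q f)"

definition d_f :: "int \<Rightarrow> ((int \<Rightarrow> complex) \<Rightarrow> complex) \<Rightarrow> (int \<Rightarrow> complex) \<Rightarrow> complex" where
  "d_f m P f = deriv (\<lambda>s. P (f(m := s))) (f m)"

text \<open>
  \<open>G\<close> represents \<open>f \<mapsto> G\<^sub>f\<close>. These properties determine \<open>G\<close> up to \<open>uvir_eq\<close>.
\<close>

definition is_G :: "((int \<Rightarrow> complex) \<Rightarrow> uvir) \<Rightarrow> bool" where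
  "is_G G \<longleftrightarrow>
    (\<forall>w\<in>neg_words. f_polynomial (\<lambda>f. G f w)) \<and>
    uvir_eq (G (\<lambda>_. 0)) (word_single []) \<and>
    (\<forall>f. \<forall>m\<le>- 2.
       uvir_eq (\<lambda>w. d_f m (\<lambda>f. G f w) f)
               (\<lambda>w. - (\<Sum>\<^sub>\<infinity>k\<in>{..m}. G_coeff f m k * mult_L (G f) k w)))"

text \<open>
  A word of degree \<open>d\<close> raises the degree by \<open>d\<close>, so finitely many words contribute to each
  coefficient.
\<close>

definition uvir_act :: "real \<Rightarrow> real \<Rightarrow> uvir \<Rightarrow> fock \<Rightarrow> fock" where
  "uvir_act \<kappa> \<beta> g \<Phi> = (\<lambda>p. \<Sum>\<^sub>\<infinity>w\<in>neg_words. g w * foldr (vir \<kappa> \<beta>) w \<Phi> p)"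


section \<open>The operators \<open>\<A>\<^sub>I\<close>\<close>

type_synonym xf_fun = "(nat \<Rightarrow> real) \<Rightarrow> (int \<Rightarrow> complex) \<Rightarrow> complex"

definition d_x :: "nat \<Rightarrow> xf_fun \<Rightarrow> xf_fun" where
  "d_x j F x f = vector_derivative (\<lambda>s. F (x(j := s)) f) (at (x j))"

text \<open>
  On a coefficient of \<open>G\<^sub>f \<Phi>\<close>, a polynomial in the \<open>f\<^sub>m\<close>, the sum over \<open>m\<close> is finite.
\<close>

definition A_op :: "real \<Rightarrow> nat \<Rightarrow> nat \<Rightarrow> xf_fun \<Rightarrow> xf_fun" where
  "A_op \<kappa> N i F x f =
     of_real (\<kappa> / 2) * d_x i (d_x i F) x f
     + (\<Sum>j\<in>{1..N} - {i}.
          of_real (2 / (x j - x i)) * d_x j F x f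
          + of_real (((\<kappa> - 6) / \<kappa>) / (x j - x i)\<^sup>2) * F x f)
     + 2 * (\<Sum>\<^sub>\<infinity>m\<in>{..- 2}. p_poly m (x i) f * d_f m (F x) f)"

end

theory Submission
  imports Defs "HOL-Complex_Analysis.Complex_Analysis"
begin

text \<open>
  Write \<open>\<Phi>\<close> for the screened vector. Pairing the coefficients \<open>p\<^sub>m\<close> with the equations defining \<open>G\<^sub>f\<close>
  is a residue computation, which turns \<open>\<A>\<^sub>I (G\<^sub>f \<Phi>)\<close> into \<open>G\<^sub>f\<close> applied to \<open>D \<Phi>\<close>, where \<open>D\<close> has
  \<open>- 2 \<Sum>\<^bsub>k \<le> -2\<^esub> x\<^sub>I\<^bsup>-2-k\<^esup> L\<^sub>k\<close> in place of the derivatives in the \<open>f\<^sub>m\<close>. That \<open>G\<^sub>f\<close> is only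
  given modulo the Virasoro relations is harmless, because the relations hold on Fock space. On the
  coherent state \<open>U\<^sup>- v\<^sub>\<beta>\<close> the annihilators act as power sums of the points, so \<open>D (h U\<^sup>- v\<^sub>\<beta>)\<close> is
  computed explicitly: it is the total derivative
  \<open>- \<Sum>\<^sub>R \<partial>/\<partial>w\<^sub>R (2 / (w\<^sub>R - x\<^sub>I) h U\<^sup>- v\<^sub>\<beta>)\<close>, whose integral along the closed contours vanishes.
\<close>

section \<open>Finitary linear functionals on Fock space\<close>

text \<open>The constants come from conformal weights. A charge \<open>b\<close> has the weight
  \<open>b^2 - 2 * alpha0 \<kappa> * b\<close>. For \<open>alpha_minus \<kappa>\<close> this is 1,
  which is why each screening point contributes only a total derivative. For
  \<open>alpha \<kappa>\<close> it is \<open>(6 - \<kappa>) / (2 * \<kappa>)\<close>, so the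
  coefficient \<open>(\<kappa> - 6) / \<kappa>\<close> is minus twice the weight of an
  \<open>x\<close>. The charge \<open>alpha \<kappa>\<close> is moreover degenerate at level two:
  \<open>\<kappa> / 2\<close> times the second derivative in the point reproduces the quadratic part
  of twice the Virasoro sum. The analytic obstacle is that the integrand is not a function of the
  points: \<open>h\<close> is known only through logarithms along the parametrised contours. On
  small polydiscs it is replaced by single-valued holomorphic functions, one for each choice of
  cells, and differentiation under the integral sign and the cancellation of boundary terms are
  proved for such families.\<close>

text \<open>
  Each coefficient of the operators below depends linearly on finitely many coefficients of the
  argument. Linearity, continuity and termwise differentiation all follow from this.
\<close>

definition fin_lin :: "(fock \<Rightarrow> complex) \<Rightarrow> bool" where
  "fin_lin T \<longleftrightarrow> (\<exists>Q a. finite Q \<and> (\<forall>\<Phi>. T \<Phi> = (\<Sum>q\<in>Q. a q * \<Phi> q)))"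

lemma fin_lin_eval: "fin_lin (\<lambda>\<Phi>. \<Phi> p)"
  unfolding fin_lin_def by (rule exI[of _ "{p}"], rule exI[of _ "\<lambda>_. 1"]) auto

lemma fin_lin_zero: "fin_lin (\<lambda>\<Phi>. 0)"
  unfolding fin_lin_def by (rule exI[of _ "{}"]) auto

lemma fin_lin_cmult: assumes "fin_lin T" shows "fin_lin (\<lambda>\<Phi>. c * T \<Phi>)"
proof -
  obtain Q a where "finite Q" "\<And>\<Phi>. T \<Phi> = (\<Sum>q\<in>Q. a q * \<Phi> q)"
    using assms unfolding fin_lin_def by blast
  then show ?thesis unfolding fin_lin_def
    by (intro exI[of _ Q] exI[of _ "\<lambda>q. c * a q"]) (auto simp: sum_distrib_left mult.assoc)
qed

lemma fin_lin_add: assumes "fin_lin T" "fin_lin T'" shows "fin_lin (\<lambda>\<Phi>. T \<Phi> + T' \<Phi>)"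
proof -
  obtain Q a where Q: "finite Q" "\<And>\<Phi>. T \<Phi> = (\<Sum>q\<in>Q. a q * \<Phi> q)"
    using assms unfolding fin_lin_def by blast
  obtain Q' a' where Q': "finite Q'" "\<And>\<Phi>. T' \<Phi> = (\<Sum>q\<in>Q'. a' q * \<Phi> q)"
    using assms unfolding fin_lin_def by blast
  have "T \<Phi> + T' \<Phi> = (\<Sum>q\<in>Q \<union> Q'. ((if q \<in> Q then a q else 0) + (if q \<in> Q' then a' q else 0)) * \<Phi> q)" for \<Phi>
  proof -
    have "(\<Sum>q\<in>Q. a q * \<Phi> q) = (\<Sum>q\<in>Q \<union> Q'. (if q \<in> Q then a q else 0) * \<Phi> q)"
      by (rule sum.mono_neutral_cong_left) (use Q Q' in auto)
    moreover have "(\<Sum>q\<in>Q'. a' q * \<Phi> q) = (\<Sum>q\<in>Q \<union> Q'. (if q \<in> Q' then a' q else 0) * \<Phi> q)"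
      by (rule sum.mono_neutral_cong_left) (use Q Q' in auto)
    ultimately show ?thesis using Q(2) Q'(2)
      by (simp add: distrib_right sum.distrib)
  qed
  then show ?thesis unfolding fin_lin_def using Q(1) Q'(1)
    by (intro exI[of _ "Q \<union> Q'"] exI[of _ "\<lambda>q. (if q \<in> Q then a q else 0) + (if q \<in> Q' then a' q else 0)"]) auto
qed

lemma fin_lin_diff: assumes "fin_lin T" "fin_lin T'" shows "fin_lin (\<lambda>\<Phi>. T \<Phi> - T' \<Phi>)"
  using fin_lin_add[OF assms(1) fin_lin_cmult[OF assms(2), of "-1"]] by simp

lemma fin_lin_sum: assumes "\<And>i. i \<in> I \<Longrightarrow> fin_lin (T i)" shows "fin_lin (\<lambda>\<Phi>. \<Sum>i\<in>I. T i \<Phi>)"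
  using assms by (induction I rule: infinite_finite_induct) (auto intro: fin_lin_zero fin_lin_add)

lemma fin_lin_comp:
  assumes "fin_lin T" "\<And>p. fin_lin (\<lambda>\<Phi>. B \<Phi> p)" shows "fin_lin (\<lambda>\<Phi>. T (B \<Phi>))"
proof -
  obtain Q a where Q: "finite Q" "\<And>\<Phi>. T \<Phi> = (\<Sum>q\<in>Q. a q * \<Phi> q)"
    using assms unfolding fin_lin_def by blast
  show ?thesis unfolding Q(2) by (intro fin_lin_sum fin_lin_cmult assms)
qed

lemma fin_lin_linear:
  assumes "fin_lin T" "\<And>q. \<Phi> q = (\<Sum>i\<in>I. c i * \<Psi> i q)"
  shows "T \<Phi> = (\<Sum>i\<in>I. c i * T (\<Psi> i))"
proof -
  obtain Q a where Q: "finite Q" "\<And>\<Phi>. T \<Phi> = (\<Sum>q\<in>Q. a q * \<Phi> q)"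
    using assms unfolding fin_lin_def by blast
  show ?thesis unfolding Q(2) assms(2)
    by (simp add: sum_distrib_left sum.swap[of _ I] mult_ac)
qed

lemma fin_lin_linear2:
  assumes "fin_lin T"
  shows "T (\<lambda>q. a * \<Phi> q + b * \<Psi> q) = a * T \<Phi> + b * T \<Psi>"
proof -
  obtain Q c where Q: "finite Q" "\<And>\<Phi>. T \<Phi> = (\<Sum>q\<in>Q. c q * \<Phi> q)"
    using assms unfolding fin_lin_def by blast
  show ?thesis unfolding Q(2)
    by (simp add: sum_distrib_left sum.distrib distrib_left distrib_right mult_ac)
qed

lemma fin_lin_zero_arg: "fin_lin T \<Longrightarrow> T (\<lambda>_. 0) = 0"
  using fin_lin_linear2[of T 0 "\<lambda>_. 0" 0 "\<lambda>_. 0"] by simp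

section \<open>The Heisenberg and Virasoro operators on Fock space\<close>

text \<open>Degrees are integers so that shifts by negative indices make sense and
  \<open>wt p + n < 0\<close> can say that no vector is left.\<close>

definition wt :: "nat multiset \<Rightarrow> int" where "wt p = int (sum_mset p)"

lemma wt_nonneg [simp]: "0 \<le> wt p" and wt_add_mset [simp]: "wt (add_mset n p) = int n + wt p"
  by (simp_all add: wt_def del: of_nat_sum_mset)

lemma wt_not_neg [simp]: "\<not> wt p < 0" 
  using wt_nonneg[of p] by linarith

lemma fin_lin_heis: "fin_lin (\<lambda>\<Phi>. heis \<beta> n \<Phi> p)"
proof -
  consider "n = 0" | "n > 0" | "n < 0" "nat (-n) \<in># p" | "n < 0" "nat (-n) \<notin># p" by linarith
  then show ?thesis
    by cases (simp_all add: heis_def fin_lin_eval fin_lin_zero fin_lin_cmult)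
qed

text \<open>This is gradedness in a form without graded pieces: an argument may be replaced by
  anything that agrees with it in the one degree that is read, in particular by a
  truncation.\<close>

lemma heis_local:
  assumes "\<And>q. wt q = wt p + n \<Longrightarrow> \<Phi> q = \<Psi> q"
  shows "heis \<beta> n \<Phi> p = heis \<beta> n \<Psi> p"
proof -
  have 1: "\<Phi> (add_mset (nat n) p) = \<Psi> (add_mset (nat n) p)" if "n > 0"
    using that by (intro assms) auto
  have 2: "\<Phi> (p - {#nat (-n)#}) = \<Psi> (p - {#nat (-n)#})" if "n < 0" "nat (-n) \<in># p"
  proof (intro assms)
    obtain q where "p = add_mset (nat (-n)) q" using \<open>nat (-n) \<in># p\<close> by (metis mset_add)
    then show "wt (p - {#nat (-n)#}) = wt p + n" using that by simp
  qed
  have 3: "\<Phi> p = \<Psi> p" if "n = 0" using that by (intro assms) auto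
  show ?thesis using 1 2 3 by (auto simp: heis_def)
qed

lemma heis_zero: "heis \<beta> n (\<lambda>_. 0) = (\<lambda>_. 0)"
  by (auto simp: heis_def)

lemma heis_eq_0: "(\<And>q. wt q = wt p + n \<Longrightarrow> \<Phi> q = 0) \<Longrightarrow> heis \<beta> n \<Phi> p = 0"
  using heis_local[of p n \<Phi> "\<lambda>_. 0" \<beta>] by (simp add: heis_zero)

lemma heis_neg_wt: "wt p + n < 0 \<Longrightarrow> heis \<beta> n \<Phi> p = 0"
  by (rule heis_eq_0) (metis wt_not_neg)

text \<open>For opposite indices the two orders see the multiplicity of the part with and without
  one additional copy, \<open>k + 1\<close> and \<open>k\<close>; the difference 1, multiplied by
  \<open>2 n\<close>, is the central term.\<close>

lemma heis_comm:
  "heis \<beta> n (heis \<beta> m \<Phi>) p = heis \<beta> m (heis \<beta> n \<Phi>) p + (if n + m = 0 then 2 * of_int n * \<Phi> p else 0)"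
proof -
  have pn: "heis \<beta> n (heis \<beta> m \<Phi>) p = heis \<beta> m (heis \<beta> n \<Phi>) p + (if n + m = 0 then 2 * of_int n * \<Phi> p else 0)"
    if "n > 0" "m < 0" for n m :: int
  proof -
    define a b where "a = nat n" "b = nat (-m)"
    have ab: "n = int a" "m = - int b" "a > 0" "b > 0" using that by (auto simp: a_b_def)
    show ?thesis
    proof (cases "a = b")
      case True
      show ?thesis
      proof (cases "a \<in># p")
        case in_p: True
        then obtain q where q: "p = add_mset a q" by (metis mset_add)
        show ?thesis using ab True q by (simp add: heis_def algebra_simps)
      next
        case False
        then have "count p a = 0" by (simp add: not_in_iff)
        then show ?thesis using ab True False by (simp add: heis_def)
      qed
    next
      case False
      then have c: "count (p - {#b#}) a = count p a" by simp
      have d: "add_mset a p - {#b#} = add_mset a (p - {#b#})" if "b \<in># p" 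
        using that False by (metis add_mset_remove_trivial_If diff_union_swap2 insert_DiffM)
      show ?thesis using ab False c d by (auto simp: heis_def)
    qed
  qed
  consider "n = 0 \<or> m = 0" | "n > 0" "m < 0" | "n < 0" "m > 0" | "n > 0" "m > 0" | "n < 0" "m < 0" by linarith
  then show ?thesis
  proof cases
    case 1
    have "heis \<beta> 0 (heis \<beta> k \<Phi>) p = heis \<beta> k (heis \<beta> 0 \<Phi>) p" for k
      using fin_lin_linear2[OF fin_lin_heis[of \<beta> k p], of "of_real (2 * \<beta>)" \<Phi> 0 \<Phi>]
      by (simp add: heis_def[of \<beta> 0])
    from this[of n] this[of m] show ?thesis using 1 by (elim disjE) simp_all
  next
    case 2
    then show ?thesis by (rule pn)
  next
    case 3
    then show ?thesis using pn[of m n] by (cases "m = - n") (auto simp: add.commute)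
  next
    case 4
    then show ?thesis by (cases "n = m") (simp_all add: heis_def add_mset_commute)
  next
    case 5
    define a b where "a = nat (-n)" "b = nat (-m)"
    have ab: "n = - int a" "m = - int b" "a > 0" "b > 0" using 5 by (auto simp: a_b_def)
    show ?thesis
    proof (cases "a = b")
      case True
      then show ?thesis using ab by simp
    next
      case False
      then have "a \<in># p - {#b#} \<longleftrightarrow> a \<in># p" "b \<in># p - {#a#} \<longleftrightarrow> b \<in># p"
        by (auto simp: in_diff_count not_in_iff)
      moreover have "p - {#a#} - {#b#} = p - {#b#} - {#a#}" by (simp add: add_mset_commute)
      ultimately show ?thesis using ab False by (simp add: heis_def)
    qed
  qed
qed

text \<open>Normal ordering changes a product only when the indices are opposite. The generators
  used below have negative index, so it never intervenes.\<close>

lemma normal_ord_eq: "n + m \<noteq> 0 \<Longrightarrow> normal_ord \<beta> n m \<Phi> p = heis \<beta> n (heis \<beta> m \<Phi>) p"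
  using heis_comm[of \<beta> n m \<Phi> p] by (simp add: normal_ord_def)

text \<open>The outer operator carries the smaller of the two indices. Once \<open>j\<close> leaves
  the window this index is below \<open>- s\<close>, and a coefficient of degree at most
  \<open>s\<close> has no room for a creation of that size.\<close>

lemma normal_ord_support:
  assumes "k < 0" "j \<notin> {-s..s}" "wt p \<le> s"
  shows "normal_ord \<beta> (k - j) j \<Phi> p = 0"
proof (cases "k - j \<le> j")
  case True
  then have "wt p + (k - j) < 0" using assms by auto
  then show ?thesis using True by (simp add: normal_ord_def heis_neg_wt)
next
  case False
  then have "wt p + j < 0" using assms by auto
  then show ?thesis using False by (simp add: normal_ord_def heis_neg_wt)
qed

lemma heis_heis_support:
  assumes "k < 0" "j \<notin> {-s..s}" "wt p \<le> s"
  shows "heis \<beta> (k - j) (heis \<beta> j \<Phi>) p = 0"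
  using normal_ord_support[OF assms, of \<beta> \<Phi>] normal_ord_eq[of "k - j" j] assms(1) by simp

text \<open>One finite window \<open>s\<close>, without normal ordering, serves all coefficients of
  degree at most \<open>s\<close> at once, so that commutators become manipulations of finite
  sums.\<close>

definition vir_trunc :: "real \<Rightarrow> real \<Rightarrow> int \<Rightarrow> int \<Rightarrow> fock \<Rightarrow> fock" where
  "vir_trunc \<kappa> \<beta> s k \<Phi> = (\<lambda>p. (1/4) * (\<Sum>j\<in>{-s..s}. heis \<beta> (k - j) (heis \<beta> j \<Phi>) p)
     - of_real (alpha0 \<kappa>) * of_int (k + 1) * heis \<beta> k \<Phi> p)"

lemma vir_eq_trunc:
  assumes "k < 0" "wt p \<le> s"
  shows "vir \<kappa> \<beta> k \<Phi> p = vir_trunc \<kappa> \<beta> s k \<Phi> p"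
proof -
  have "(\<Sum>\<^sub>\<infinity>j\<in>(UNIV :: int set). normal_ord \<beta> (k - j) j \<Phi> p) = (\<Sum>\<^sub>\<infinity>j\<in>{-s..s}. normal_ord \<beta> (k - j) j \<Phi> p)"
    by (rule infsum_cong_neutral) (use normal_ord_support[OF assms(1) _ assms(2)] in auto)
  also have "\<dots> = (\<Sum>j\<in>{-s..s}. heis \<beta> (k - j) (heis \<beta> j \<Phi>) p)"
    using assms(1) by (simp add: normal_ord_eq)
  finally show ?thesis by (simp add: vir_def vir_trunc_def)
qed

lemma fin_lin_heis2: "fin_lin (\<lambda>\<Phi>. heis \<beta> n (heis \<beta> m \<Phi>) p)"
  by (rule fin_lin_comp[OF fin_lin_heis fin_lin_heis])

lemma fin_lin_vir_trunc: "fin_lin (\<lambda>\<Phi>. vir_trunc \<kappa> \<beta> s k \<Phi> p)"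
  unfolding vir_trunc_def
  by (intro fin_lin_diff fin_lin_cmult fin_lin_sum fin_lin_heis2 fin_lin_heis)

lemma fin_lin_vir: "k < 0 \<Longrightarrow> fin_lin (\<lambda>\<Phi>. vir \<kappa> \<beta> k \<Phi> p)"
  using fin_lin_vir_trunc[of \<kappa> \<beta> "wt p" k p] vir_eq_trunc[of k p "wt p" \<kappa> \<beta>] by simp

lemma vir_local:
  assumes "k < 0" "\<And>q. wt q = wt p + k \<Longrightarrow> \<Phi> q = \<Psi> q"
  shows "vir \<kappa> \<beta> k \<Phi> p = vir \<kappa> \<beta> k \<Psi> p"
proof -
  have "heis \<beta> (k - j) (heis \<beta> j \<Phi>) p = heis \<beta> (k - j) (heis \<beta> j \<Psi>) p" for j
    by (intro heis_local assms) simp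
  moreover have "heis \<beta> k \<Phi> p = heis \<beta> k \<Psi> p" by (intro heis_local assms) simp
  ultimately show ?thesis
    using assms(1) by (simp add: vir_eq_trunc[where s="wt p"] vir_trunc_def)
qed

lemma heis_vir_trunc:
  "heis \<beta> n (vir_trunc \<kappa> \<beta> s k \<Phi>) p = (1/4) * (\<Sum>j\<in>{-s..s}. heis \<beta> n (heis \<beta> (k - j) (heis \<beta> j \<Phi>)) p)
     - of_real (alpha0 \<kappa>) * of_int (k + 1) * heis \<beta> n (heis \<beta> k \<Phi>) p"
  unfolding vir_trunc_def
  using fin_lin_linear2[OF fin_lin_heis[of \<beta> n p], of "1/4" "\<lambda>p. (\<Sum>j\<in>{-s..s}. heis \<beta> (k - j) (heis \<beta> j \<Phi>) p)"
      "- of_real (alpha0 \<kappa>) * of_int (k + 1)" "heis \<beta> k \<Phi>"]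
   fin_lin_linear[OF fin_lin_heis[of \<beta> n p], of "\<lambda>p. (\<Sum>j\<in>{-s..s}. heis \<beta> (k - j) (heis \<beta> j \<Phi>) p)" "\<lambda>_. 1"
     "\<lambda>j. heis \<beta> (k - j) (heis \<beta> j \<Phi>)" "{-s..s}"]
  by simp

lemma heis_if: "heis \<beta> n (\<lambda>p. \<Phi> p + (if c then a * \<Psi> p else 0)) p
   = heis \<beta> n \<Phi> p + (if c then a * heis \<beta> n \<Psi> p else 0)"
  using fin_lin_linear2[OF fin_lin_heis[of \<beta> n p], of 1 \<Phi> a \<Psi>] by auto

text \<open>Moving \<open>a\<^sub>n\<close> through a quadratic term costs a nonzero commutator only
  at \<open>j = - n\<close> and at \<open>j = k + n\<close>. Each costs \<open>- 2 n\<close>, and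
  the factor 1/4 turns the total into \<open>- n\<close>. The linear term of the generator yields
  the scalar.\<close>

lemma vir_heis_comm:
  assumes "k < 0"
  shows "vir \<kappa> \<beta> k (heis \<beta> n \<Phi>) p = heis \<beta> n (vir \<kappa> \<beta> k \<Phi>) p - of_int n * heis \<beta> (k + n) \<Phi> p
     - (if k + n = 0 then 2 * of_real (alpha0 \<kappa>) * of_int ((k + 1) * k) * \<Phi> p else 0)"
proof -
  \<comment> \<open>Large enough for the degrees \<open>wt p\<close> and \<open>wt p + n\<close>,
    and for the window to contain the exceptional indices \<open>- n\<close> and
    \<open>k + n\<close>.\<close>
  define s where "s = wt p + \<bar>n\<bar> + \<bar>k\<bar>"
  have s: "wt p \<le> s" "wt p + n \<le> s" "\<bar>n\<bar> + \<bar>k\<bar> \<le> s" "0 \<le> s" by (auto simp: s_def)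
  have "heis \<beta> n (vir \<kappa> \<beta> k \<Phi>) p = heis \<beta> n (vir_trunc \<kappa> \<beta> s k \<Phi>) p"
    by (rule heis_local, rule vir_eq_trunc) (use assms s in auto)
  note R = this[unfolded heis_vir_trunc]
  have L: "vir \<kappa> \<beta> k (heis \<beta> n \<Phi>) p = vir_trunc \<kappa> \<beta> s k (heis \<beta> n \<Phi>) p"
    using assms s by (intro vir_eq_trunc)
  have T: "heis \<beta> (k - j) (heis \<beta> j (heis \<beta> n \<Phi>)) p = heis \<beta> n (heis \<beta> (k - j) (heis \<beta> j \<Phi>)) p
     + (if j = - n then - 2 * of_int n * heis \<beta> (k + n) \<Phi> p else 0)
     + (if j = k + n then - 2 * of_int n * heis \<beta> (k + n) \<Phi> p else 0)" for j
  proof -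
    have 1: "heis \<beta> j (heis \<beta> n \<Phi>) = (\<lambda>p. heis \<beta> n (heis \<beta> j \<Phi>) p + (if j + n = 0 then 2 * of_int j * \<Phi> p else 0))"
      using heis_comm by blast
    have "heis \<beta> (k - j) (heis \<beta> j (heis \<beta> n \<Phi>)) p
      = heis \<beta> (k - j) (heis \<beta> n (heis \<beta> j \<Phi>)) p + (if j + n = 0 then 2 * of_int j * heis \<beta> (k - j) \<Phi> p else 0)"
      unfolding 1 by (rule heis_if)
    also have "heis \<beta> (k - j) (heis \<beta> n (heis \<beta> j \<Phi>)) p = heis \<beta> n (heis \<beta> (k - j) (heis \<beta> j \<Phi>)) p
       + (if k - j + n = 0 then 2 * of_int (k - j) * heis \<beta> j \<Phi> p else 0)"
      by (rule heis_comm)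
    also have "(if k - j + n = 0 then 2 * of_int (k - j) * heis \<beta> j \<Phi> p else 0)
       = (if j = k + n then - 2 * of_int n * heis \<beta> (k + n) \<Phi> p else 0)"
      by (cases "j = k + n") auto
    also have "(if j + n = 0 then 2 * of_int j * heis \<beta> (k - j) \<Phi> p else 0)
       = (if j = - n then - 2 * of_int n * heis \<beta> (k + n) \<Phi> p else 0)"
      by (cases "j = - n") auto
    finally show ?thesis by simp
  qed
  have "-n \<in> {-s..s}" "k + n \<in> {-s..s}" using s by auto
  then have S: "(\<Sum>j\<in>{-s..s}. heis \<beta> (k - j) (heis \<beta> j (heis \<beta> n \<Phi>)) p)
     = (\<Sum>j\<in>{-s..s}. heis \<beta> n (heis \<beta> (k - j) (heis \<beta> j \<Phi>)) p) - 4 * of_int n * heis \<beta> (k + n) \<Phi> p"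
    unfolding T sum.distrib by simp
  show ?thesis unfolding L R vir_trunc_def S
    using heis_comm[of \<beta> k n \<Phi> p] by (auto simp: algebra_simps)
qed

text \<open>The generator \<open>L\<^sub>k\<close> is moved through both factors of each term of
  \<open>L\<^sub>l\<close>. The scalars from \<open>vir_heis_comm\<close> combine through
  \<open>l (l + 1) - k (k + 1) = (l - k) (k + l + 1)\<close> to the linear term of the generator of
  index \<open>k + l\<close>. No central charge arises because \<open>k + l < 0\<close>.\<close>

lemma virasoro_comm:
  assumes "k < 0" "l < 0"
  shows "vir \<kappa> \<beta> k (vir \<kappa> \<beta> l \<Phi>) p - vir \<kappa> \<beta> l (vir \<kappa> \<beta> k \<Phi>) p = of_int (k - l) * vir \<kappa> \<beta> (k + l) \<Phi> p"
proof -
  define s where "s = wt p + \<bar>l\<bar> + \<bar>k\<bar>"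
  have s: "wt p \<le> s" "\<bar>l\<bar> + \<bar>k\<bar> \<le> s" "0 \<le> s" by (auto simp: s_def)
  define A where "A = 2 * of_real (alpha0 \<kappa>) * (of_int ((k + 1) * k) :: complex)"
  have 1: "vir \<kappa> \<beta> k (vir \<kappa> \<beta> l \<Phi>) p = vir \<kappa> \<beta> k (vir_trunc \<kappa> \<beta> s l \<Phi>) p"
    by (rule vir_local[OF assms(1)], rule vir_eq_trunc) (use assms s in auto)
  also have "\<dots> = (1/4) * (\<Sum>j\<in>{-s..s}. vir \<kappa> \<beta> k (heis \<beta> (l - j) (heis \<beta> j \<Phi>)) p)
     - of_real (alpha0 \<kappa>) * of_int (l + 1) * vir \<kappa> \<beta> k (heis \<beta> l \<Phi>) p"
    unfolding vir_trunc_def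
    using fin_lin_linear2[OF fin_lin_vir[OF assms(1), of \<kappa> \<beta> p], of "1/4" "\<lambda>p. (\<Sum>j\<in>{-s..s}. heis \<beta> (l - j) (heis \<beta> j \<Phi>) p)"
      "- of_real (alpha0 \<kappa>) * of_int (l + 1)" "heis \<beta> l \<Phi>"]
   fin_lin_linear[OF fin_lin_vir[OF assms(1), of \<kappa> \<beta> p], of "\<lambda>p. (\<Sum>j\<in>{-s..s}. heis \<beta> (l - j) (heis \<beta> j \<Phi>) p)" "\<lambda>_. 1"
     "\<lambda>j. heis \<beta> (l - j) (heis \<beta> j \<Phi>)" "{-s..s}"]
    by simp
  finally have L: "vir \<kappa> \<beta> k (vir \<kappa> \<beta> l \<Phi>) p = \<dots>" .
  have R: "vir \<kappa> \<beta> l (vir \<kappa> \<beta> k \<Phi>) p = vir_trunc \<kappa> \<beta> s l (vir \<kappa> \<beta> k \<Phi>) p"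
    by (rule vir_eq_trunc) (use assms s in auto)
  have T: "vir \<kappa> \<beta> k (heis \<beta> (l - j) (heis \<beta> j \<Phi>)) p = heis \<beta> (l - j) (heis \<beta> j (vir \<kappa> \<beta> k \<Phi>)) p
     - of_int (l - j) * heis \<beta> (k + l - j) (heis \<beta> j \<Phi>) p
     - of_int j * heis \<beta> (l - j) (heis \<beta> (k + j) \<Phi>) p
     - (if j = k + l then A * heis \<beta> (k + l) \<Phi> p else 0)
     - (if j = - k then A * heis \<beta> (k + l) \<Phi> p else 0)" for j
  proof -
    have 1: "vir \<kappa> \<beta> k (heis \<beta> j \<Phi>) = (\<lambda>p. (heis \<beta> j (vir \<kappa> \<beta> k \<Phi>) p + (if True then (- of_int j) * heis \<beta> (k + j) \<Phi> p else 0))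
       + (if k + j = 0 then (-A) * \<Phi> p else 0))"
      using vir_heis_comm[OF assms(1), of \<kappa> \<beta> j \<Phi>] by (auto simp: A_def)
    have "heis \<beta> (l - j) (vir \<kappa> \<beta> k (heis \<beta> j \<Phi>)) p
      = heis \<beta> (l - j) (heis \<beta> j (vir \<kappa> \<beta> k \<Phi>)) p - of_int j * heis \<beta> (l - j) (heis \<beta> (k + j) \<Phi>) p
       + (if k + j = 0 then (-A) * heis \<beta> (l - j) \<Phi> p else 0)"
      unfolding 1 heis_if by simp
    moreover have "vir \<kappa> \<beta> k (heis \<beta> (l - j) (heis \<beta> j \<Phi>)) p = heis \<beta> (l - j) (vir \<kappa> \<beta> k (heis \<beta> j \<Phi>)) p
      - of_int (l - j) * heis \<beta> (k + (l - j)) (heis \<beta> j \<Phi>) p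
      - (if k + (l - j) = 0 then A * heis \<beta> j \<Phi> p else 0)"
      unfolding A_def by (rule vir_heis_comm[OF assms(1)])
    moreover have "k + (l - j) = k + l - j" by simp
    moreover have "(if k + j = 0 then (-A) * heis \<beta> (l - j) \<Phi> p else 0)
       = - (if j = - k then A * heis \<beta> (k + l) \<Phi> p else 0)"
      by (cases "j = - k") (auto simp: add.commute)
    moreover have "(if k + l - j = 0 then A * heis \<beta> j \<Phi> p else 0)
       = (if j = k + l then A * heis \<beta> (k + l) \<Phi> p else 0)"
      by (cases "j = k + l") auto
    ultimately show ?thesis by simp
  qed
  have "- k \<in> {-s..s}" "k + l \<in> {-s..s}" using s assms by auto
  then have S: "(\<Sum>j\<in>{-s..s}. vir \<kappa> \<beta> k (heis \<beta> (l - j) (heis \<beta> j \<Phi>)) p)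
     = (\<Sum>j\<in>{-s..s}. heis \<beta> (l - j) (heis \<beta> j (vir \<kappa> \<beta> k \<Phi>)) p)
     - (\<Sum>j\<in>{-s..s}. of_int (l - j) * heis \<beta> (k + l - j) (heis \<beta> j \<Phi>) p)
     - (\<Sum>j\<in>{-s..s}. of_int j * heis \<beta> (l - j) (heis \<beta> (k + j) \<Phi>) p)
     - 2 * A * heis \<beta> (k + l) \<Phi> p"
    unfolding T sum_subtractf by simp
  \<comment> \<open>Shift of the index by \<open>k\<close>. The terms added above
    \<open>s + k\<close> vanish by the support bound for the smaller window \<open>s + k\<close>,
    which still covers the degree of \<open>p\<close> by the choice of \<open>s\<close>; the terms
    dropped below \<open>- s\<close> vanish by the bound for \<open>s\<close>.\<close>
  have sh: "(\<Sum>j\<in>{-s..s}. of_int j * heis \<beta> (l - j) (heis \<beta> (k + j) \<Phi>) p)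
     = (\<Sum>j\<in>{-s..s}. of_int (j - k) * heis \<beta> (k + l - j) (heis \<beta> j \<Phi>) p)"
  proof -
    have "(\<Sum>j\<in>{-s..s}. of_int j * heis \<beta> (l - j) (heis \<beta> (k + j) \<Phi>) p)
      = (\<Sum>j\<in>{-s+k..s+k}. of_int (j - k) * heis \<beta> (k + l - j) (heis \<beta> j \<Phi>) p)"
      by (rule sum.reindex_bij_witness[of _ "\<lambda>j. j - k" "\<lambda>j. k + j"]) (auto simp: algebra_simps)
    also have "\<dots> = (\<Sum>j\<in>{-s+k..s}. of_int (j - k) * heis \<beta> (k + l - j) (heis \<beta> j \<Phi>) p)"
    proof (rule sum.mono_neutral_left)
      show "\<forall>j\<in>{-s+k..s} - {-s+k..s+k}. of_int (j - k) * heis \<beta> (k + l - j) (heis \<beta> j \<Phi>) p = 0"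
      proof
        fix j assume "j \<in> {-s+k..s} - {-s+k..s+k}"
        then have "j \<notin> {-(s+k)..s+k}" using assms by auto
        moreover have "wt p \<le> s + k" using assms by (auto simp: s_def)
        ultimately show "of_int (j - k) * heis \<beta> (k + l - j) (heis \<beta> j \<Phi>) p = 0"
          using heis_heis_support[of "k+l" j "s+k" p \<beta> \<Phi>] assms by auto
      qed
    qed (use assms in auto)
    also have "\<dots> = (\<Sum>j\<in>{-s..s}. of_int (j - k) * heis \<beta> (k + l - j) (heis \<beta> j \<Phi>) p)"
    proof (rule sum.mono_neutral_right)
      show "\<forall>j\<in>{-s+k..s} - {-s..s}. of_int (j - k) * heis \<beta> (k + l - j) (heis \<beta> j \<Phi>) p = 0"
        using heis_heis_support[of "k+l" _ s p \<beta> \<Phi>] assms s(1) by auto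
    qed (use assms in auto)
    finally show ?thesis .
  qed
  have C: "vir \<kappa> \<beta> k (heis \<beta> l \<Phi>) p = heis \<beta> l (vir \<kappa> \<beta> k \<Phi>) p - of_int l * heis \<beta> (k + l) \<Phi> p"
    using vir_heis_comm[OF assms(1), of \<kappa> \<beta> l \<Phi> p] assms by auto
  have V: "vir \<kappa> \<beta> (k + l) \<Phi> p = vir_trunc \<kappa> \<beta> s (k + l) \<Phi> p"
    by (rule vir_eq_trunc) (use assms s in auto)
  have E: "(\<Sum>j\<in>{-s..s}. of_int (l - j) * heis \<beta> (k + l - j) (heis \<beta> j \<Phi>) p)
     + (\<Sum>j\<in>{-s..s}. of_int (j - k) * heis \<beta> (k + l - j) (heis \<beta> j \<Phi>) p)
     = of_int (l - k) * (\<Sum>j\<in>{-s..s}. heis \<beta> (k + l - j) (heis \<beta> j \<Phi>) p)"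
    unfolding sum_distrib_left sum.distrib[symmetric]
    by (rule sum.cong) (auto simp: algebra_simps)
  define X where "X = (\<Sum>j\<in>{-s..s}. of_int (l - j) * heis \<beta> (k + l - j) (heis \<beta> j \<Phi>) p)"
  define Y where "Y = (\<Sum>j\<in>{-s..s}. of_int (j - k) * heis \<beta> (k + l - j) (heis \<beta> j \<Phi>) p)"
  define Z where "Z = (\<Sum>j\<in>{-s..s}. heis \<beta> (k + l - j) (heis \<beta> j \<Phi>) p)"
  define h where "h = heis \<beta> (k + l) \<Phi> p"
  have "vir \<kappa> \<beta> k (vir \<kappa> \<beta> l \<Phi>) p - vir \<kappa> \<beta> l (vir \<kappa> \<beta> k \<Phi>) p
     = (1/4) * (- (X + Y) - 2 * A * h) + of_real (alpha0 \<kappa>) * of_int (l + 1) * (of_int l * h)"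
    unfolding L R vir_trunc_def S sh C X_def[symmetric] Y_def[symmetric] h_def[symmetric]
    by (simp add: algebra_simps)
  also have "X + Y = of_int (l - k) * Z" using E by (simp add: X_def Y_def Z_def)
  finally show ?thesis
    unfolding V vir_trunc_def Z_def[symmetric] h_def[symmetric] A_def
    by (simp add: algebra_simps diff_divide_distrib add_divide_distrib)
qed

section \<open>The action of the completed enveloping algebra\<close>

definition words_upto :: "nat multiset \<Rightarrow> int list set" where
  "words_upto p = {w \<in> neg_words. - sum_list w \<le> wt p}"

lemma neg_words_append [simp]: "u @ v \<in> neg_words \<longleftrightarrow> u \<in> neg_words \<and> v \<in> neg_words"
  by (auto simp: neg_words_def)

lemma neg_words_Cons [simp]: "k # w \<in> neg_words \<longleftrightarrow> k < 0 \<and> w \<in> neg_words"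
  and neg_words_Nil [simp]: "[] \<in> neg_words"
  by (auto simp: neg_words_def)

lemma neg_words_length: "w \<in> neg_words \<Longrightarrow> int (length w) \<le> - sum_list w"
  by (induction w) auto

lemma neg_words_letter: "w \<in> neg_words \<Longrightarrow> k \<in> set w \<Longrightarrow> sum_list w \<le> k"
proof (induction w)
  case (Cons a w)
  then show ?case using neg_words_length[of w] by fastforce
qed simp

text \<open>All letters are at most -1, so the degree bounds both the length of a word and the size
  of its letters.\<close>

lemma finite_words_upto: "finite (words_upto p)"
proof (rule finite_subset)
  show "words_upto p \<subseteq> {w. set w \<subseteq> {- wt p..<0} \<and> length w \<le> nat (wt p)}"
  proof
    fix w assume "w \<in> words_upto p"
    then have w: "w \<in> neg_words" "- sum_list w \<le> wt p" by (auto simp: words_upto_def)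
    have "k \<in> {- wt p..<0}" if "k \<in> set w" for k
      using neg_words_letter[OF w(1) that] w that by (auto simp: neg_words_def)
    then show "w \<in> {w. set w \<subseteq> {- wt p..<0} \<and> length w \<le> nat (wt p)}"
      using neg_words_length[OF w(1)] w(2) by auto
  qed
qed (rule finite_lists_length_le, simp)

lemma foldr_vir_zero:
  assumes "w \<in> neg_words" "wt p + sum_list w < 0"
  shows "foldr (vir \<kappa> \<beta>) w \<Phi> p = 0"
  using assms
proof (induction w arbitrary: p)
  case (Cons k w)
  then have k: "k < 0" by simp
  have "vir \<kappa> \<beta> k (foldr (vir \<kappa> \<beta>) w \<Phi>) p = vir \<kappa> \<beta> k (\<lambda>_. 0) p"
    by (rule vir_local[OF k]) (use Cons in auto)
  also have "\<dots> = 0" by (rule fin_lin_zero_arg[OF fin_lin_vir[OF k]])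
  finally show ?case by simp
qed simp

lemma fin_lin_foldr_vir:
  assumes "w \<in> neg_words" shows "fin_lin (\<lambda>\<Phi>. foldr (vir \<kappa> \<beta>) w \<Phi> p)"
  using assms
proof (induction w arbitrary: p)
  case Nil
  then show ?case by (simp add: fin_lin_eval)
next
  case (Cons k w)
  then have "fin_lin (\<lambda>\<Phi>. vir \<kappa> \<beta> k (foldr (vir \<kappa> \<beta>) w \<Phi>) p)"
    by (intro fin_lin_comp[OF fin_lin_vir]) auto
  then show ?case by simp
qed

lemma foldr_vir_not_words: "w \<in> neg_words \<Longrightarrow> w \<notin> words_upto p \<Longrightarrow> foldr (vir \<kappa> \<beta>) w \<Phi> p = 0"
  by (rule foldr_vir_zero) (auto simp: words_upto_def)

lemma uvir_act_finite:
  "uvir_act \<kappa> \<beta> g \<Phi> p = (\<Sum>w\<in>words_upto p. g w * foldr (vir \<kappa> \<beta>) w \<Phi> p)"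
proof -
  have "uvir_act \<kappa> \<beta> g \<Phi> p = (\<Sum>\<^sub>\<infinity>w\<in>words_upto p. g w * foldr (vir \<kappa> \<beta>) w \<Phi> p)"
    unfolding uvir_act_def
    by (rule infsum_cong_neutral) (auto simp: foldr_vir_not_words, auto simp: words_upto_def)
  then show ?thesis using finite_words_upto by simp
qed

lemma fin_lin_uvir_act: "fin_lin (\<lambda>\<Phi>. uvir_act \<kappa> \<beta> g \<Phi> p)"
  unfolding uvir_act_finite
  by (intro fin_lin_sum fin_lin_cmult fin_lin_foldr_vir) (auto simp: words_upto_def)

lemma act_word_single:
  assumes "u \<in> neg_words"
  shows "(\<Sum>w\<in>words_upto p. word_single u w * foldr (vir \<kappa> \<beta>) w \<Phi> p) = foldr (vir \<kappa> \<beta>) u \<Phi> p"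
proof -
  have "(\<Sum>w\<in>words_upto p. word_single u w * foldr (vir \<kappa> \<beta>) w \<Phi> p)
      = (\<Sum>w\<in>words_upto p. if w = u then foldr (vir \<kappa> \<beta>) u \<Phi> p else 0)"
    by (rule sum.cong) (auto simp: word_single_def)
  also have "\<dots> = (if u \<in> words_upto p then foldr (vir \<kappa> \<beta>) u \<Phi> p else 0)"
    using finite_words_upto by simp
  also have "\<dots> = foldr (vir \<kappa> \<beta>) u \<Phi> p"
    using foldr_vir_not_words[OF assms] by auto
  finally show ?thesis .
qed

lemma foldr_vir_relation:
  assumes "u \<in> neg_words" "m < 0" "n < 0"
  shows "foldr (vir \<kappa> \<beta>) (u @ [m, n] @ v) \<Phi> p = foldr (vir \<kappa> \<beta>) (u @ [n, m] @ v) \<Phi> p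
     + of_int (m - n) * foldr (vir \<kappa> \<beta>) (u @ [m + n] @ v) \<Phi> p"
proof -
  define \<Psi> where "\<Psi> = foldr (vir \<kappa> \<beta>) v \<Phi>"
  have "vir \<kappa> \<beta> m (vir \<kappa> \<beta> n \<Psi>) = (\<lambda>q. 1 * vir \<kappa> \<beta> n (vir \<kappa> \<beta> m \<Psi>) q + of_int (m - n) * vir \<kappa> \<beta> (m + n) \<Psi> q)"
    using virasoro_comm[OF assms(2,3)] by (auto simp: algebra_simps)
  then show ?thesis
    using fin_lin_linear2[OF fin_lin_foldr_vir[OF assms(1), of \<kappa> \<beta> p], of 1 "vir \<kappa> \<beta> n (vir \<kappa> \<beta> m \<Psi>)" "of_int (m - n)" "vir \<kappa> \<beta> (m + n) \<Psi>"]
    by (simp add: \<Psi>_def)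
qed

lemma vir_ideal_act:
  assumes "g \<in> vir_ideal"
  shows "(\<Sum>w\<in>words_upto p. g w * foldr (vir \<kappa> \<beta>) w \<Phi> p) = 0"
  using assms
proof (induction rule: vir_ideal.induct)
  case (step g u v m n c)
  let ?S = "\<lambda>g. \<Sum>w\<in>words_upto p. g w * foldr (vir \<kappa> \<beta>) w \<Phi> p"
  have "?S (\<lambda>w. g w + c * (word_single (u @ [m, n] @ v) w - word_single (u @ [n, m] @ v) w
                    - of_int (m - n) * word_single (u @ [m + n] @ v) w))
    = ?S g + c * (?S (word_single (u @ [m, n] @ v)) - ?S (word_single (u @ [n, m] @ v))
        - of_int (m - n) * ?S (word_single (u @ [m + n] @ v)))"
    by (simp add: distrib_right left_diff_distrib right_diff_distrib sum.distrib sum_subtractf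
        sum_distrib_left mult.assoc del: append.simps append_Cons)
  also have "\<dots> = 0"
    using step foldr_vir_relation[of u m n \<kappa> \<beta> v \<Phi> p]
    by (subst act_word_single, simp)+ simp
  finally show ?case .
qed simp

text \<open>Equality is imposed degree by degree, and only the degrees from 0 to \<open>wt p\<close>
  reach the coefficient at \<open>p\<close>. The difference therefore acts as a finite sum of
  elements of the ideal.\<close>

lemma uvir_eq_act:
  assumes "uvir_eq g g'" shows "uvir_act \<kappa> \<beta> g \<Phi> p = uvir_act \<kappa> \<beta> g' \<Phi> p"
proof -
  let ?D = "\<lambda>d w. if w \<in> neg_words \<and> - sum_list w = d then g w - g' w else 0"
  have D: "(\<Sum>d\<in>{0..wt p}. ?D d w) = g w - g' w" if "w \<in> words_upto p" for w
  proof -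
    have w: "w \<in> neg_words" "- sum_list w \<in> {0..wt p}"
      using that neg_words_length[of w] by (auto simp: words_upto_def)
    have "(\<Sum>d\<in>{0..wt p}. ?D d w) = (\<Sum>d\<in>{0..wt p}. if d = - sum_list w then g w - g' w else 0)"
      using w by (intro sum.cong) auto
    then show ?thesis using w(2) by simp
  qed
  have "uvir_act \<kappa> \<beta> g \<Phi> p - uvir_act \<kappa> \<beta> g' \<Phi> p = (\<Sum>w\<in>words_upto p. (g w - g' w) * foldr (vir \<kappa> \<beta>) w \<Phi> p)"
    by (simp add: uvir_act_finite sum_subtractf left_diff_distrib)
  also have "\<dots> = (\<Sum>w\<in>words_upto p. \<Sum>d\<in>{0..wt p}. ?D d w * foldr (vir \<kappa> \<beta>) w \<Phi> p)"
    by (rule sum.cong[OF refl]) (simp only: sum_distrib_right[symmetric] D)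
  also have "\<dots> = (\<Sum>d\<in>{0..wt p}. \<Sum>w\<in>words_upto p. ?D d w * foldr (vir \<kappa> \<beta>) w \<Phi> p)"
    by (rule sum.swap)
  also have "\<dots> = 0"
    using assms vir_ideal_act[of "?D _"] unfolding uvir_eq_def by (intro sum.neutral) blast
  finally show ?thesis by simp
qed

text \<open>The last letter of a word acts first, so multiplication from the right becomes an
  operator applied to the vector. This converts the differential equation of \<open>G\<close> into a
  statement about \<open>vir\<close>.\<close>

lemma uvir_act_mult_L:
  assumes "k < 0"
  shows "uvir_act \<kappa> \<beta> (mult_L g k) \<Phi> p = uvir_act \<kappa> \<beta> g (vir \<kappa> \<beta> k \<Phi>) p"
proof -
  let ?i = "\<lambda>w. w @ [k]"
  have "uvir_act \<kappa> \<beta> (mult_L g k) \<Phi> p = (\<Sum>\<^sub>\<infinity>w\<in>?i ` neg_words. mult_L g k w * foldr (vir \<kappa> \<beta>) w \<Phi> p)"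
    unfolding uvir_act_def
  proof (rule infsum_cong_neutral)
    fix w assume w: "w \<in> neg_words - ?i ` neg_words"
    have False if "w \<noteq> []" "last w = k"
    proof -
      have "w = butlast w @ [k]" using that by (metis append_butlast_last_id)
      moreover from this have "butlast w \<in> neg_words" using w by (metis DiffD1 neg_words_append)
      ultimately show False using w by blast
    qed
    then show "mult_L g k w * foldr (vir \<kappa> \<beta>) w \<Phi> p = 0" by (auto simp: mult_L_def)
  qed (use assms in auto)
  also have "\<dots> = uvir_act \<kappa> \<beta> g (vir \<kappa> \<beta> k \<Phi>) p"
    unfolding uvir_act_def by (subst infsum_reindex) (auto simp: inj_on_def mult_L_def o_def)
  finally show ?thesis .
qed

section \<open>Derivatives in the indeterminates of the Laurent series\<close>

lemma f_polynomial_differentiable: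
  "f_polynomial P \<Longrightarrow> (\<lambda>s. P (f(m := s))) field_differentiable (at c)"
proof (induction rule: f_polynomial.induct)
  case (var n)
  then show ?case by (cases "n = m") (auto simp: field_differentiable_ident field_differentiable_const)
qed (auto intro: field_differentiable_add field_differentiable_mult field_differentiable_const)

lemma d_f_act:
  assumes "\<And>w. w \<in> neg_words \<Longrightarrow> f_polynomial (\<lambda>f. G f w)"
  shows "d_f m (\<lambda>f. uvir_act \<kappa> \<beta> (G f) \<Phi> p) f = uvir_act \<kappa> \<beta> (\<lambda>w. d_f m (\<lambda>f. G f w) f) \<Phi> p"
  unfolding uvir_act_finite d_f_def
proof (rule DERIV_imp_deriv, rule DERIV_sum)
  fix w assume "w \<in> words_upto p"
  then have "f_polynomial (\<lambda>f. G f w)" using assms by (auto simp: words_upto_def)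
  then have "(\<lambda>s. G (f(m := s)) w) field_differentiable (at (f m))" by (rule f_polynomial_differentiable)
  then have "((\<lambda>s. G (f(m := s)) w) has_field_derivative deriv (\<lambda>s. G (f(m := s)) w) (f m)) (at (f m))"
    by (rule field_differentiable_derivI)
  then show "((\<lambda>s. G (f(m := s)) w * foldr (vir \<kappa> \<beta>) w \<Phi> p) has_field_derivative
     deriv (\<lambda>s. G (f(m := s)) w) (f m) * foldr (vir \<kappa> \<beta>) w \<Phi> p) (at (f m))"
    by (rule DERIV_cmult_right)
qed

text \<open>The infinite sum over \<open>k\<close> can be cut at \<open>- B\<close>, since a word
  reaching the coefficient at \<open>p\<close> has no letter below \<open>- wt p\<close>. The bound
  \<open>B\<close> is left free because one bound must later serve several coefficients.\<close>

lemma d_f_G_act: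
  assumes "is_G G" "m \<le> -2" "wt p \<le> B"
  shows "d_f m (\<lambda>f. uvir_act \<kappa> \<beta> (G f) \<Phi> p) f
    = - (\<Sum>k\<in>{-B..m}. G_coeff f m k * uvir_act \<kappa> \<beta> (G f) (vir \<kappa> \<beta> k \<Phi>) p)"
proof -
  have "d_f m (\<lambda>f. uvir_act \<kappa> \<beta> (G f) \<Phi> p) f = uvir_act \<kappa> \<beta> (\<lambda>w. d_f m (\<lambda>f. G f w) f) \<Phi> p"
    using assms(1) by (intro d_f_act) (auto simp: is_G_def)
  also have "\<dots> = uvir_act \<kappa> \<beta> (\<lambda>w. - (\<Sum>\<^sub>\<infinity>k\<in>{..m}. G_coeff f m k * mult_L (G f) k w)) \<Phi> p"
    using assms(1,2) by (intro uvir_eq_act) (auto simp: is_G_def)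
  also have "\<dots> = (\<Sum>w\<in>words_upto p. - (\<Sum>k\<in>{-B..m}. G_coeff f m k * mult_L (G f) k w) * foldr (vir \<kappa> \<beta>) w \<Phi> p)"
    unfolding uvir_act_finite
  proof (rule sum.cong[OF refl])
    fix w assume w: "w \<in> words_upto p"
    have "(\<Sum>\<^sub>\<infinity>k\<in>{..m}. G_coeff f m k * mult_L (G f) k w) = (\<Sum>\<^sub>\<infinity>k\<in>{-B..m}. G_coeff f m k * mult_L (G f) k w)"
    proof (rule infsum_cong_neutral)
      fix k assume "k \<in> {..m} - {-B..m}"
      then have "k < - B" by auto
      then have "w = [] \<or> last w \<noteq> k"
        using w neg_words_letter[of w k] assms(3) by (auto simp: words_upto_def)
      then show "G_coeff f m k * mult_L (G f) k w = 0" by (auto simp: mult_L_def)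
    qed auto
    then show "- (\<Sum>\<^sub>\<infinity>k\<in>{..m}. G_coeff f m k * mult_L (G f) k w) * foldr (vir \<kappa> \<beta>) w \<Phi> p =
         - (\<Sum>k\<in>{-B..m}. G_coeff f m k * mult_L (G f) k w) * foldr (vir \<kappa> \<beta>) w \<Phi> p" by simp
  qed
  also have "\<dots> = - (\<Sum>k\<in>{-B..m}. G_coeff f m k * uvir_act \<kappa> \<beta> (mult_L (G f) k) \<Phi> p)"
    unfolding uvir_act_finite
    by (simp add: sum_negf sum_distrib_left sum_distrib_right mult.assoc sum.swap[of _ "words_upto p"])
  also have "\<dots> = - (\<Sum>k\<in>{-B..m}. G_coeff f m k * uvir_act \<kappa> \<beta> (G f) (vir \<kappa> \<beta> k \<Phi>) p)"
    using assms(2) by (simp add: uvir_act_mult_L)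
  finally show ?thesis .
qed

section \<open>The residue pairing\<close>

context
  includes fps_syntax
begin

lemma fseries_subdegree: "fls_subdegree (fseries f) = -1"
  and fseries_nonzero: "fseries f \<noteq> 0"
proof -
  have 1: "fseries f $$ (-1) = 1" by (simp add: fseries_def)
  then show "fseries f \<noteq> 0" by auto
  show "fls_subdegree (fseries f) = -1"
    by (rule fls_subdegree_eqI) (auto simp: fseries_def)
qed

lemma fls_X_inv_powi_times_nth: "(fls_X_inv powi a * g) $$ n = (g :: 'a::field fls) $$ (n + a)"
proof -
  have "fls_X_inv powi a = (fls_X_intpow (- a) :: 'a fls)"
    by (cases "a \<ge> 0") (auto simp: power_int_def fls_X_inv_power_conv_shift_1 fls_inverse_X_inv fls_X_power_conv_shift_1)
  then show ?thesis by (simp only: fls_X_intpow_times_conv_shift) simp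
qed

lemma fls_times_nth_bounds:
  fixes g h :: "'a::{comm_monoid_add, mult_zero} fls"
  assumes "lo \<le> fls_subdegree g" "n - fls_subdegree h \<le> hi"
  shows "(g * h) $$ n = (\<Sum>i\<in>{lo..hi}. g $$ i * h $$ (n - i))"
  unfolding fls_times_nth(2)
  by (rule sum.mono_neutral_left) (use assms in \<open>auto simp: not_le\<close>)

lemma z_deriv_fseries_subdegree: "0 \<le> fls_subdegree (z_deriv (fseries f))"
proof -
  have "z_deriv (fseries f) \<noteq> 0 \<Longrightarrow> 0 \<le> fls_subdegree (z_deriv (fseries f))"
  proof (rule fls_subdegree_geI)
    fix k :: int assume "k < 0"
    have "z_deriv (fseries f) $$ k = - (fls_shift (-2) (fls_deriv (fseries f)) $$ k)"
      by (simp add: z_deriv_def fls_X_power_times_conv_shift)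
    also have "\<dots> = - (of_int (k - 1) * fseries f $$ (k - 1))" by simp
    also have "\<dots> = 0"
      using \<open>k < 0\<close> by (simp add: fseries_subdegree)
    finally show "z_deriv (fseries f) $$ k = 0" .
  qed
  then show ?thesis by (cases "z_deriv (fseries f) = 0") auto
qed

text \<open>For \<open>n \<ge> 0\<close> the product is, up to a constant factor, the derivative of
  a power and has no residue. For \<open>n = -1\<close> it is the logarithmic derivative, whose
  residue is read off from the subdegree -1, that is, from the simple pole at infinity.\<close>

lemma z_res_deriv_power:
  assumes "n \<ge> -1"
  shows "z_res (z_deriv (fseries f) * fseries f powi n) = (if n = -1 then 1 else 0)"
proof -
  have "z_res (z_deriv (fseries f) * fseries f powi n)
      = - ((fls_X ^ 2 * (fls_deriv (fseries f) * fseries f powi n)) $$ 1)"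
    by (simp add: z_res_def z_deriv_def mult.assoc)
  \<comment> \<open>The factor \<open>fls_X ^ 2\<close> from the chain rule moves index 1, where
    \<open>z_res\<close> reads, to index -1, where \<open>fls_residue\<close> reads.\<close>
  also have "\<dots> = - fls_residue (fls_deriv (fseries f) * fseries f powi n)"
    by (simp only: fls_X_power_times_conv_shift) simp
  also have "\<dots> = (if n = -1 then 1 else 0)"
  proof (cases "n = -1")
    case True
    then show ?thesis
      using fls_residue_deriv_times_inverse_eq_subdegree(1)[of "fseries f"]
      by (simp add: power_int_minus fseries_subdegree)
  next
    case False
    then have "n \<ge> 0" using assms by simp
    then obtain k where k: "n = int k" by (rule nonneg_int_cases)
    have "fls_deriv (fseries f ^ Suc k) = of_nat (Suc k) * (fls_deriv (fseries f) * fseries f ^ k)"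
      by (simp only: fls_deriv_power) (simp add: mult_ac)
    then have "of_nat (Suc k) * fls_residue (fls_deriv (fseries f) * fseries f ^ k) = 0"
      using fls_residue_deriv[of "fseries f ^ Suc k"] fls_residue_of_int_times(1)[of "int (Suc k)" "fls_deriv (fseries f) * fseries f ^ k"]
      by simp
    then have "fls_residue (fls_deriv (fseries f) * fseries f ^ k) = 0"
      using of_nat_neq_0 mult_eq_0_iff by blast
    then show ?thesis using k by simp
  qed
  finally show ?thesis .
qed

text \<open>
  Formally, the sum over \<open>m\<close> glues the two residues to
  \<open>Res\<^sub>w f'(w) f(w)\<^bsup>-2-k\<^esup> / (f(w) - x) = Res\<^sub>z z\<^bsup>-2-k\<^esup> / (z - x)\<close>.
\<close>

lemma p_poly_G_coeff_sum:
  assumes "k \<le> -2"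
  shows "(\<Sum>m\<in>{k..-2}. p_poly m x f * G_coeff f m k) = of_real x ^ nat (-2 - k)"
proof -
  define F where "F = fseries f"
  define g where "g = z_deriv F * F powi (-2 - k)"
  define J where "J = nat (-2 - k)"
  have sF: "fls_subdegree (F powi a) = - a" for a
    by (simp add: fls_subdegree_power_int F_def fseries_subdegree)
  have p: "p_poly m x f = (\<Sum>j\<le>J. (F powi (-1 - int j)) $$ (-1 - m) * of_real x ^ j)" if "k \<le> m" for m
  proof -
    have c: "z_res (fls_X_inv powi (- 2 - m) * F powi (- 1 - int j)) = (F powi (-1 - int j)) $$ (-1 - m)" for j
      unfolding z_res_def fls_X_inv_powi_times_nth by (simp add: algebra_simps)
    \<comment> \<open>The power starts at index \<open>j + 1\<close>, while
      \<open>-1 - m \<le> -1 - k = J + 1\<close>; hence only \<open>j \<le> J\<close> can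
      contribute.\<close>
    have "(F powi (-1 - int j)) $$ (-1 - m) = 0" if "j \<notin> {..J}" for j
      using that \<open>k \<le> m\<close> by (intro fls_eq0_below_subdegree) (auto simp: sF J_def F_def fseries_subdegree)
    then show ?thesis
      unfolding p_poly_def F_def[symmetric] c by (subst suminf_finite[of "{..J}"]) auto
  qed
  have G: "G_coeff f m k = g $$ (2 + m)" for m
  proof -
    have "z_deriv F / F powi (2 + k) = g"
      unfolding g_def using power_int_minus[of F "2 + k"] by (simp add: divide_inverse)
    then show ?thesis
      by (simp add: G_coeff_def F_def[symmetric] z_res_def fls_X_inv_powi_times_nth)
  qed
  have gs: "fls_subdegree g \<ge> 2 + k \<or> g = 0"
  proof (cases "z_deriv F = 0")
    case False
    have "F powi (-2 - k) \<noteq> 0" using fseries_nonzero by (simp add: F_def)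
    then show ?thesis using False z_deriv_fseries_subdegree[of f] sF[of "-2-k"]
      unfolding g_def F_def by simp
  qed (simp add: g_def)
  have conv: "(\<Sum>m\<in>{k..-2}. (F powi (-1 - int j)) $$ (-1 - m) * g $$ (2 + m)) = (if j = J then 1 else 0)"
    if "j \<le> J" for j
  proof -
    have "(\<Sum>m\<in>{k..-2}. (F powi (-1 - int j)) $$ (-1 - m) * g $$ (2 + m))
       = (\<Sum>i\<in>{1..-1-k}. (F powi (-1 - int j)) $$ i * g $$ (1 - i))"
      by (rule sum.reindex_bij_witness[of _ "\<lambda>i. -1 - i" "\<lambda>m. -1 - m"]) (auto simp: algebra_simps)
    \<comment> \<open>The range is exactly large enough for a full convolution: the first factor
      starts at index \<open>1 + j\<close>, the second not before \<open>2 + k\<close>.\<close>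
    also have "\<dots> = (F powi (-1 - int j) * g) $$ 1"
    proof (cases "g = 0")
      case False
      then show ?thesis using gs sF[of "-1 - int j"]
        by (intro fls_times_nth_bounds[symmetric]) auto
    qed simp
    also have "F powi (-1 - int j) * g = z_deriv F * F powi (-3 - int j - k)"
    proof -
      have "F powi (-1 - int j) * F powi (-2 - k) = F powi ((-1 - int j) + (-2 - k))"
        using fseries_nonzero by (intro power_int_add[symmetric]) (auto simp: F_def)
      then show ?thesis by (simp add: g_def mult.left_commute algebra_simps)
    qed
    \<comment> \<open>The exponent equals \<open>J - j - 1\<close>, which is at least -1, with
      equality only for \<open>j = J\<close>.\<close>
    also have "\<dots> $$ 1 = (if j = J then 1 else 0)"
      using z_res_deriv_power[of "-3 - int j - k" f] that assms
      by (auto simp: z_res_def F_def[symmetric] J_def)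
    finally show ?thesis .
  qed
  have "(\<Sum>m\<in>{k..-2}. p_poly m x f * G_coeff f m k)
     = (\<Sum>m\<in>{k..-2}. \<Sum>j\<le>J. of_real x ^ j * ((F powi (-1 - int j)) $$ (-1 - m) * g $$ (2 + m)))"
    by (rule sum.cong) (auto simp: p G sum_distrib_left sum_distrib_right mult_ac)
  also have "\<dots> = (\<Sum>j\<le>J. of_real x ^ j * (\<Sum>m\<in>{k..-2}. (F powi (-1 - int j)) $$ (-1 - m) * g $$ (2 + m)))"
    by (subst sum.swap) (simp add: sum_distrib_left)
  also have "\<dots> = (\<Sum>j\<le>J. if j = J then of_real x ^ J else 0)"
    by (rule sum.cong) (auto simp: conv)
  finally show ?thesis by (simp add: J_def)
qed

end

lemma f_derivative_sum:
  assumes G: "is_G G" and B: "wt p \<le> B"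
  shows "(\<Sum>\<^sub>\<infinity>m\<in>{..- 2}. p_poly m x f * d_f m (\<lambda>f. uvir_act \<kappa> \<beta> (G f) \<Phi> p) f)
    = - (\<Sum>k\<in>{- B..-2}. of_real x ^ nat (- 2 - k) * uvir_act \<kappa> \<beta> (G f) (vir \<kappa> \<beta> k \<Phi>) p)"
proof -
  define U where "U k = uvir_act \<kappa> \<beta> (G f) (vir \<kappa> \<beta> k \<Phi>) p" for k
  have d: "d_f m (\<lambda>f. uvir_act \<kappa> \<beta> (G f) \<Phi> p) f = - (\<Sum>k\<in>{- B..m}. G_coeff f m k * U k)" if "m \<le> -2" for m
    unfolding U_def by (rule d_f_G_act[OF G that B])
  have "(\<Sum>\<^sub>\<infinity>m\<in>{..- 2}. p_poly m x f * d_f m (\<lambda>f. uvir_act \<kappa> \<beta> (G f) \<Phi> p) f)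
    = (\<Sum>\<^sub>\<infinity>m\<in>{- B..- 2}. p_poly m x f * d_f m (\<lambda>f. uvir_act \<kappa> \<beta> (G f) \<Phi> p) f)"
    by (rule infsum_cong_neutral) (auto simp: d)
  \<comment> \<open>The triangle \<open>k \<le> m\<close> is padded by zeros to a square, so that
    the two sums can be exchanged.\<close>
  also have "\<dots> = (\<Sum>m\<in>{- B..- 2}. \<Sum>k\<in>{- B..-2}. if k \<le> m then - (p_poly m x f * G_coeff f m k * U k) else 0)"
    unfolding infsum_finite[OF finite_atLeastAtMost_int]
  proof (rule sum.cong[OF refl])
    fix m assume m: "m \<in> {- B..- 2}"
    have "(\<Sum>k\<in>{- B..-2}. if k \<le> m then - (p_poly m x f * G_coeff f m k * U k) else 0)
       = (\<Sum>k\<in>{- B..m}. - (p_poly m x f * G_coeff f m k * U k))"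
      using m by (intro sum.mono_neutral_cong_right) auto
    then show "p_poly m x f * d_f m (\<lambda>f. uvir_act \<kappa> \<beta> (G f) \<Phi> p) f
      = (\<Sum>k\<in>{- B..-2}. if k \<le> m then - (p_poly m x f * G_coeff f m k * U k) else 0)"
      using m by (simp add: d sum_distrib_left sum_negf mult.assoc)
  qed
  also have "\<dots> = (\<Sum>k\<in>{- B..-2}. \<Sum>m\<in>{- B..- 2}. if k \<le> m then - (p_poly m x f * G_coeff f m k * U k) else 0)"
    by (rule sum.swap)
  also have "\<dots> = (\<Sum>k\<in>{- B..-2}. - (of_real x ^ nat (- 2 - k) * U k))"
  proof (rule sum.cong[OF refl])
    fix k assume k: "k \<in> {- B..- 2}"
    have "(\<Sum>m\<in>{- B..- 2}. if k \<le> m then - (p_poly m x f * G_coeff f m k * U k) else 0)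
      = (\<Sum>m\<in>{k..- 2}. - (p_poly m x f * G_coeff f m k * U k))"
      using k by (intro sum.mono_neutral_cong_right) auto
    also have "\<dots> = - ((\<Sum>m\<in>{k..- 2}. p_poly m x f * G_coeff f m k) * U k)"
      by (simp add: sum_negf sum_distrib_right)
    finally show "(\<Sum>m\<in>{- B..- 2}. if k \<le> m then - (p_poly m x f * G_coeff f m k * U k) else 0)
      = - (of_real x ^ nat (- 2 - k) * U k)"
      using k by (simp add: p_poly_G_coeff_sum)
  qed
  finally show ?thesis by (simp add: sum_negf U_def)
qed

section \<open>Coherent states\<close>

text \<open>The vector \<open>exp (\<Sum>n. c n a\<^bsub>-n\<^esub>) v\<close>; the multiplicities of parts give divided powers.\<close>

definition coh :: "(nat \<Rightarrow> complex) \<Rightarrow> fock" where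
  "coh c p = (\<Prod>n\<in>set_mset p. c n ^ count p n / fact (count p n))"

lemma coh_superset:
  "finite A \<Longrightarrow> set_mset p \<subseteq> A \<Longrightarrow> coh c p = (\<Prod>n\<in>A. c n ^ count p n / fact (count p n))"
  unfolding coh_def by (rule prod.mono_neutral_left) (auto simp: not_in_iff)

lemma coh_add_mset: "coh c (add_mset n p) = c n / of_nat (Suc (count p n)) * coh c p"
proof -
  let ?A = "insert n (set_mset p)"
  have A: "finite ?A" "n \<in> ?A" by auto
  have "coh c (add_mset n p) = (\<Prod>k\<in>?A. c k ^ count (add_mset n p) k / fact (count (add_mset n p) k))"
    by (rule coh_superset) auto
  also have "\<dots> = c n ^ Suc (count p n) / fact (Suc (count p n)) *
     (\<Prod>k\<in>?A - {n}. c k ^ count (add_mset n p) k / fact (count (add_mset n p) k))"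
    by (subst prod.remove[OF A]) simp
  also have "(\<Prod>k\<in>?A - {n}. c k ^ count (add_mset n p) k / fact (count (add_mset n p) k))
     = (\<Prod>k\<in>?A - {n}. c k ^ count p k / fact (count p k))"
    by (rule prod.cong) auto
  also have "c n ^ Suc (count p n) / fact (Suc (count p n)) = c n / of_nat (Suc (count p n)) * (c n ^ count p n / fact (count p n))"
    by simp
  also have "\<dots> * (\<Prod>k\<in>?A - {n}. c k ^ count p k / fact (count p k))
     = c n / of_nat (Suc (count p n)) * (\<Prod>k\<in>?A. c k ^ count p k / fact (count p k))"
    using prod.remove[OF A, of "\<lambda>k. c k ^ count p k / fact (count p k)"] by (simp only: mult.assoc)
  also have "(\<Prod>k\<in>?A. c k ^ count p k / fact (count p k)) = coh c p"
    by (rule coh_superset[symmetric]) auto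
  finally show ?thesis .
qed

lemma coh_remove: "n \<in># p \<Longrightarrow> c n * coh c (p - {#n#}) = of_nat (count p n) * coh c p"
  using coh_add_mset[of c n "p - {#n#}"] by (auto simp: in_diff_count not_in_iff Suc_diff_1 simp del: of_nat_Suc)

text \<open>The \<open>k\<close>-th power reaches exactly the multisets with \<open>k\<close> parts,
  so the exponential series has a single nonzero term in each coefficient. In the induction a part
  \<open>n\<close> enters with weight \<open>count p n\<close>, and these weights add up to
  \<open>size p\<close>. The assumption on \<open>c 0\<close> disposes of multisets that contain
  0.\<close>

lemma exp_creation_power:
  assumes "c 0 = 0"
  shows "((\<lambda>\<Phi> p. \<Sum>\<^sub>\<infinity>n\<in>{1::nat..}. c n * heis \<beta> (- int n) \<Phi> p) ^^ k) vac p
    = (if size p = k then fact k * coh c p else 0)"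
proof (induction k arbitrary: p)
  case 0
  then show ?case by (auto simp: vac_def coh_def)
next
  case (Suc k)
  let ?U = "\<lambda>\<Phi> p. \<Sum>\<^sub>\<infinity>n\<in>{1::nat..}. c n * heis \<beta> (- int n) \<Phi> p"
  define \<Phi> where "\<Phi> = (?U ^^ k) vac"
  have IH: "\<Phi> r = (if size r = k then fact k * coh c r else 0)" for r
    unfolding \<Phi>_def by (rule Suc.IH)
  have "?U \<Phi> p = (\<Sum>\<^sub>\<infinity>n\<in>set_mset p. c n * \<Phi> (p - {#n#}))"
    by (rule infsum_cong_neutral) (auto simp: heis_def assms not_less_eq_eq)
  also have "\<dots> = (\<Sum>n\<in>set_mset p. if size p = Suc k then fact k * (of_nat (count p n) * coh c p) else 0)"
    unfolding infsum_finite[OF finite_set_mset]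
  proof (rule sum.cong[OF refl])
    fix n assume n: "n \<in># p"
    then have "size (p - {#n#}) = k \<longleftrightarrow> size p = Suc k"
      by (metis Suc_pred size_Diff_singleton nonempty_has_size diff_Suc_1 empty_iff set_mset_empty)
    then show "c n * \<Phi> (p - {#n#}) = (if size p = Suc k then fact k * (of_nat (count p n) * coh c p) else 0)"
      using coh_remove[OF n, of c] by (auto simp: IH)
  qed
  also have "\<dots> = (if size p = Suc k then fact k * (of_nat (\<Sum>n\<in>set_mset p. count p n) * coh c p) else 0)"
    by (simp add: sum_distrib_left sum_distrib_right)
  also have "(\<Sum>n\<in>set_mset p. count p n) = size p"
    by (simp add: size_multiset_overloaded_eq)
  finally show ?case by (simp add: \<Phi>_def mult_ac)
qed

section \<open>Coherent states of charged points\<close>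

definition power_sum :: "(nat \<Rightarrow> complex) \<Rightarrow> nat \<Rightarrow> (nat \<Rightarrow> complex) \<Rightarrow> nat \<Rightarrow> complex" where
  "power_sum q T z n = (\<Sum>s\<in>{1..T}. q s * z s ^ n)"

definition coh_pt :: "(nat \<Rightarrow> complex) \<Rightarrow> nat \<Rightarrow> (nat \<Rightarrow> complex) \<Rightarrow> fock" where
  "coh_pt q T z = coh (\<lambda>n. 1 / of_nat n * power_sum q T z n)"

text \<open>
  The \<open>w\<^sub>r\<close> and \<open>x\<^sub>i\<close> are treated alike, as points with charges \<open>\<alpha>\<^sub>-\<close> and \<open>\<alpha>\<close>: the point with
  index \<open>r \<le> L\<close> is \<open>w\<^sub>r\<close>, and the point with index \<open>L + i\<close> is \<open>x\<^sub>i\<close>. The exponents of \<open>h\<close> are then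
  twice the products of the charges.
\<close>

definition charge :: "real \<Rightarrow> nat \<Rightarrow> nat \<Rightarrow> complex" where
  "charge \<kappa> L s = of_real (if s \<le> L then alpha_minus \<kappa> else alpha \<kappa>)"

definition config :: "nat \<Rightarrow> (nat \<Rightarrow> real) \<Rightarrow> (nat \<Rightarrow> complex) \<Rightarrow> nat \<Rightarrow> complex" where
  "config L x w s = (if s \<in> {1..L} then w s else of_real (x (s - L)))"

lemma sum_split_config:
  "(\<Sum>s\<in>{1..L + N}. g s) = (\<Sum>r\<in>{1..L}. g r) + (\<Sum>i\<in>{1..N}. g (L + i))" for g :: "nat \<Rightarrow> 'a::comm_monoid_add"
proof -
  have "{1..L + N} = {1..L} \<union> (\<lambda>i. L + i) ` {1..N}"
    by (auto simp: image_iff intro!: bexI[of _ "_ - L"])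
  moreover have "{1..L} \<inter> (\<lambda>i. L + i) ` {1..N} = {}" by auto
  moreover have "sum g ((\<lambda>i. L + i) ` {1..N}) = (\<Sum>i\<in>{1..N}. g (L + i))"
    by (subst sum.reindex) auto
  ultimately show ?thesis
    by (simp only: sum.union_disjoint finite_atLeastAtMost finite_imageI)
qed

lemma power_sum_config:
  "power_sum (charge \<kappa> L) (L + N) (config L x w) n
    = of_real (alpha \<kappa>) * (\<Sum>i=1..N. of_real (x i) ^ n) + of_real (alpha_minus \<kappa>) * (\<Sum>r=1..L. w r ^ n)"
  unfolding power_sum_def sum_split_config
  by (simp add: charge_def config_def sum_distrib_left add.commute)

lemma power_sum_config_0: "power_sum (charge \<kappa> L) (L + N) z 0 = of_real (beta \<kappa> N L)"
  unfolding power_sum_def sum_split_config by (simp add: charge_def beta_def)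

lemma U_minus_coh: "U_minus \<kappa> N L x w vac p = coh_pt (charge \<kappa> L) (L + N) (config L x w) p"
proof -
  define c where "c n = 1 / of_nat n * power_sum (charge \<kappa> L) (L + N) (config L x w) n" for n
  have U: "U_exponent \<kappa> N L x w = (\<lambda>\<Phi> p. \<Sum>\<^sub>\<infinity>n\<in>{1::nat..}. c n * heis (beta \<kappa> N L) (- int n) \<Phi> p)"
    by (intro ext) (simp only: U_exponent_def c_def power_sum_config)
  \<comment> \<open>Division by zero gives 0, which is the value that
    \<open>exp_creation_power\<close> asks for.\<close>
  have "c 0 = 0" by (simp add: c_def)
  have "(\<lambda>k. (U_exponent \<kappa> N L x w ^^ k) vac p / fact k) = (\<lambda>k. if k = size p then coh c p else 0)"
    unfolding U exp_creation_power[where c=c, OF \<open>c 0 = 0\<close>] by auto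
  then have "(\<lambda>k. (U_exponent \<kappa> N L x w ^^ k) vac p / fact k) sums coh c p"
    using sums_single[of "size p" "\<lambda>_. coh c p"] by simp
  then show ?thesis
    unfolding U_minus_def coh_pt_def c_def[abs_def] by (rule sums_unique[symmetric])
qed

text \<open>An annihilator acts as \<open>2 n\<close> times the derivative in the
  \<open>n\<close>-th creator, and \<open>2 n\<close> meets the factor \<open>1 / n\<close> of the
  exponent. That the total charge is \<open>\<beta>\<close> extends the formula to
  \<open>n = 0\<close>, so the zero mode needs no separate treatment.\<close>

lemma heis_coh_pt_pos:
  assumes "of_real \<beta> = power_sum q T z 0"
  shows "heis \<beta> (int n) (coh_pt q T z) = (\<lambda>p. 2 * power_sum q T z n * coh_pt q T z p)"
proof
  fix p
  show "heis \<beta> (int n) (coh_pt q T z) p = 2 * power_sum q T z n * coh_pt q T z p"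
  proof (cases "n = 0")
    case True
    then show ?thesis using assms by (simp add: heis_def)
  next
    case False
    then show ?thesis by (simp add: heis_def coh_pt_def coh_add_mset del: of_nat_Suc)
  qed
qed

text \<open>Creators do not depend on the charge of the vacuum; the argument 0 of
  \<open>heis\<close> is an arbitrary choice that removes the parameter.\<close>

definition create :: "nat \<Rightarrow> fock \<Rightarrow> fock" where
  "create n = heis 0 (- int n)"

lemma create_heis: "n > 0 \<Longrightarrow> heis \<beta> (- int n) = create n"
  by (intro ext) (simp add: create_def heis_def)

lemma create_apply: "n > 0 \<Longrightarrow> create n \<Phi> p = (if n \<in># p then \<Phi> (p - {#n#}) else 0)"
  by (simp add: create_def heis_def)

lemma create_eq_0: "sum_mset p < n \<Longrightarrow> create n \<Phi> p = 0"
  unfolding create_def by (rule heis_neg_wt) (simp add: wt_def del: of_nat_sum_mset)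

lemma create_create_eq_0: "sum_mset p < a + b \<Longrightarrow> create a (create b \<Phi>) p = 0"
  unfolding create_def
  by (rule heis_eq_0, rule heis_neg_wt) (simp add: wt_def del: of_nat_sum_mset)

lemma fin_lin_create: "fin_lin (\<lambda>\<Phi>. create n \<Phi> p)"
  unfolding create_def by (rule fin_lin_heis)

text \<open>
  The creation half \<open>\<Sum>n. \<zeta>\<^bsup>n-1\<^esup> a\<^bsub>-n\<^esub>\<close> of the Heisenberg current and its \<open>\<zeta>\<close>-derivative.
\<close>

definition current :: "complex \<Rightarrow> fock \<Rightarrow> fock" where
  "current \<zeta> \<Phi> p = (\<Sum>n\<in>{1..sum_mset p}. \<zeta> ^ (n - 1) * create n \<Phi> p)"

definition dcurrent :: "complex \<Rightarrow> fock \<Rightarrow> fock" where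
  "dcurrent \<zeta> \<Phi> p = (\<Sum>n\<in>{1..sum_mset p}. of_nat (n - 1) * \<zeta> ^ (n - 2) * create n \<Phi> p)"

lemma fin_lin_current: "fin_lin (\<lambda>\<Phi>. current \<zeta> \<Phi> p)"
  unfolding current_def by (intro fin_lin_sum fin_lin_cmult fin_lin_create)

lemma current_upto:
  assumes "sum_mset p \<le> B"
  shows "current \<zeta> \<Phi> p = (\<Sum>n\<in>{1..B}. \<zeta> ^ (n - 1) * create n \<Phi> p)"
  unfolding current_def
  by (rule sum.mono_neutral_left) (use assms in \<open>auto simp: create_eq_0\<close>)

lemma dcurrent_upto:
  assumes "sum_mset p \<le> B"
  shows "dcurrent \<zeta> \<Phi> p = (\<Sum>n\<in>{1..B}. of_nat (n - 1) * \<zeta> ^ (n - 2) * create n \<Phi> p)"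
  unfolding dcurrent_def
  by (rule sum.mono_neutral_left) (use assms in \<open>auto simp: create_eq_0\<close>)

lemma current_current:
  assumes "sum_mset p \<le> B"
  shows "current \<zeta> (current \<zeta> \<Phi>) p
    = (\<Sum>a\<in>{1..B}. \<Sum>b\<in>{1..B}. \<zeta> ^ (a + b - 2) * create a (create b \<Phi>) p)"
proof -
  have "create a (current \<zeta> \<Phi>) p = (\<Sum>b\<in>{1..B}. \<zeta> ^ (b - 1) * create a (create b \<Phi>) p)" for a
  proof -
    have "create a (current \<zeta> \<Phi>) p = create a (\<lambda>q. \<Sum>b\<in>{1..B}. \<zeta> ^ (b - 1) * create b \<Phi> q) p"
      unfolding create_def[of a]
    proof (rule heis_local)
      fix q assume "wt q = wt p + - int a"
      then have "sum_mset q \<le> B" using assms by (simp add: wt_def del: of_nat_sum_mset)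
      then show "current \<zeta> \<Phi> q = (\<Sum>b\<in>{1..B}. \<zeta> ^ (b - 1) * create b \<Phi> q)" by (rule current_upto)
    qed
    also have "\<dots> = (\<Sum>b\<in>{1..B}. \<zeta> ^ (b - 1) * create a (create b \<Phi>) p)"
      by (rule fin_lin_linear[OF fin_lin_create]) simp
    finally show ?thesis .
  qed
  moreover have "\<zeta> ^ (a - 1) * \<zeta> ^ (b - 1) = \<zeta> ^ (a + b - 2)" if "a \<in> {1..B}" "b \<in> {1..B}" for a b
    using that by (simp add: power_add[symmetric] numeral_2_eq_2)
  ultimately show ?thesis
    unfolding current_upto[OF assms, of \<zeta> "current \<zeta> \<Phi>"]
    by (auto simp: sum_distrib_left mult.assoc[symmetric] intro!: sum.cong)
qed

section \<open>The Virasoro generators on coherent states\<close>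

lemma sum_int_to_nat: "(\<Sum>j\<in>{0..int s}. g j) = (\<Sum>j\<le>s. g (int j))" for g :: "int \<Rightarrow> 'a::comm_monoid_add"
  by (rule sum.reindex_bij_witness[of _ int nat]) auto

text \<open>The sum over \<open>j\<close> falls into three blocks. For \<open>- m < j < 0\<close>
  both factors create. For \<open>j \<ge> 0\<close> the inner factor is an annihilator and becomes a
  power sum. The block \<open>j \<le> - m\<close> is the mirror image of the second under
  \<open>j \<mapsto> - m - j\<close>, since the factors commute; this doubles the mixed terms and,
  with the factor 1/4 of the generator, leaves coefficient 1.\<close>

lemma vir_coh_pt:
  assumes b: "of_real \<beta> = power_sum q T z 0" and m: "m > 0" and B: "sum_mset p \<le> B"
  shows "vir \<kappa> \<beta> (- int m) (coh_pt q T z) p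
    = (1/4) * (\<Sum>b\<in>{1..<m}. create (m - b) (create b (coh_pt q T z)) p)
      + (\<Sum>j\<le>B. power_sum q T z j * create (m + j) (coh_pt q T z) p)
      + of_real (alpha0 \<kappa>) * of_nat (m - 1) * create m (coh_pt q T z) p"
proof -
  let ?e = "coh_pt q T z"
  let ?t = "\<lambda>j. heis \<beta> (- int m - j) (heis \<beta> j ?e) p"
  \<comment> \<open>With this window the reflected block runs exactly over the indices from 0 to
    \<open>B\<close>.\<close>
  define s where "s = m + B"
  have "{- int s..int s} = {- int s..- int m} \<union> ({- int m + 1..-1} \<union> {0..int s})"
    using m by (auto simp: s_def)
  then have "(\<Sum>j\<in>{- int s..int s}. ?t j) = (\<Sum>j\<in>{- int s..- int m}. ?t j)
     + ((\<Sum>j\<in>{- int m + 1..-1}. ?t j) + (\<Sum>j\<in>{0..int s}. ?t j))"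
    using m by (subst sum.union_disjoint[symmetric], auto)+
  also have "(\<Sum>j\<in>{0..int s}. ?t j) = (\<Sum>j\<le>s. 2 * (power_sum q T z j * create (m + j) ?e p))"
    unfolding sum_int_to_nat
  proof (rule sum.cong[OF refl])
    fix j
    have "heis \<beta> (- int m - int j) = create (m + j)" using m create_heis[of "m + j" \<beta>] by simp
    then have "?t (int j) = create (m + j) (\<lambda>p. 2 * power_sum q T z j * ?e p) p"
      using heis_coh_pt_pos[OF b, of j] by simp
    also have "create (m + j) (\<lambda>p. 2 * power_sum q T z j * ?e p) p = 2 * power_sum q T z j * create (m + j) ?e p"
      using fin_lin_linear2[OF fin_lin_create[of "m+j" p], of "2 * power_sum q T z j" ?e 0 ?e] by simp
    finally show "?t (int j) = 2 * (power_sum q T z j * create (m + j) ?e p)" by (simp add: mult.assoc)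
  qed
  also have "\<dots> = (\<Sum>j\<le>B. 2 * (power_sum q T z j * create (m + j) ?e p))"
    by (rule sum.mono_neutral_right) (use B m in \<open>auto simp: s_def create_eq_0\<close>)
  also have "(\<Sum>j\<in>{- int s..- int m}. ?t j) = (\<Sum>j\<in>{0..int B}. ?t j)"
  proof (rule sum.reindex_bij_witness[of _ "\<lambda>j. - int m - j" "\<lambda>j. - int m - j"])
    fix j assume "j \<in> {- int s..- int m}"
    show "?t (- int m - j) = ?t j"
      using heis_comm[of \<beta> "- int m - j" j ?e p] m by simp
  qed (auto simp: s_def)
  also have "\<dots> = (\<Sum>j\<le>B. 2 * (power_sum q T z j * create (m + j) ?e p))"
    unfolding sum_int_to_nat
  proof (rule sum.cong[OF refl])
    fix j
    have "heis \<beta> (- int m - int j) = create (m + j)" using m create_heis[of "m + j" \<beta>] by simp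
    then have "?t (int j) = create (m + j) (\<lambda>p. 2 * power_sum q T z j * ?e p) p"
      using heis_coh_pt_pos[OF b, of j] by simp
    also have "create (m + j) (\<lambda>p. 2 * power_sum q T z j * ?e p) p = 2 * power_sum q T z j * create (m + j) ?e p"
      using fin_lin_linear2[OF fin_lin_create[of "m+j" p], of "2 * power_sum q T z j" ?e 0 ?e] by simp
    finally show "?t (int j) = 2 * (power_sum q T z j * create (m + j) ?e p)" by (simp add: mult.assoc)
  qed
  also have "(\<Sum>j\<in>{- int m + 1..-1}. ?t j) = (\<Sum>b\<in>{1..<m}. create (m - b) (create b ?e) p)"
  proof (rule sum.reindex_bij_witness[of _ "\<lambda>b. - int b" "\<lambda>j. nat (- j)"])
    fix j assume j: "j \<in> {- int m + 1..-1}"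
    define b where "b = nat (- j)"
    have b: "j = - int b" "b > 0" "b < m" using j by (auto simp: b_def)
    then have "- int m - j = - int (m - b)" by simp
    then show "create (m - nat (- j)) (create (nat (- j)) ?e) p = ?t j"
      using b create_heis[of b \<beta>] create_heis[of "m - b" \<beta>] by simp
  qed (use m in auto)
  finally have S: "(\<Sum>j\<in>{- int s..int s}. ?t j)
     = (\<Sum>b\<in>{1..<m}. create (m - b) (create b ?e) p) + 4 * (\<Sum>j\<le>B. power_sum q T z j * create (m + j) ?e p)"
    by (simp add: sum_distrib_left[symmetric])
  have "wt p \<le> int s" using B by (simp add: s_def wt_def del: of_nat_sum_mset)
  then have "vir \<kappa> \<beta> (- int m) ?e p = vir_trunc \<kappa> \<beta> (int s) (- int m) ?e p"
    using m by (intro vir_eq_trunc) auto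
  then show ?thesis
    unfolding vir_trunc_def S using m
    by (simp add: create_heis of_nat_diff algebra_simps)
qed

text \<open>The power \<open>m - 2\<close> splits as \<open>(a - 1) + (b - 1)\<close> for
  \<open>m = a + b\<close>, which turns the pure creation terms into the square of the current. The
  mixed terms are collected by \<open>n = m + j\<close>. Completing the ranges is harmless, as
  creations of total size above \<open>B\<close> vanish at \<open>p\<close>.\<close>

lemma vir_coh_pt_sum:
  assumes b: "of_real \<beta> = power_sum q T z 0" and B: "sum_mset p \<le> B"
  shows "(\<Sum>k\<in>{- int B..-2}. \<zeta> ^ nat (- 2 - k) * vir \<kappa> \<beta> k (coh_pt q T z) p)
    = (1/4) * current \<zeta> (current \<zeta> (coh_pt q T z)) p + of_real (alpha0 \<kappa>) * dcurrent \<zeta> (coh_pt q T z) p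
      + (\<Sum>n\<in>{1..B}. (\<Sum>j<n - 1. \<zeta> ^ (n - 2 - j) * power_sum q T z j) * create n (coh_pt q T z) p)"
proof -
  let ?e = "coh_pt q T z"
  have d0: "n \<le> B" if "create n ?e p \<noteq> 0" for n
    using B that create_eq_0[of p n ?e] by linarith
  have c0: "a + b \<le> B" if "create a (create b ?e) p \<noteq> 0" for a b
    using B that create_create_eq_0[of p a b ?e] by linarith
  have "(\<Sum>k\<in>{- int B..-2}. \<zeta> ^ nat (- 2 - k) * vir \<kappa> \<beta> k ?e p)
     = (\<Sum>m\<in>{2..B}. \<zeta> ^ (m - 2) * vir \<kappa> \<beta> (- int m) ?e p)"
  proof (rule sum.reindex_bij_witness[of _ "\<lambda>m. - int m" "\<lambda>k. nat (- k)"])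
    fix k :: int assume k: "k \<in> {- int B..-2}"
    then have "nat (- 2 - k) = nat (- k) - 2" by auto
    then show "\<zeta> ^ (nat (- k) - 2) * vir \<kappa> \<beta> (- int (nat (- k))) ?e p = \<zeta> ^ nat (- 2 - k) * vir \<kappa> \<beta> k ?e p"
      using k by simp
  qed auto
  also have "\<dots> = (1/4) * (\<Sum>m\<in>{2..B}. \<Sum>b\<in>{1..<m}. \<zeta> ^ (m - 2) * create (m - b) (create b ?e) p)
      + of_real (alpha0 \<kappa>) * (\<Sum>m\<in>{2..B}. of_nat (m - 1) * \<zeta> ^ (m - 2) * create m ?e p)
      + (\<Sum>m\<in>{2..B}. \<Sum>j\<le>B. \<zeta> ^ (m - 2) * power_sum q T z j * create (m + j) ?e p)"
    unfolding sum_distrib_left sum.distrib[symmetric]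
    by (intro sum.cong[OF refl], subst vir_coh_pt[OF b _ B]) (auto simp: algebra_simps sum_distrib_left sum_divide_distrib)
  also have "(\<Sum>m\<in>{2..B}. of_nat (m - 1) * \<zeta> ^ (m - 2) * create m ?e p) = dcurrent \<zeta> ?e p"
    unfolding dcurrent_upto[OF B]
  proof (rule sum.mono_neutral_left)
    show "\<forall>n\<in>{1..B} - {2..B}. of_nat (n - 1) * \<zeta> ^ (n - 2) * create n ?e p = 0"
    proof
      fix n assume "n \<in> {1..B} - {2..B}"
      then have "n = 1" by auto
      then show "of_nat (n - 1) * \<zeta> ^ (n - 2) * create n ?e p = 0" by simp
    qed
  qed auto
  also have "(\<Sum>m\<in>{2..B}. \<Sum>b\<in>{1..<m}. \<zeta> ^ (m - 2) * create (m - b) (create b ?e) p) = current \<zeta> (current \<zeta> ?e) p"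
  proof -
    have "current \<zeta> (current \<zeta> ?e) p
      = (\<Sum>(a,b)\<in>{1..B}\<times>{1..B}. \<zeta> ^ (a + b - 2) * create a (create b ?e) p)"
      unfolding current_current[OF B] by (rule sum.cartesian_product)
    also have "\<dots> = (\<Sum>(a,b)\<in>{(a,b). a \<ge> 1 \<and> b \<ge> 1 \<and> a + b \<le> B}. \<zeta> ^ (a + b - 2) * create a (create b ?e) p)"
      by (rule sum.mono_neutral_right) (auto dest: c0)
    also have "\<dots> = (\<Sum>(m,b)\<in>(SIGMA m:{2..B}. {1..<m}). \<zeta> ^ (m - 2) * create (m - b) (create b ?e) p)"
      by (rule sum.reindex_bij_witness[of _ "\<lambda>(m,b). (m - b, b)" "\<lambda>(a,b). (a + b, b)"]) auto
    also have "\<dots> = (\<Sum>m\<in>{2..B}. \<Sum>b\<in>{1..<m}. \<zeta> ^ (m - 2) * create (m - b) (create b ?e) p)"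
      by (rule sum.Sigma[symmetric]) auto
    finally show ?thesis by simp
  qed
  also have "(\<Sum>m\<in>{2..B}. \<Sum>j\<le>B. \<zeta> ^ (m - 2) * power_sum q T z j * create (m + j) ?e p)
     = (\<Sum>n\<in>{1..B}. (\<Sum>j<n - 1. \<zeta> ^ (n - 2 - j) * power_sum q T z j) * create n ?e p)"
  proof -
    have "(\<Sum>m\<in>{2..B}. \<Sum>j\<le>B. \<zeta> ^ (m - 2) * power_sum q T z j * create (m + j) ?e p)
      = (\<Sum>(m,j)\<in>{2..B}\<times>{..B}. \<zeta> ^ (m - 2) * power_sum q T z j * create (m + j) ?e p)"
      by (rule sum.cartesian_product)
    also have "\<dots> = (\<Sum>(m,j)\<in>{(m,j). m \<ge> 2 \<and> m + j \<le> B}. \<zeta> ^ (m - 2) * power_sum q T z j * create (m + j) ?e p)"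
      by (rule sum.mono_neutral_right) (auto dest!: d0)
    also have "\<dots> = (\<Sum>(n,j)\<in>(SIGMA n:{1..B}. {..<n-1}). \<zeta> ^ (n - 2 - j) * power_sum q T z j * create n ?e p)"
      by (rule sum.reindex_bij_witness[of _ "\<lambda>(n,j). (n - j, j)" "\<lambda>(m,j). (m + j, j)"]) (auto simp: diff_commute)
    also have "\<dots> = (\<Sum>n\<in>{1..B}. \<Sum>j<n - 1. \<zeta> ^ (n - 2 - j) * power_sum q T z j * create n ?e p)"
      by (rule sum.Sigma[symmetric]) auto
    finally show ?thesis by (simp add: sum_distrib_right)
  qed
  finally show ?thesis .
qed

lemma power_diff_quotient:
  fixes \<zeta> w :: complex
  assumes "\<zeta> \<noteq> w" "n \<ge> 1"
  shows "(\<Sum>j<n - 1. \<zeta> ^ (n - 2 - j) * w ^ j) = (\<zeta> ^ (n - 1) - w ^ (n - 1)) / (\<zeta> - w)"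
proof -
  have "\<zeta> ^ (n - 1) - w ^ (n - 1) = (\<zeta> - w) * (\<Sum>j<n - 1. w ^ j * \<zeta> ^ (n - 1 - Suc j))"
    using power_diff_sumr2[of w "n - 1" \<zeta>] by (simp add: algebra_simps)
  also have "(\<Sum>j<n - 1. w ^ j * \<zeta> ^ (n - 1 - Suc j)) = (\<Sum>j<n - 1. \<zeta> ^ (n - 2 - j) * w ^ j)"
    by (rule sum.cong) (auto simp: mult.commute diff_diff_left numeral_2_eq_2)
  finally show ?thesis using assms by (simp add: field_simps)
qed

text \<open>Splitting the power sums by points, the inner sum for a point \<open>s\<close> is the
  divided difference of \<open>\<zeta>^(n - 1)\<close> between \<open>z i\<close> and
  \<open>z s\<close>. For \<open>s = i\<close> it degenerates to the derivative, which is the origin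
  of the extra \<open>dcurrent\<close> term.\<close>

lemma divided_difference_current:
  assumes B: "sum_mset p \<le> B" and i: "i \<in> {1..T}" and dist: "\<And>s. s \<in> {1..T} - {i} \<Longrightarrow> z s \<noteq> z i"
  shows "(\<Sum>n\<in>{1..B}. (\<Sum>j<n - 1. z i ^ (n - 2 - j) * power_sum q T z j) * create n \<Phi> p)
    = q i * dcurrent (z i) \<Phi> p
      + (\<Sum>s\<in>{1..T} - {i}. q s * ((current (z i) \<Phi> p - current (z s) \<Phi> p) / (z i - z s)))"
proof -
  define D where "D s n = (\<Sum>j<n - 1. z i ^ (n - 2 - j) * z s ^ j)" for s n
  have "(\<Sum>n\<in>{1..B}. (\<Sum>j<n - 1. z i ^ (n - 2 - j) * power_sum q T z j) * create n \<Phi> p)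
     = (\<Sum>n\<in>{1..B}. \<Sum>s\<in>{1..T}. q s * (D s n * create n \<Phi> p))"
  proof (rule sum.cong[OF refl])
    fix n
    have "(\<Sum>j<n - 1. z i ^ (n - 2 - j) * power_sum q T z j) = (\<Sum>s\<in>{1..T}. q s * D s n)"
      unfolding power_sum_def D_def sum_distrib_left by (subst sum.swap) (simp add: mult_ac)
    then show "(\<Sum>j<n - 1. z i ^ (n - 2 - j) * power_sum q T z j) * create n \<Phi> p = (\<Sum>s\<in>{1..T}. q s * (D s n * create n \<Phi> p))"
      by (simp add: sum_distrib_right mult.assoc)
  qed
  also have "\<dots> = (\<Sum>s\<in>{1..T}. q s * (\<Sum>n\<in>{1..B}. D s n * create n \<Phi> p))"
    by (subst sum.swap) (simp add: sum_distrib_left)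
  also have "\<dots> = q i * (\<Sum>n\<in>{1..B}. D i n * create n \<Phi> p) + (\<Sum>s\<in>{1..T} - {i}. q s * (\<Sum>n\<in>{1..B}. D s n * create n \<Phi> p))"
    using i by (subst sum.remove[of _ i]) auto
  also have "(\<Sum>n\<in>{1..B}. D i n * create n \<Phi> p) = dcurrent (z i) \<Phi> p"
    unfolding dcurrent_upto[OF B]
  proof (rule sum.cong[OF refl])
    fix n
    have "D i n = (\<Sum>j<n - 1. z i ^ (n - 2))"
      unfolding D_def by (rule sum.cong) (auto simp: power_add[symmetric])
    then show "D i n * create n \<Phi> p = of_nat (n - 1) * z i ^ (n - 2) * create n \<Phi> p" by simp
  qed
  also have "(\<Sum>s\<in>{1..T} - {i}. q s * (\<Sum>n\<in>{1..B}. D s n * create n \<Phi> p))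
    = (\<Sum>s\<in>{1..T} - {i}. q s * ((current (z i) \<Phi> p - current (z s) \<Phi> p) / (z i - z s)))"
  proof (rule sum.cong[OF refl])
    fix s assume s: "s \<in> {1..T} - {i}"
    have "(\<Sum>n\<in>{1..B}. D s n * create n \<Phi> p) = (current (z i) \<Phi> p - current (z s) \<Phi> p) / (z i - z s)"
      unfolding current_upto[OF B] sum_subtractf[symmetric] sum_divide_distrib
    proof (rule sum.cong[OF refl])
      fix n assume "n \<in> {1..B}"
      then have "D s n = (z i ^ (n - 1) - z s ^ (n - 1)) / (z i - z s)"
        unfolding D_def using dist[OF s] by (intro power_diff_quotient) auto
      then show "D s n * create n \<Phi> p = (z i ^ (n - 1) * create n \<Phi> p - z s ^ (n - 1) * create n \<Phi> p) / (z i - z s)"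
        by (simp add: left_diff_distrib)
    qed
    then show "q s * (\<Sum>n\<in>{1..B}. D s n * create n \<Phi> p) = q s * ((current (z i) \<Phi> p - current (z s) \<Phi> p) / (z i - z s))" by simp
  qed
  finally show ?thesis .
qed

section \<open>The null vector identity\<close>

text \<open>The logarithmic derivative of \<open>h\<close> in the point \<open>z\<^sub>s\<close>, and the derivative of that.\<close>

definition dlog :: "(nat \<Rightarrow> complex) \<Rightarrow> nat \<Rightarrow> (nat \<Rightarrow> complex) \<Rightarrow> nat \<Rightarrow> complex" where
  "dlog q T z s = (\<Sum>t\<in>{1..T} - {s}. 2 * q s * q t / (z s - z t))"

definition ddlog :: "(nat \<Rightarrow> complex) \<Rightarrow> nat \<Rightarrow> (nat \<Rightarrow> complex) \<Rightarrow> nat \<Rightarrow> complex" where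
  "ddlog q T z s = - (\<Sum>t\<in>{1..T} - {s}. 2 * q s * q t / (z s - z t)\<^sup>2)"

lemma sum_offdiag_swap:
  fixes g :: "'a \<Rightarrow> 'a \<Rightarrow> complex"
  assumes "finite R"
  shows "(\<Sum>s\<in>R. \<Sum>t\<in>R - {s}. g s t) = (\<Sum>s\<in>R. \<Sum>t\<in>R - {s}. g t s)"
proof -
  have *: "(\<Sum>s\<in>R. \<Sum>t\<in>R - {s}. g s t) = (\<Sum>s\<in>R. \<Sum>t\<in>R. if t = s then 0 else g s t)" for g :: "'a \<Rightarrow> 'a \<Rightarrow> complex"
    by (intro sum.cong[OF refl] sum.mono_neutral_cong_left) (use assms in auto)
  show ?thesis unfolding * by (subst sum.swap) (auto intro!: sum.cong)
qed

lemma alpha_facts: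
  assumes "\<kappa> > 0"
  shows "(of_real \<kappa> :: complex) * (of_real (alpha \<kappa>))\<^sup>2 = 1" "alpha_minus \<kappa> = - 2 * alpha \<kappa>"
    "alpha0 \<kappa> = \<kappa> * alpha \<kappa> / 4 - alpha \<kappa>"
proof -
  have "\<kappa> * (alpha \<kappa>)\<^sup>2 = 1" using assms by (simp add: alpha_def power_divide)
  then show "(of_real \<kappa> :: complex) * (of_real (alpha \<kappa>))\<^sup>2 = 1"
    by (metis of_real_1 of_real_mult of_real_power)
  show "alpha_minus \<kappa> = - 2 * alpha \<kappa>" by (simp add: alpha_def alpha_minus_def)
  have "sqrt \<kappa> = \<kappa> * alpha \<kappa>" using assms by (simp add: alpha_def real_div_sqrt)
  then show "alpha0 \<kappa> = \<kappa> * alpha \<kappa> / 4 - alpha \<kappa>"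
    by (simp add: alpha0_def alpha_def field_simps)
qed

lemma sum_square_diag:
  fixes g :: "'a \<Rightarrow> complex"
  assumes "finite R"
  shows "(\<Sum>s\<in>R. g s)\<^sup>2 = (\<Sum>s\<in>R. \<Sum>t\<in>R - {s}. g s * g t) + (\<Sum>s\<in>R. (g s)\<^sup>2)"
proof -
  have "(\<Sum>s\<in>R. g s)\<^sup>2 = (\<Sum>s\<in>R. \<Sum>t\<in>R. g s * g t)"
    by (simp add: power2_eq_square sum_product)
  also have "\<dots> = (\<Sum>s\<in>R. g s * g s + (\<Sum>t\<in>R - {s}. g s * g t))"
    by (intro sum.cong[OF refl] sum.remove) (use assms in auto)
  finally show ?thesis by (simp add: sum.distrib power2_eq_square)
qed

text \<open>This is the equation for \<open>h\<close> alone, divided by \<open>h\<close>, including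
  the derivative of the prefactor in the screening points. Partial fractions cancel the sum over
  pairs of points other than \<open>i\<close>. The rest is a combination of \<open>UX\<close> and
  \<open>UW\<close>, and both coefficients vanish by \<open>k * a\<^sup>2 = 1\<close>.\<close>

lemma null_vector_scalar:
  fixes \<kappa> :: real and N L T i :: nat and z :: "nat \<Rightarrow> complex"
  defines "q \<equiv> charge \<kappa> L"
  assumes \<kappa>: "\<kappa> > 0" and T: "T = L + N" and i: "i \<in> {L + 1..T}" and inj: "inj_on z {1..T}"
  shows "of_real (\<kappa> / 2) * ((dlog q T z i)\<^sup>2 + ddlog q T z i)
     + (\<Sum>s\<in>{1..T} - {i}. 2 / (z s - z i) * dlog q T z s)
     + (\<Sum>j\<in>{L + 1..T} - {i}. of_real ((\<kappa> - 6) / \<kappa>) / (z j - z i)\<^sup>2)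
     - (\<Sum>r\<in>{1..L}. 2 / (z r - z i)\<^sup>2) = 0"
proof -
  define R where "R = {1..T} - {i}"
  define u where "u s = 1 / (z s - z i)" for s
  define a where "a = (of_real (alpha \<kappa>) :: complex)"
  define k where "k = (of_real \<kappa> :: complex)"
  have ka: "k * a\<^sup>2 = 1" unfolding k_def a_def by (rule alpha_facts(1)[OF \<kappa>])
  have k0: "k \<noteq> 0" using \<kappa> by (simp add: k_def)
  have qi: "q i = a" using i by (simp add: q_def charge_def a_def)
  have R: "finite R" by (simp add: R_def)
  have ne: "z s \<noteq> z t" if "s \<in> {1..T}" "t \<in> {1..T}" "s \<noteq> t" for s t
    using inj that by (auto dest: inj_onD)
  have d1: "dlog q T z i = - 2 * a * (\<Sum>t\<in>R. q t * u t)"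
  proof -
    have "2 * q i * q t / (z i - z t) = - 2 * a * (q t * u t)" for t
      using minus_divide_right[of "2 * a * q t" "z t - z i"] by (simp add: qi u_def)
    then show ?thesis unfolding dlog_def R_def[symmetric] by (simp add: sum_distrib_left)
  qed
  have d2: "ddlog q T z i = - 2 * a * (\<Sum>t\<in>R. q t * (u t)\<^sup>2)"
  proof -
    have "2 * q i * q t / (z i - z t)\<^sup>2 = 2 * a * (q t * (u t)\<^sup>2)" for t
      by (simp add: qi u_def power2_commute[of "z i"] power_divide)
    then show ?thesis unfolding ddlog_def R_def[symmetric] by (simp add: sum_distrib_left sum_negf)
  qed
  define X where "X = (\<Sum>s\<in>R. \<Sum>t\<in>R - {s}. (q s * u s) * (q t * u t))"
  define Q where "Q = (\<Sum>s\<in>R. (q s * u s)\<^sup>2)"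
  define P where "P = (\<Sum>s\<in>R. q s * (u s)\<^sup>2)"
  have ds: "(\<Sum>s\<in>R. 2 / (z s - z i) * dlog q T z s) = 4 * a * P - 2 * X"
  proof -
    define g where "g s t = 4 * q s * q t * u s / (z s - z t)" for s t
    have "2 / (z s - z i) * dlog q T z s = 4 * a * (q s * (u s)\<^sup>2) + (\<Sum>t\<in>R - {s}. g s t)" if s: "s \<in> R" for s
    proof -
      have e: "{1..T} - {s} = insert i (R - {s})" and "i \<notin> R - {s}"
        using s i by (auto simp: R_def)
      then have "dlog q T z s = 2 * q s * a * u s + (\<Sum>t\<in>R - {s}. 2 * q s * q t / (z s - z t))"
        unfolding dlog_def e using R by (simp add: qi u_def)
      moreover have "2 / (z s - z i) = 2 * u s" by (simp add: u_def)
      ultimately show ?thesis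
        by (simp add: g_def sum_distrib_left distrib_left power2_eq_square mult_ac)
    qed
    then have "(\<Sum>s\<in>R. 2 / (z s - z i) * dlog q T z s) = 4 * a * P + (\<Sum>s\<in>R. \<Sum>t\<in>R - {s}. g s t)"
      by (simp add: sum.distrib P_def sum_distrib_left)
    \<comment> \<open>The summand is not symmetric in \<open>s\<close> and \<open>t\<close>. Adding
      its transpose brings in \<open>u s / (z s - z t) + u t / (z t - z s) = - u s * u t\<close>,
      which removes the differences not involving \<open>z i\<close>.\<close>
    moreover have "2 * (\<Sum>s\<in>R. \<Sum>t\<in>R - {s}. g s t) = - 4 * X"
    proof -
      have "2 * (\<Sum>s\<in>R. \<Sum>t\<in>R - {s}. g s t) = (\<Sum>s\<in>R. \<Sum>t\<in>R - {s}. g s t) + (\<Sum>s\<in>R. \<Sum>t\<in>R - {s}. g t s)"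
        using sum_offdiag_swap[OF R, of g] by simp
      also have "\<dots> = (\<Sum>s\<in>R. \<Sum>t\<in>R - {s}. g s t + g t s)" by (simp add: sum.distrib)
      also have "\<dots> = (\<Sum>s\<in>R. \<Sum>t\<in>R - {s}. - 4 * ((q s * u s) * (q t * u t)))"
      proof (intro sum.cong refl)
        fix s t assume "s \<in> R" "t \<in> R - {s}"
        then have "z s \<noteq> z t" "z s \<noteq> z i" "z t \<noteq> z i"
          using ne i by (auto simp: R_def)
        then have "u s / (z s - z t) + u t / (z t - z s) = - u s * u t"
          unfolding u_def by (simp add: divide_simps) (simp add: algebra_simps)
        then have "4 * q s * q t * (u s / (z s - z t) + u t / (z t - z s)) = 4 * q s * q t * (- u s * u t)" by simp
        then show "g s t + g t s = - 4 * ((q s * u s) * (q t * u t))"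
          unfolding g_def by (simp add: algebra_simps)
      qed
      finally show ?thesis by (simp add: X_def sum_distrib_left)
    qed
    ultimately show ?thesis by simp
  qed
  have XW: "R = ({L + 1..T} - {i}) \<union> {1..L}" "({L + 1..T} - {i}) \<inter> {1..L} = {}"
    using i T by (auto simp: R_def)
  have split: "sum g R = sum g ({L + 1..T} - {i}) + sum g {1..L}" for g :: "nat \<Rightarrow> complex"
    unfolding XW(1) by (rule sum.union_disjoint) (use XW(2) in auto)
  define UX where "UX = (\<Sum>s\<in>{L + 1..T} - {i}. (u s)\<^sup>2)"
  define UW where "UW = (\<Sum>s\<in>{1..L}. (u s)\<^sup>2)"
  have qW: "q s = - 2 * a" if "s \<in> {1..L}" for s
    using that alpha_facts(2)[OF \<kappa>] by (simp add: q_def charge_def a_def)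
  have qX: "q s = a" if "s \<in> {L + 1..T} - {i}" for s
    using that by (simp add: q_def charge_def a_def)
  have Q: "Q = a\<^sup>2 * UX + 4 * a\<^sup>2 * UW"
    unfolding Q_def split by (simp add: qW qX UX_def UW_def sum_distrib_left power_mult_distrib)
  have P: "P = a * UX - 2 * a * UW"
    unfolding P_def split by (simp add: qW qX UX_def UW_def sum_distrib_left sum_negf)
  \<comment> \<open>In this form the coefficient is polynomial in \<open>a\<close>, and no separate
    \<open>\<kappa>\<close> remains once \<open>k * a\<^sup>2\<close> is replaced by 1.\<close>
  have kk: "of_real ((\<kappa> - 6) / \<kappa>) = (1 - 6 * a\<^sup>2 :: complex)"
    using ka k0 by (simp add: k_def field_simps)
  have X1: "(\<Sum>j\<in>{L + 1..T} - {i}. of_real ((\<kappa> - 6) / \<kappa>) / (z j - z i)\<^sup>2) = (1 - 6 * a\<^sup>2) * UX"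
    unfolding kk UX_def u_def by (simp add: sum_distrib_left power_divide)
  have W1: "(\<Sum>r\<in>{1..L}. 2 / (z r - z i)\<^sup>2) = 2 * UW"
    unfolding UW_def u_def by (simp add: sum_distrib_left power_divide)
  have "of_real (\<kappa> / 2) * ((dlog q T z i)\<^sup>2 + ddlog q T z i) = 2 * (k * a\<^sup>2) * (X + Q) - k * a * P"
    unfolding d1 d2 P_def[symmetric] X_def Q_def sum_square_diag[OF R, symmetric]
    by (simp add: k_def power_mult_distrib algebra_simps)
  also have "k * a * P = (k * a\<^sup>2) * UX - 2 * (k * a\<^sup>2) * UW"
    unfolding P by (simp add: algebra_simps power2_eq_square)
  also have "2 * (k * a\<^sup>2) * (X + Q) - \<dots> = 2 * (X + Q) - UX + 2 * UW" unfolding ka by simp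
  finally show ?thesis
    unfolding R_def[symmetric] ds X1 W1 unfolding Q P by (simp add: algebra_simps power2_eq_square)
qed

text \<open>Since \<open>alpha0 \<kappa> + alpha \<kappa> = \<kappa> * alpha \<kappa> / 4\<close>,
  twice the Virasoro sum equals \<open>CC / 2 + k * a / 2 * D - 2 * Y * C i + 2 * Z\<close>. By
  \<open>k * a\<^sup>2 = 1\<close> the second derivative in \<open>z i\<close> supplies the first
  three terms, and the first derivatives in the other points supply the last. The scalar rest is
  \<open>null_vector_scalar\<close>. The right-hand side is minus the total derivative in the
  screening points with \<open>h\<close> divided out.\<close>

lemma null_vector_identity:
  fixes \<kappa> :: real and N L T i B :: nat and z :: "nat \<Rightarrow> complex" and p :: "nat multiset"
  defines "q \<equiv> charge \<kappa> L"
  defines "e \<equiv> coh_pt q T z"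
  assumes \<kappa>: "\<kappa> > 0" and T: "T = L + N" and i: "i \<in> {L + 1..T}" and inj: "inj_on z {1..T}" and B: "sum_mset p \<le> B"
  shows "of_real (\<kappa> / 2) * (((dlog q T z i)\<^sup>2 + ddlog q T z i) * e p
        + 2 * dlog q T z i * (q i * current (z i) e p)
        + q i * (dcurrent (z i) e p + q i * current (z i) (current (z i) e) p))
     + (\<Sum>j\<in>{L + 1..T} - {i}. 2 / (z j - z i) * (dlog q T z j * e p + q j * current (z j) e p)
          + of_real ((\<kappa> - 6) / \<kappa>) / (z j - z i)\<^sup>2 * e p)
     - 2 * (\<Sum>k\<in>{- int B..-2}. (z i) ^ nat (- 2 - k) * vir \<kappa> (beta \<kappa> N L) k e p)
     = - (\<Sum>r\<in>{1..L}. 2 / (z r - z i) * (dlog q T z r * e p + q r * current (z r) e p)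
          - 2 / (z r - z i)\<^sup>2 * e p)"
proof -
  define R where "R = {1..T} - {i}"
  define a where "a = (of_real (alpha \<kappa>) :: complex)"
  define k where "k = (of_real \<kappa> :: complex)"
  have ka: "k * a\<^sup>2 = 1" unfolding k_def a_def by (rule alpha_facts(1)[OF \<kappa>])
  have qi: "q i = a" using i by (simp add: q_def charge_def a_def)
  have ne: "z s \<noteq> z i" if "s \<in> R" for s
    using inj that i by (auto simp: R_def dest: inj_onD)
  define V where "V = (\<Sum>k\<in>{- int B..-2}. (z i) ^ nat (- 2 - k) * vir \<kappa> (beta \<kappa> N L) k e p)"
  define C where "C s = current (z s) e p" for s
  define D where "D = dcurrent (z i) e p"
  define CC where "CC = current (z i) (current (z i) e) p"
  define Y where "Y = (\<Sum>s\<in>R. q s / (z s - z i))"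
  define Z where "Z = (\<Sum>s\<in>R. q s / (z s - z i) * C s)"
  have V: "V = (1/4) * CC + of_real (alpha0 \<kappa>) * D + (a * D - Y * C i + Z)"
  proof -
    have iT: "i \<in> {1..T}" using i by auto
    have "of_real (beta \<kappa> N L) = power_sum q T z 0"
      unfolding q_def T by (rule power_sum_config_0[symmetric])
    then have "V = (1/4) * CC + of_real (alpha0 \<kappa>) * D
      + (\<Sum>n\<in>{1..B}. (\<Sum>j<n - 1. z i ^ (n - 2 - j) * power_sum q T z j) * create n e p)"
      unfolding V_def CC_def D_def e_def by (rule vir_coh_pt_sum[OF _ B])
    also have "(\<Sum>n\<in>{1..B}. (\<Sum>j<n - 1. z i ^ (n - 2 - j) * power_sum q T z j) * create n e p)
      = a * D + (\<Sum>s\<in>R. q s * ((C i - C s) / (z i - z s)))"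
      unfolding R_def C_def D_def qi[symmetric]
      by (rule divided_difference_current[OF B iT]) (use ne in \<open>auto simp: R_def\<close>)
    also have "(\<Sum>s\<in>R. q s * ((C i - C s) / (z i - z s))) = (\<Sum>s\<in>R. q s / (z s - z i) * C s - q s / (z s - z i) * C i)"
    proof (rule sum.cong[OF refl])
      fix s assume "s \<in> R"
      then have "z s \<noteq> z i" by (rule ne)
      then have "z s - z i \<noteq> 0" "z i - z s \<noteq> 0" by auto
      then show "q s * ((C i - C s) / (z i - z s)) = q s / (z s - z i) * C s - q s / (z s - z i) * C i"
        by (simp add: divide_simps) (simp add: algebra_simps)
    qed
    finally show ?thesis by (simp add: sum_subtractf Y_def Z_def sum_distrib_right)
  qed
  have dl: "dlog q T z i = - 2 * a * Y"
  proof -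
    have "2 * q i * q t / (z i - z t) = - 2 * a * (q t / (z t - z i))" for t
      using minus_divide_right[of "2 * a * q t" "z t - z i"] by (simp add: qi)
    then show ?thesis unfolding dlog_def R_def[symmetric] Y_def by (simp add: sum_distrib_left)
  qed
  have XW: "R = ({L + 1..T} - {i}) \<union> {1..L}" "({L + 1..T} - {i}) \<inter> {1..L} = {}"
    using i T by (auto simp: R_def)
  have split: "sum g R = sum g ({L + 1..T} - {i}) + sum g {1..L}" for g :: "nat \<Rightarrow> complex"
    unfolding XW(1) by (rule sum.union_disjoint) (use XW(2) in auto)
  have a0: "of_real (alpha0 \<kappa>) = k * a / 4 - a"
    unfolding alpha_facts(3)[OF \<kappa>] by (simp add: k_def a_def)
  define SUMX where "SUMX = (\<Sum>j\<in>{L + 1..T} - {i}. 2 / (z j - z i) * (dlog q T z j * e p + q j * current (z j) e p)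
          + of_real ((\<kappa> - 6) / \<kappa>) / (z j - z i)\<^sup>2 * e p)"
  define SUMW where "SUMW = (\<Sum>r\<in>{1..L}. 2 / (z r - z i) * (dlog q T z r * e p + q r * current (z r) e p)
          - 2 / (z r - z i)\<^sup>2 * e p)"
  define SX where "SX = (\<Sum>j\<in>{L + 1..T} - {i}. of_real ((\<kappa> - 6) / \<kappa>) / (z j - z i)\<^sup>2)"
  define SW where "SW = (\<Sum>r\<in>{1..L}. 2 / (z r - z i)\<^sup>2)"
  have sc: "of_real (\<kappa> / 2) * ((dlog q T z i)\<^sup>2 + ddlog q T z i)
     + (\<Sum>s\<in>R. 2 / (z s - z i) * dlog q T z s) + SX - SW = 0"
    unfolding R_def SX_def SW_def q_def by (rule null_vector_scalar[OF \<kappa> T i inj])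
  have "SUMX
     + SUMW
     = (\<Sum>s\<in>R. 2 / (z s - z i) * (dlog q T z s * e p + q s * C s)) + (SX - SW) * e p"
    unfolding SUMX_def SUMW_def split SX_def SW_def C_def
    by (simp add: sum.distrib sum_subtractf sum_distrib_right left_diff_distrib)
  also have "\<dots> = ((\<Sum>s\<in>R. 2 / (z s - z i) * dlog q T z s) + SX - SW) * e p + 2 * Z"
    unfolding Z_def by (simp add: sum.distrib sum_distrib_left sum_distrib_right algebra_simps)
  also have "(\<Sum>s\<in>R. 2 / (z s - z i) * dlog q T z s) + SX - SW = - of_real (\<kappa> / 2) * ((dlog q T z i)\<^sup>2 + ddlog q T z i)"
    using sc by (simp add: algebra_simps add_eq_0_iff)
  finally have S: "SUMX
     = - of_real (\<kappa> / 2) * ((dlog q T z i)\<^sup>2 + ddlog q T z i) * e p + 2 * Z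
     - SUMW"
    by (simp add: algebra_simps)
  have K: "of_real (\<kappa> / 2) * (2 * dlog q T z i * (q i * C i) + q i * (D + q i * CC))
    = - 2 * (k * a\<^sup>2) * Y * C i + k * a / 2 * D + (k * a\<^sup>2) / 2 * CC"
    unfolding dl qi k_def by (simp add: algebra_simps power2_eq_square)
  show ?thesis
    unfolding SUMX_def[symmetric] SUMW_def[symmetric] V_def[symmetric]
    unfolding V S a0 C_def[symmetric] D_def[symmetric] CC_def[symmetric]
    using K unfolding ka by (simp add: distrib_left) (simp add: algebra_simps)
qed

section \<open>Iterated integrals along cell decompositions\<close>

lemma continuous_on_fun_upd:
  fixes g :: "'a::topological_space \<Rightarrow> nat \<Rightarrow> complex"
  assumes "continuous_on A g" "continuous_on A h"
  shows "continuous_on A (\<lambda>x. (g x)(M := h x))"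
proof (rule continuous_on_coordinatewise_then_product)
  fix s
  have "continuous_on A (\<lambda>x. g x s)"
    by (rule continuous_on_compose2[OF continuous_on_product_coordinates assms(1)]) auto
  then show "continuous_on A (\<lambda>x. ((g x)(M := h x)) s)"
    using assms(2) by (cases "s = M") auto
qed

text \<open>
  A valid path need not be rectifiable, so contour integrals over it are not controlled by the
  supremum of the integrand. Therefore every path is cut into \<open>n\<close> short cells and, by holomorphy,
  replaced by the segments from \<open>c s k\<close> to \<open>c s (Suc k)\<close>. A multi-index \<open>K\<close> chooses a cell for each
  variable; the integrand is a family of functions indexed by \<open>K\<close>, each on a polydisc, because
  the branch of \<open>h\<close> depends on the cell.
\<close>

type_synonym branch_family = "(nat \<Rightarrow> nat) \<Rightarrow> (nat \<Rightarrow> complex) \<Rightarrow> complex"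

locale polydiscs =
  fixes T L n :: nat and \<delta> :: real and c :: "nat \<Rightarrow> nat \<Rightarrow> complex"
  assumes L_le_T: "L \<le> T" and n_pos: "n > 0" and \<delta>_pos: "\<delta> > 0"
    and near: "s \<in> {1..L} \<Longrightarrow> k < n \<Longrightarrow> dist (c s k) (c s (Suc k)) < \<delta>"
begin

text \<open>Only the first \<open>L\<close> variables are cut. The remaining entries of
  \<open>K\<close> are unconstrained; in the application their centres do not depend on
  \<open>K\<close>.\<close>

definition cells :: "(nat \<Rightarrow> nat) set" where
  "cells = {K. \<forall>s\<in>{1..L}. K s < n}"

definition disc :: "(nat \<Rightarrow> nat) \<Rightarrow> (nat \<Rightarrow> complex) set" where
  "disc K = {z. \<forall>s\<in>{1..T}. z s \<in> ball (c s (K s)) \<delta>}"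

abbreviation cell :: "nat \<Rightarrow> real set" where
  "cell k \<equiv> {real k / real n..real (Suc k) / real n}"

definition seg :: "nat \<Rightarrow> nat \<Rightarrow> real \<Rightarrow> complex" where
  "seg s k \<tau> = c s k + of_real \<tau> * (c s (Suc k) - c s k)"

definition seg_int :: "nat \<Rightarrow> branch_family \<Rightarrow> branch_family" where
  "seg_int M E K z = (\<Sum>k<n. (c M (Suc k) - c M k) * integral {0..1} (\<lambda>\<tau>. E (K(M := k)) (z(M := seg M k \<tau>))))"

primrec iter_int :: "nat \<Rightarrow> branch_family \<Rightarrow> branch_family" where
  "iter_int 0 E = E"
| "iter_int (Suc m) E = iter_int m (seg_int (Suc m) E)"

definition cont_cells :: "branch_family \<Rightarrow> bool" where
  "cont_cells E \<longleftrightarrow> (\<forall>K\<in>cells. continuous_on (disc K) (E K))"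

definition pderiv_on :: "nat \<Rightarrow> branch_family \<Rightarrow> branch_family \<Rightarrow> bool" where
  "pderiv_on s E E' \<longleftrightarrow> (\<forall>K\<in>cells. \<forall>z\<in>disc K. ((\<lambda>\<zeta>. E K (z(s := \<zeta>))) has_field_derivative E' K z) (at (z s)))"

lemma seg_0 [simp]: "seg s k 0 = c s k" and seg_1 [simp]: "seg s k 1 = c s (Suc k)"
  by (simp_all add: seg_def)

lemma seg_in_ball: "s \<in> {1..L} \<Longrightarrow> k < n \<Longrightarrow> \<tau> \<in> {0..1} \<Longrightarrow> seg s k \<tau> \<in> ball (c s k) \<delta>"
proof -
  assume a: "s \<in> {1..L}" "k < n" "\<tau> \<in> {0..1}"
  have "dist (c s k) (seg s k \<tau>) = \<tau> * dist (c s k) (c s (Suc k))"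
    using a(3) by (simp add: seg_def dist_norm norm_mult norm_minus_commute)
  also have "\<dots> \<le> dist (c s k) (c s (Suc k))" using a(3) by (simp add: mult_left_le_one_le)
  finally show ?thesis using near[OF a(1,2)] by simp
qed

lemma cells_upd: "K \<in> cells \<Longrightarrow> k < n \<Longrightarrow> K(M := k) \<in> cells"
  by (auto simp: cells_def)

lemma disc_upd: "z \<in> disc K \<Longrightarrow> w \<in> ball (c M k) \<delta> \<Longrightarrow> z(M := w) \<in> disc (K(M := k))"
  by (auto simp: disc_def)

lemma disc_upd_same: "z \<in> disc K \<Longrightarrow> w \<in> ball (c M (K M)) \<delta> \<Longrightarrow> z(M := w) \<in> disc K"
  by (auto simp: disc_def)

lemma continuous_on_seg: "continuous_on A h \<Longrightarrow> continuous_on A (\<lambda>x. seg M k (h x))"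
  unfolding seg_def by (intro continuous_intros)

lemma cont_cells_integrand:
  assumes "cont_cells E" "K \<in> cells" "M \<in> {1..L}" "k < n"
  shows "continuous_on (disc K \<times> {0..1}) (\<lambda>(z, \<tau>). E (K(M := k)) (z(M := seg M k \<tau>)))"
proof -
  have 1: "continuous_on (disc K \<times> {0..1::real}) (\<lambda>x. (fst x)(M := seg M k (snd x)))"
    by (intro continuous_on_fun_upd continuous_on_seg continuous_intros)
  have "continuous_on (disc K \<times> {0..1}) (\<lambda>x. E (K(M := k)) ((fst x)(M := seg M k (snd x))))"
  proof (rule continuous_on_compose2[OF _ 1])
    show "continuous_on (disc (K(M := k))) (E (K(M := k)))"
      using assms cells_upd unfolding cont_cells_def by blast
    show "(\<lambda>x. (fst x)(M := seg M k (snd x))) ` (disc K \<times> {0..1}) \<subseteq> disc (K(M := k))"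
      using disc_upd[OF _ seg_in_ball[OF assms(3,4)]] by fastforce
  qed
  then show ?thesis by (simp add: case_prod_unfold)
qed

lemma integrand_continuous:
  assumes "cont_cells E" "K \<in> cells" "M \<in> {1..L}" "k < n" "z \<in> disc K"
  shows "continuous_on {0..1} (\<lambda>\<tau>. E (K(M := k)) (z(M := seg M k \<tau>)))"
proof -
  have "continuous_on {0..1} (\<lambda>\<tau>. (\<lambda>(z, \<tau>). E (K(M := k)) (z(M := seg M k \<tau>))) (z, \<tau>))"
    by (rule continuous_on_compose2[OF cont_cells_integrand[OF assms(1-4)]])
      (use assms(5) in \<open>auto intro!: continuous_intros\<close>)
  then show ?thesis by simp
qed

lemma cont_cells_seg_int: assumes "cont_cells E" "M \<in> {1..L}" shows "cont_cells (seg_int M E)"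
  unfolding cont_cells_def
proof
  fix K assume K: "K \<in> cells"
  show "continuous_on (disc K) (seg_int M E K)"
    unfolding seg_int_def[abs_def]
  proof (intro continuous_on_sum continuous_on_mult_left)
    fix k assume "k \<in> {..<n}"
    then show "continuous_on (disc K) (\<lambda>z. integral {0..1} (\<lambda>\<tau>. E (K(M := k)) (z(M := seg M k \<tau>))))"
      using integral_continuous_on_param[of "disc K" 0 "1::real" "\<lambda>z \<tau>. E (K(M := k)) (z(M := seg M k \<tau>))"]
        cont_cells_integrand[OF assms(1) K assms(2), of k] by simp
  qed
qed

lemma pderiv_seg_int:
  assumes E: "cont_cells E" and E': "cont_cells E'" and d: "pderiv_on s E E'" and M: "M \<in> {1..L}" and s: "s \<in> {1..T}" "s \<noteq> M"
  shows "pderiv_on s (seg_int M E) (seg_int M E')"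
  unfolding pderiv_on_def
proof (intro ballI)
  fix K z assume K: "K \<in> cells" and z: "z \<in> disc K"
  define U where "U = ball (c s (K s)) \<delta>"
  have zs: "z s \<in> U" using z s by (auto simp: disc_def U_def)
  have zU: "z(s := \<zeta>) \<in> disc K" if "\<zeta> \<in> U" for \<zeta>
    using disc_upd_same[OF z] that by (auto simp: U_def)
  show "((\<lambda>\<zeta>. seg_int M E K (z(s := \<zeta>))) has_field_derivative seg_int M E' K z) (at (z s))"
    unfolding seg_int_def
  proof (intro DERIV_sum DERIV_cmult)
    fix k assume "k \<in> {..<n}"
    then have k: "k < n" by simp
    have "((\<lambda>\<zeta>. integral (cbox 0 1) (\<lambda>\<tau>. E (K(M := k)) (z(s := \<zeta>, M := seg M k \<tau>)))) has_field_derivative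
       integral (cbox 0 1) (\<lambda>\<tau>. E' (K(M := k)) (z(s := z s, M := seg M k \<tau>)))) (at (z s) within U)"
    proof (rule leibniz_rule_field_derivative)
      fix \<zeta> \<tau> assume \<zeta>: "\<zeta> \<in> U" and "\<tau> \<in> cbox 0 (1::real)"
      then have \<tau>: "\<tau> \<in> {0..1}" by simp
      let ?z = "z(s := \<zeta>, M := seg M k \<tau>)"
      have "?z \<in> disc (K(M := k))" by (rule disc_upd[OF zU[OF \<zeta>] seg_in_ball[OF M k \<tau>]])
      then have "((\<lambda>\<xi>. E (K(M := k)) (?z(s := \<xi>))) has_field_derivative E' (K(M := k)) ?z) (at (?z s))"
        using d cells_upd[OF K k] unfolding pderiv_on_def by blast
      moreover have "?z(s := \<xi>) = z(s := \<xi>, M := seg M k \<tau>)" for \<xi>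
        using s(2) by (auto simp: fun_eq_iff)
      ultimately show "((\<lambda>\<zeta>. E (K(M := k)) (z(s := \<zeta>, M := seg M k \<tau>))) has_field_derivative
           E' (K(M := k)) (z(s := \<zeta>, M := seg M k \<tau>))) (at \<zeta> within U)"
        using s(2) by (auto intro: has_field_derivative_at_within)
    next
      fix \<zeta> assume "\<zeta> \<in> U"
      then show "(\<lambda>\<tau>. E (K(M := k)) (z(s := \<zeta>, M := seg M k \<tau>))) integrable_on cbox 0 1"
        using integrable_continuous_real[OF integrand_continuous[OF E K M k zU]] by simp
    next
      have "continuous_on (U \<times> {0..1}) (\<lambda>x. (\<lambda>(z, \<tau>). E' (K(M := k)) (z(M := seg M k \<tau>))) (z(s := fst x), snd x))"
      proof (rule continuous_on_compose2[OF cont_cells_integrand[OF E' K M k]])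
        show "continuous_on (U \<times> {0..1::real}) (\<lambda>x. (z(s := fst x), snd x))"
          by (intro continuous_on_Pair continuous_on_fun_upd continuous_intros)
      qed (use zU in auto)
      then show "continuous_on (U \<times> cbox 0 1) (\<lambda>(\<zeta>, \<tau>). E' (K(M := k)) (z(s := \<zeta>, M := seg M k \<tau>)))"
        by (simp add: case_prod_unfold)
    qed (use zs in \<open>auto simp: U_def\<close>)
    moreover have "at (z s) within U = at (z s)" using zs by (intro at_within_open) (auto simp: U_def)
    ultimately show "((\<lambda>\<zeta>. integral {0..1} (\<lambda>\<tau>. E (K(M := k)) (z(s := \<zeta>, M := seg M k \<tau>)))) has_field_derivative
       integral {0..1} (\<lambda>\<tau>. E' (K(M := k)) (z(M := seg M k \<tau>)))) (at (z s))"
      by simp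
  qed
qed

lemma pderiv_iter_int:
  "cont_cells E \<Longrightarrow> cont_cells E' \<Longrightarrow> pderiv_on s E E' \<Longrightarrow> m \<le> L \<Longrightarrow> s \<in> {Suc m..T} \<Longrightarrow> pderiv_on s (iter_int m E) (iter_int m E')"
proof (induction m arbitrary: E E')
  case (Suc m)
  have "pderiv_on s (seg_int (Suc m) E) (seg_int (Suc m) E')"
    by (rule pderiv_seg_int) (use Suc.prems in auto)
  moreover have "cont_cells (seg_int (Suc m) E)" "cont_cells (seg_int (Suc m) E')"
    using Suc.prems by (auto intro!: cont_cells_seg_int)
  ultimately show ?case using Suc.IH Suc.prems by auto
qed simp

lemma seg_int_cong:
  assumes "\<And>k \<tau>. k < n \<Longrightarrow> \<tau> \<in> {0..1} \<Longrightarrow> E (K(M := k)) (z(M := seg M k \<tau>)) = E' (K(M := k)) (z(M := seg M k \<tau>))"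
  shows "seg_int M E K z = seg_int M E' K z"
  unfolding seg_int_def using assms by (intro sum.cong arg_cong2[where f="(*)"] integral_cong refl) auto

text \<open>The integration never moves the variables outside \<open>1..m\<close>. Agreement is
  therefore required only where they keep the values of \<open>z0\<close>, which later permits
  writing the real numbers \<open>x j\<close> for the corresponding points.\<close>

lemma iter_int_cong:
  assumes "\<And>K z. K \<in> cells \<Longrightarrow> z \<in> disc K \<Longrightarrow> (\<And>s. s \<notin> {1..m} \<Longrightarrow> z s = z0 s) \<Longrightarrow> E K z = E' K z"
    and "K0 \<in> cells" "z0 \<in> disc K0" "m \<le> L"
  shows "iter_int m E K0 z0 = iter_int m E' K0 z0"
  using assms(1,4)
proof (induction m arbitrary: E E')
  case 0
  then show ?case using assms(2,3) by simp
next
  case (Suc m)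
  have "seg_int (Suc m) E K z = seg_int (Suc m) E' K z" if "K \<in> cells" "z \<in> disc K" "\<And>s. s \<notin> {1..m} \<Longrightarrow> z s = z0 s" for K z
  proof (rule seg_int_cong)
    fix k :: nat and \<tau> :: real assume "k < n" "\<tau> \<in> {0..1}"
    then show "E (K(Suc m := k)) (z(Suc m := seg (Suc m) k \<tau>)) = E' (K(Suc m := k)) (z(Suc m := seg (Suc m) k \<tau>))"
      using that Suc.prems(2) by (intro Suc.prems(1) cells_upd disc_upd seg_in_ball) auto
  qed
  then have "iter_int m (seg_int (Suc m) E) K0 z0 = iter_int m (seg_int (Suc m) E') K0 z0"
    using Suc.prems(2) by (intro Suc.IH) auto
  then show ?case by simp
qed

lemma seg_int_sum:
  assumes "\<And>a. a \<in> I \<Longrightarrow> cont_cells (E a)" "K \<in> cells" "z \<in> disc K" "M \<in> {1..L}" "finite I"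
  shows "seg_int M (\<lambda>K z. \<Sum>a\<in>I. b a * E a K z) K z = (\<Sum>a\<in>I. b a * seg_int M (E a) K z)"
proof -
  have "integral {0..1} (\<lambda>\<tau>. \<Sum>a\<in>I. b a * E a (K(M := k)) (z(M := seg M k \<tau>)))
     = (\<Sum>a\<in>I. b a * integral {0..1} (\<lambda>\<tau>. E a (K(M := k)) (z(M := seg M k \<tau>))))" if "k < n" for k
  proof -
    have "(\<lambda>\<tau>. E a (K(M := k)) (z(M := seg M k \<tau>))) integrable_on {0..1}" if "a \<in> I" for a
      using integrable_continuous_real[OF integrand_continuous[OF assms(1)[OF that] assms(2,4) \<open>k < n\<close> assms(3)]] .
    then have "integral {0..1} (\<lambda>\<tau>. \<Sum>a\<in>I. b a * E a (K(M := k)) (z(M := seg M k \<tau>)))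
     = (\<Sum>a\<in>I. integral {0..1} (\<lambda>\<tau>. b a * E a (K(M := k)) (z(M := seg M k \<tau>))))"
      by (intro integral_sum assms(5) integrable_on_mult_right)
    then show ?thesis by simp
  qed
  then show ?thesis
    unfolding seg_int_def by (simp add: sum_distrib_left sum.swap[of _ I] mult_ac)
qed

lemma iter_int_sum:
  assumes "\<And>a. a \<in> I \<Longrightarrow> cont_cells (E a)" "K \<in> cells" "z \<in> disc K" "m \<le> L" "finite I"
  shows "iter_int m (\<lambda>K z. \<Sum>a\<in>I. b a * E a K z) K z = (\<Sum>a\<in>I. b a * iter_int m (E a) K z)"
  using assms(1,4)
proof (induction m arbitrary: E)
  case (Suc m)
  have "iter_int m (seg_int (Suc m) (\<lambda>K z. \<Sum>a\<in>I. b a * E a K z)) K z = iter_int m (\<lambda>K z. \<Sum>a\<in>I. b a * seg_int (Suc m) (E a) K z) K z"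
    by (rule iter_int_cong) (use Suc.prems assms in \<open>auto intro!: seg_int_sum\<close>)
  also have "\<dots> = (\<Sum>a\<in>I. b a * iter_int m (seg_int (Suc m) (E a)) K z)"
    using Suc.prems by (intro Suc.IH cont_cells_seg_int) auto
  finally show ?case by simp
qed simp

definition cyc :: "nat \<Rightarrow> nat" where
  "cyc k = (if Suc k < n then Suc k else 0)"

text \<open>
  Consecutive local branches agree at the common point of their cells, cyclically, as the
  path is closed. This makes the boundary terms of a total derivative telescope.
\<close>

definition matching :: "nat \<Rightarrow> branch_family \<Rightarrow> bool" where
  "matching M G \<longleftrightarrow> (\<forall>K\<in>cells. \<forall>z\<in>disc K. \<forall>k<n.
     G (K(M := k)) (z(M := c M (Suc k))) = G (K(M := cyc k)) (z(M := c M (cyc k))))"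

lemma sum_cyc: "(\<Sum>k<n. g (cyc k)) = (\<Sum>k<n. g k)" for g :: "nat \<Rightarrow> complex"
proof (rule sum.reindex_bij_witness[of _ "\<lambda>k. if k = 0 then n - 1 else k - 1" cyc])
qed (use n_pos in \<open>auto simp: cyc_def split: if_splits\<close>)

lemma seg_int_total:
  assumes E: "cont_cells E" and d: "pderiv_on M G E" and m: "matching M G" and M: "M \<in> {1..L}"
    and K: "K \<in> cells" and z: "z \<in> disc K"
  shows "seg_int M E K z = 0"
proof -
  have "(c M (Suc k) - c M k) * integral {0..1} (\<lambda>\<tau>. E (K(M := k)) (z(M := seg M k \<tau>)))
     = G (K(M := cyc k)) (z(M := c M (cyc k))) - G (K(M := k)) (z(M := c M k))" if k: "k < n" for k
  proof -
    have "((\<lambda>\<tau>. (c M (Suc k) - c M k) * E (K(M := k)) (z(M := seg M k \<tau>))) has_integral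
        G (K(M := k)) (z(M := seg M k 1)) - G (K(M := k)) (z(M := seg M k 0))) {0..1}"
    proof (rule fundamental_theorem_of_calculus)
      fix \<tau> :: real assume \<tau>: "\<tau> \<in> {0..1}"
      let ?z = "z(M := seg M k \<tau>)"
      have "?z \<in> disc (K(M := k))" by (rule disc_upd[OF z seg_in_ball[OF M k \<tau>]])
      then have "((\<lambda>\<xi>. G (K(M := k)) (?z(M := \<xi>))) has_field_derivative E (K(M := k)) ?z) (at (?z M))"
        using d cells_upd[OF K k] unfolding pderiv_on_def by blast
      then have D: "((\<lambda>\<xi>. G (K(M := k)) (z(M := \<xi>))) has_field_derivative E (K(M := k)) ?z) (at (seg M k \<tau>))"
        by simp
      have "(seg M k has_vector_derivative (c M (Suc k) - c M k)) (at \<tau>)"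
        unfolding seg_def[abs_def] by (auto intro!: derivative_eq_intros)
      from field_vector_diff_chain_at[OF this D]
      show "((\<lambda>\<tau>. G (K(M := k)) (z(M := seg M k \<tau>))) has_vector_derivative
          (c M (Suc k) - c M k) * E (K(M := k)) ?z) (at \<tau> within {0..1})"
        by (simp add: o_def has_vector_derivative_at_within)
    qed simp
    then have "(c M (Suc k) - c M k) * integral {0..1} (\<lambda>\<tau>. E (K(M := k)) (z(M := seg M k \<tau>)))
      = G (K(M := k)) (z(M := c M (Suc k))) - G (K(M := k)) (z(M := c M k))"
      by (simp add: integral_unique flip: integral_mult_right)
    then show ?thesis using m K z k by (simp add: matching_def)
  qed
  then have "seg_int M E K z = (\<Sum>k<n. G (K(M := cyc k)) (z(M := c M (cyc k))) - G (K(M := k)) (z(M := c M k)))"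
    unfolding seg_int_def by simp
  also have "\<dots> = 0"
    unfolding sum_subtractf using sum_cyc[of "\<lambda>k. G (K(M := k)) (z(M := c M k))"] by simp
  finally show ?thesis .
qed

lemma matching_seg_int:
  assumes m: "matching M G" and s: "s \<in> {1..L}" "s \<noteq> M"
  shows "matching M (seg_int s G)"
  unfolding matching_def
proof (intro ballI allI impI)
  fix K z k assume K: "K \<in> cells" and z: "z \<in> disc K" and k: "k < n"
  have "integral {0..1} (\<lambda>\<tau>. G (K(M := k, s := l)) (z(M := c M (Suc k), s := seg s l \<tau>)))
      = integral {0..1} (\<lambda>\<tau>. G (K(M := cyc k, s := l)) (z(M := c M (cyc k), s := seg s l \<tau>)))" if l: "l < n" for l
  proof (rule integral_cong)
    fix \<tau> :: real assume \<tau>: "\<tau> \<in> {0..1}"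
    have "G ((K(s := l))(M := k)) ((z(s := seg s l \<tau>))(M := c M (Suc k)))
       = G ((K(s := l))(M := cyc k)) ((z(s := seg s l \<tau>))(M := c M (cyc k)))"
      using m cells_upd[OF K l] disc_upd[OF z seg_in_ball[OF s(1) l \<tau>]] k unfolding matching_def by blast
    then show "G (K(M := k, s := l)) (z(M := c M (Suc k), s := seg s l \<tau>)) = G (K(M := cyc k, s := l)) (z(M := c M (cyc k), s := seg s l \<tau>))"
      using s(2) by (simp add: fun_upd_twist[of s M])
  qed
  then show "seg_int s G (K(M := k)) (z(M := c M (Suc k))) = seg_int s G (K(M := cyc k)) (z(M := c M (cyc k)))"
    unfolding seg_int_def by simp
qed

lemma iter_int_zero: "iter_int m (\<lambda>K z. 0) = (\<lambda>K z. 0)"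
proof (induction m)
  case (Suc m)
  have "seg_int (Suc m) (\<lambda>K z. 0) = (\<lambda>K z. 0)" by (intro ext) (simp add: seg_int_def)
  then show ?case using Suc by simp
qed simp

text \<open>The exact variable need not be the innermost one. Integration over the variables above
  \<open>M\<close> comes first and preserves both the derivative relation and the matching, until
  \<open>seg_int_total\<close> applies.\<close>

lemma iter_int_total:
  assumes "M \<in> {1..m}" "m \<le> L" "K \<in> cells" "z \<in> disc K"
  shows "cont_cells G \<Longrightarrow> cont_cells E \<Longrightarrow> pderiv_on M G E \<Longrightarrow> matching M G \<Longrightarrow> iter_int m E K z = 0"
  using assms(1,2)
proof (induction m arbitrary: G E)
  case (Suc m)
  show ?case
  proof (cases "M = Suc m")
    case True
    have "iter_int m (seg_int (Suc m) E) K z = iter_int m (\<lambda>K z. 0) K z"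
      by (rule iter_int_cong) (use Suc.prems True assms(3,4) in \<open>auto intro!: seg_int_total[of E _ G]\<close>)
    then show ?thesis by (simp add: iter_int_zero)
  next
    case False
    have "cont_cells (seg_int (Suc m) G)" "cont_cells (seg_int (Suc m) E)" "pderiv_on M (seg_int (Suc m) G) (seg_int (Suc m) E)" "matching M (seg_int (Suc m) G)"
      using Suc.prems False L_le_T by (auto intro!: cont_cells_seg_int pderiv_seg_int matching_seg_int)
    then show ?thesis using Suc.IH[of "seg_int (Suc m) G" "seg_int (Suc m) E"] Suc.prems False by auto
  qed
qed simp

lemma iter_int_lin2:
  assumes "cont_cells E" "cont_cells E'" "K \<in> cells" "z \<in> disc K" "m \<le> L"
  shows "iter_int m (\<lambda>K z. a * E K z + b * E' K z) K z = a * iter_int m E K z + b * iter_int m E' K z"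
  using iter_int_sum[of "{True, False}" "\<lambda>t. if t then E else E'" K z m "\<lambda>t. if t then a else b"] assms by simp

lemma cont_cells_lin2: "cont_cells E \<Longrightarrow> cont_cells E' \<Longrightarrow> cont_cells (\<lambda>K z. a * E K z + b * E' K z)"
  unfolding cont_cells_def by (auto intro!: continuous_intros)

lemma cont_cells_sum: "(\<And>a. a \<in> I \<Longrightarrow> cont_cells (E a)) \<Longrightarrow> cont_cells (\<lambda>K z. \<Sum>a\<in>I. b a * E a K z)"
  unfolding cont_cells_def by (auto intro!: continuous_on_sum continuous_on_mult_left)

end

section \<open>From valid paths to segments\<close>

lemma path_integral_ball:
  fixes g :: "complex \<Rightarrow> complex" and \<gamma> :: "real \<Rightarrow> complex"
  assumes g: "g holomorphic_on ball a r" and \<gamma>: "valid_path \<gamma>"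
    and u: "0 \<le> u" "u \<le> v" "v \<le> 1" and im: "\<And>x. x \<in> {u..v} \<Longrightarrow> \<gamma> x \<in> ball a r"
  shows "((\<lambda>x. g (\<gamma> x) * vector_derivative \<gamma> (at x within {0..1})) has_integral
     (\<gamma> v - \<gamma> u) * integral {0..1} (\<lambda>\<tau>. g (\<gamma> u + of_real \<tau> * (\<gamma> v - \<gamma> u)))) {u..v}"
proof -
  \<comment> \<open>A primitive on the ball decides everything: the integrals over the piece of path
    and over the chord are both \<open>Q (\<gamma> v) - Q (\<gamma> u)\<close>.\<close>
  obtain Q where Q: "\<And>x. x \<in> ball a r \<Longrightarrow> (Q has_field_derivative g x) (at x within ball a r)"
    using holomorphic_convex_primitive'[OF convex_ball open_ball g] by metis
  then have Q: "(Q has_field_derivative g x) (at x)" if "x \<in> ball a r" for x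
    using that by (metis at_within_open open_ball)
  then have contQ: "continuous_on (ball a r) Q"
    by (meson DERIV_isCont continuous_at_imp_continuous_on)
  obtain S where S: "finite S" "\<gamma> C1_differentiable_on {0..1} - S" and cont: "continuous_on {0..1} \<gamma>"
    using \<gamma> unfolding valid_path_def piecewise_C1_differentiable_on_def by blast
  have 1: "((\<lambda>x. g (\<gamma> x) * vector_derivative \<gamma> (at x within {0..1})) has_integral Q (\<gamma> v) - Q (\<gamma> u)) {u..v}"
  \<comment> \<open>This form admits finitely many exceptional points and delivers integrability as
    well, so no bound on the derivative of the path is needed.\<close>
  proof (rule fundamental_theorem_of_calculus_interior_strong[OF S(1) u(2)])
    fix x assume x: "x \<in> {u<..<v} - S"
    then have x01: "x \<in> {0<..<1}" using u by auto
    then have "\<gamma> differentiable (at x)" using S(2) x unfolding C1_differentiable_on_eq by auto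
    then have "(\<gamma> has_vector_derivative vector_derivative \<gamma> (at x)) (at x)"
      by (simp add: vector_derivative_works)
    moreover have "at x within {0..1} = at x" using x01 by (intro at_within_interior) auto
    moreover have "\<gamma> x \<in> ball a r" using x im by auto
    note field_vector_diff_chain_at[OF calculation(1) Q[OF this]]
    ultimately show "((\<lambda>x. Q (\<gamma> x)) has_vector_derivative g (\<gamma> x) * vector_derivative \<gamma> (at x within {0..1})) (at x)"
      by (simp add: o_def mult.commute)
  next
    show "continuous_on {u..v} (\<lambda>x. Q (\<gamma> x))"
      by (rule continuous_on_compose2[OF contQ continuous_on_subset[OF cont]]) (use u im in auto)
  qed
  define l where "l \<tau> = \<gamma> u + of_real \<tau> * (\<gamma> v - \<gamma> u)" for \<tau> :: real
  have l: "l \<tau> \<in> ball a r" if "\<tau> \<in> {0..1}" for \<tau>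
  proof -
    have "l \<tau> = (1 - \<tau>) *\<^sub>R \<gamma> u + \<tau> *\<^sub>R \<gamma> v" by (simp add: l_def scaleR_conv_of_real algebra_simps)
    moreover have "\<gamma> u \<in> ball a r" "\<gamma> v \<in> ball a r" using im u by auto
    ultimately show ?thesis using that convexD_alt[OF convex_ball] by (metis atLeastAtMost_iff)
  qed
  have "((\<lambda>\<tau>. (\<gamma> v - \<gamma> u) * g (l \<tau>)) has_integral Q (l 1) - Q (l 0)) {0..1}"
  proof (rule fundamental_theorem_of_calculus)
    fix \<tau> :: real assume \<tau>: "\<tau> \<in> {0..1}"
    have "(l has_vector_derivative (\<gamma> v - \<gamma> u)) (at \<tau>)"
      unfolding l_def[abs_def] by (auto intro!: derivative_eq_intros)
    from field_vector_diff_chain_at[OF this Q[OF l[OF \<tau>]]]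
    show "((\<lambda>\<tau>. Q (l \<tau>)) has_vector_derivative (\<gamma> v - \<gamma> u) * g (l \<tau>)) (at \<tau> within {0..1})"
      by (simp add: o_def has_vector_derivative_at_within)
  qed simp
  then have "(\<gamma> v - \<gamma> u) * integral {0..1} (\<lambda>\<tau>. g (l \<tau>)) = Q (\<gamma> v) - Q (\<gamma> u)"
    by (simp add: integral_unique l_def flip: integral_mult_right)
  then show ?thesis using 1 by (simp add: l_def)
qed

lemma has_integral_combine_chain:
  fixes g :: "real \<Rightarrow> complex" and a :: "nat \<Rightarrow> real"
  assumes "\<And>k. k < m \<Longrightarrow> (g has_integral I k) {a k..a (Suc k)}" "\<And>k. k < m \<Longrightarrow> a k \<le> a (Suc k)"
  shows "(g has_integral (\<Sum>k<m. I k)) {a 0..a m} \<and> a 0 \<le> a m"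
  using assms
proof (induction m)
  case 0
  then show ?case using has_integral_refl(2)[of g "a 0"] by simp
next
  case (Suc m)
  then have "(g has_integral (\<Sum>k<m. I k)) {a 0..a m}" "a 0 \<le> a m" by auto
  then show ?case using Suc.prems(1,2)[of m] has_integral_combine[of "a 0" "a m" "a (Suc m)" g]
    by fastforce
qed

locale path_cells = polydiscs +
  fixes \<gamma> :: "nat \<Rightarrow> real \<Rightarrow> complex"
  assumes valid: "s \<in> {1..L} \<Longrightarrow> valid_path (\<gamma> s)"
    and c_path: "s \<in> {1..L} \<Longrightarrow> k \<le> n \<Longrightarrow> c s k = \<gamma> s (real k / real n)"
    and cell_ball: "s \<in> {1..L} \<Longrightarrow> k < n \<Longrightarrow> u \<in> cell k \<Longrightarrow> \<gamma> s u \<in> ball (c s k) \<delta>"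
begin

lemma integral_cells:
  assumes M: "M \<in> {1..L}" and h: "\<And>k. k < n \<Longrightarrow> h k holomorphic_on ball (c M k) \<delta>"
    and F: "\<And>k u. k < n \<Longrightarrow> u \<in> cell k \<Longrightarrow> F u = h k (\<gamma> M u)"
  shows "integral {0..1} (\<lambda>u. F u * vector_derivative (\<gamma> M) (at u within {0..1}))
    = (\<Sum>k<n. (c M (Suc k) - c M k) * integral {0..1} (\<lambda>\<tau>. h k (seg M k \<tau>)))"
proof -
  let ?a = "\<lambda>k. real k / real n"
  have "((\<lambda>u. F u * vector_derivative (\<gamma> M) (at u within {0..1})) has_integral
     (c M (Suc k) - c M k) * integral {0..1} (\<lambda>\<tau>. h k (seg M k \<tau>))) {?a k..?a (Suc k)}" if k: "k < n" for k
  proof -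
    have "((\<lambda>u. h k (\<gamma> M u) * vector_derivative (\<gamma> M) (at u within {0..1})) has_integral
      (\<gamma> M (?a (Suc k)) - \<gamma> M (?a k)) * integral {0..1} (\<lambda>\<tau>. h k (\<gamma> M (?a k) + of_real \<tau> * (\<gamma> M (?a (Suc k)) - \<gamma> M (?a k))))) {?a k..?a (Suc k)}"
      by (rule path_integral_ball[OF h[OF k] valid[OF M] _ _ _ cell_ball[OF M k]])
        (use k in \<open>auto simp: divide_simps\<close>)
    moreover have "\<gamma> M (?a (Suc k)) = c M (Suc k)" "\<gamma> M (?a k) = c M k"
      using c_path[OF M] k by auto
    ultimately show ?thesis
      unfolding seg_def using has_integral_eq[of "{?a k..?a (Suc k)}" "\<lambda>u. h k (\<gamma> M u) * vector_derivative (\<gamma> M) (at u within {0..1})"] F[OF k]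
      by simp
  qed
  then have "((\<lambda>u. F u * vector_derivative (\<gamma> M) (at u within {0..1})) has_integral
     (\<Sum>k<n. (c M (Suc k) - c M k) * integral {0..1} (\<lambda>\<tau>. h k (seg M k \<tau>)))) {?a 0..?a n}"
    by (intro has_integral_combine_chain[THEN conjunct1]) (auto simp: divide_right_mono)
  then show ?thesis using n_pos by (simp add: integral_unique)
qed

text \<open>The assumed partial derivatives \<open>E'\<close> serve only to make \<open>E\<close>
  holomorphic in each integrated variable, so that paths may be replaced by segments. They pass to
  the inner integral by the Leibniz rule, which keeps the induction going.\<close>

lemma iter_integral_eq_iter_int:
  assumes "m \<le> L" "cont_cells E" "\<And>s. s \<in> {1..m} \<Longrightarrow> \<exists>E'. cont_cells E' \<and> pderiv_on s E E'"
    and K0: "K0 \<in> cells" and z0: "z0 \<in> disc K0"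
    and "\<And>K t. K \<in> cells \<Longrightarrow> (\<And>s. s \<in> {1..m} \<Longrightarrow> t s \<in> cell (K s))
        \<Longrightarrow> (\<And>s. s \<notin> {1..m} \<Longrightarrow> K s = K0 s) \<Longrightarrow> F t = E K (\<lambda>s. if s \<in> {1..m} then \<gamma> s (t s) else z0 s)"
  shows "iter_integral \<gamma> m F t = iter_int m E K0 z0"
  using assms(1,2,3,6)
proof (induction m arbitrary: E F t)
  case 0
  then show ?case using K0 by simp
next
  case (Suc m)
  let ?M = "Suc m"
  have M: "?M \<in> {1..L}" using Suc.prems by auto
  define F1 where "F1 t = integral {0..1} (\<lambda>u. F (t(?M := u)) * vector_derivative (\<gamma> ?M) (at u within {0..1}))" for t
  have "iter_integral \<gamma> m F1 t = iter_int m (seg_int ?M E) K0 z0"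
  proof (rule Suc.IH)
    show "m \<le> L" "cont_cells (seg_int ?M E)" using Suc.prems M by (auto intro: cont_cells_seg_int)
  next
    fix s assume s: "s \<in> {1..m}"
    then obtain E' where "cont_cells E'" "pderiv_on s E E'" using Suc.prems(3)[of s] by auto
    then show "\<exists>E'. cont_cells E' \<and> pderiv_on s (seg_int ?M E) E'"
      using pderiv_seg_int[of E E' s ?M] cont_cells_seg_int[of E' ?M] Suc.prems M s L_le_T by auto
  next
    fix K t assume K: "K \<in> cells" and t: "\<And>s. s \<in> {1..m} \<Longrightarrow> t s \<in> cell (K s)"
      and KK: "\<And>s. s \<notin> {1..m} \<Longrightarrow> K s = K0 s"
    let ?z = "\<lambda>s. if s \<in> {1..m} then \<gamma> s (t s) else z0 s"
    have z: "?z \<in> disc K"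
      unfolding disc_def
    proof (intro CollectI ballI)
      fix s assume s: "s \<in> {1..T}"
      show "?z s \<in> ball (c s (K s)) \<delta>"
      proof (cases "s \<in> {1..m}")
        case True
        then have sL: "s \<in> {1..L}" using Suc.prems(1) by auto
        then have "K s < n" using K by (auto simp: cells_def)
        then show ?thesis using cell_ball[OF sL _ t[OF True]] True by simp
      next
        case False
        then show ?thesis using KK[OF False] z0 s by (auto simp: disc_def)
      qed
    qed
    have "F1 t = (\<Sum>k<n. (c ?M (Suc k) - c ?M k) * integral {0..1} (\<lambda>\<tau>. E (K(?M := k)) (?z(?M := seg ?M k \<tau>))))"
      unfolding F1_def
    proof (rule integral_cells[OF M, where h = "\<lambda>k w. E (K(?M := k)) (?z(?M := w))"])
      fix k assume k: "k < n"
      obtain E' where E': "pderiv_on ?M E E'" using Suc.prems(3)[of ?M] by auto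
      show "(\<lambda>w. E (K(?M := k)) (?z(?M := w))) holomorphic_on ball (c ?M k) \<delta>"
        unfolding holomorphic_on_def
      proof
        fix w assume "w \<in> ball (c ?M k) \<delta>"
        then have "?z(?M := w) \<in> disc (K(?M := k))" by (rule disc_upd[OF z])
        then have "((\<lambda>\<xi>. E (K(?M := k)) (?z(?M := w, ?M := \<xi>))) has_field_derivative E' (K(?M := k)) (?z(?M := w))) (at ((?z(?M := w)) ?M))"
          using E' cells_upd[OF K k] unfolding pderiv_on_def by blast
        then show "(\<lambda>w. E (K(?M := k)) (?z(?M := w))) field_differentiable at w within ball (c ?M k) \<delta>"
          by (auto simp: field_differentiable_def intro: has_field_derivative_at_within)
      qed
      fix u assume u: "u \<in> cell k"
      have "F (t(?M := u)) = E (K(?M := k)) (\<lambda>s. if s \<in> {1..?M} then \<gamma> s ((t(?M := u)) s) else z0 s)"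
      proof (rule Suc.prems(4))
        show "K(?M := k) \<in> cells" by (rule cells_upd[OF K k])
        fix s
        show "(t(?M := u)) s \<in> cell ((K(?M := k)) s)" if "s \<in> {1..?M}"
          using that t[of s] u by (cases "s = ?M") auto
        show "(K(?M := k)) s = K0 s" if "s \<notin> {1..?M}" using that KK[of s] by auto
      qed
      also have "(\<lambda>s. if s \<in> {1..?M} then \<gamma> s ((t(?M := u)) s) else z0 s) = ?z(?M := \<gamma> ?M u)"
        by (auto simp: fun_eq_iff)
      finally show "F (t(?M := u)) = E (K(?M := k)) (?z(?M := \<gamma> ?M u))" .
    qed
    then show "F1 t = seg_int ?M E K ?z" unfolding seg_int_def .
  qed
  then show ?case by (simp add: F1_def[abs_def])
qed

end

section \<open>Derivatives and continuity of the integrand\<close>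

lemma continuous_on_coord [continuous_intros]: "continuous_on A (\<lambda>z::nat \<Rightarrow> complex. z s)"
  by (rule continuous_on_subset[OF continuous_on_product_coordinates subset_UNIV])

lemma fin_lin_has_field_derivative:
  assumes "fin_lin T" "\<And>q. ((\<lambda>\<zeta>. \<Phi> \<zeta> q) has_field_derivative \<Phi>' q) (at \<zeta>0)"
  shows "((\<lambda>\<zeta>. T (\<Phi> \<zeta>)) has_field_derivative T \<Phi>') (at \<zeta>0)"
proof -
  obtain Q a where Q: "finite Q" "\<And>\<Phi>. T \<Phi> = (\<Sum>q\<in>Q. a q * \<Phi> q)"
    using assms(1) unfolding fin_lin_def by blast
  show ?thesis unfolding Q(2) by (intro DERIV_sum DERIV_cmult assms(2))
qed

lemma fin_lin_continuous_on:
  assumes "fin_lin T" "\<And>q. continuous_on A (\<lambda>z. \<Phi> z q)"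
  shows "continuous_on A (\<lambda>z. T (\<Phi> z))"
proof -
  obtain Q a where Q: "finite Q" "\<And>\<Phi>. T \<Phi> = (\<Sum>q\<in>Q. a q * \<Phi> q)"
    using assms(1) unfolding fin_lin_def by blast
  show ?thesis unfolding Q(2) by (intro continuous_on_sum continuous_on_mult_left assms(2))
qed

text \<open>The derivative of a divided power is the next lower divided power, so differentiating
  the factor of a part \<open>n\<close> amounts to removing one copy of it.\<close>

lemma coh_has_field_derivative:
  assumes "\<And>n. ((\<lambda>\<zeta>. c \<zeta> n) has_field_derivative c' n) (at \<zeta>0)"
  shows "((\<lambda>\<zeta>. coh (c \<zeta>) p) has_field_derivative (\<Sum>n\<in>set_mset p. c' n * coh (c \<zeta>0) (p - {#n#}))) (at \<zeta>0)"
proof -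
  let ?u = "\<lambda>n m \<zeta>. c \<zeta> n ^ m / fact m"
  have D: "((\<lambda>\<zeta>. ?u n m \<zeta>) has_field_derivative c' n * (if m = 0 then 0 else ?u n (m - 1) \<zeta>0)) (at \<zeta>0)" for n m
  proof (cases m)
    case (Suc k)
    have "((\<lambda>\<zeta>. c \<zeta> n ^ Suc k / fact (Suc k)) has_field_derivative
       (1 + of_nat k) * (c' n * c \<zeta>0 n ^ k) / fact (Suc k)) (at \<zeta>0)"
      using DERIV_cdivide[OF DERIV_power_Suc[OF assms, of n k], of "fact (Suc k)"] .
    moreover have "(1 + of_nat k) * (c' n * c \<zeta>0 n ^ k) / fact (Suc k) = c' n * (c \<zeta>0 n ^ k / fact k)"
      using of_nat_neq_0[of k, where 'a=complex] by (simp add: field_simps del: of_nat_Suc) (simp add: field_simps)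
    ultimately show ?thesis using Suc by simp
  qed simp
  have "((\<lambda>\<zeta>. \<Prod>n\<in>set_mset p. ?u n (count p n) \<zeta>) has_field_derivative
     (\<Sum>n\<in>set_mset p. c' n * (if count p n = 0 then 0 else ?u n (count p n - 1) \<zeta>0)
         * (\<Prod>m\<in>set_mset p - {n}. ?u m (count p m) \<zeta>0))) (at \<zeta>0)"
    by (rule has_field_derivative_prod[OF D])
  also have "(\<Sum>n\<in>set_mset p. c' n * (if count p n = 0 then 0 else ?u n (count p n - 1) \<zeta>0)
         * (\<Prod>m\<in>set_mset p - {n}. ?u m (count p m) \<zeta>0))
     = (\<Sum>n\<in>set_mset p. c' n * coh (c \<zeta>0) (p - {#n#}))"
  proof (rule sum.cong[OF refl])
    fix n assume n: "n \<in># p"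
    have "coh (c \<zeta>0) (p - {#n#}) = (\<Prod>m\<in>set_mset p. ?u m (count (p - {#n#}) m) \<zeta>0)"
      by (rule coh_superset) (auto dest: in_diffD)
    also have "\<dots> = ?u n (count p n - 1) \<zeta>0 * (\<Prod>m\<in>set_mset p - {n}. ?u m (count (p - {#n#}) m) \<zeta>0)"
      using n by (subst prod.remove[of _ n]) auto
    also have "(\<Prod>m\<in>set_mset p - {n}. ?u m (count (p - {#n#}) m) \<zeta>0) = (\<Prod>m\<in>set_mset p - {n}. ?u m (count p m) \<zeta>0)"
      by (rule prod.cong) auto
    finally show "c' n * (if count p n = 0 then 0 else ?u n (count p n - 1) \<zeta>0) * (\<Prod>m\<in>set_mset p - {n}. ?u m (count p m) \<zeta>0)
       = c' n * coh (c \<zeta>0) (p - {#n#})"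
      using n by (simp add: count_eq_zero_iff)
  qed
  finally show ?thesis by (simp add: coh_def)
qed

lemma power_sum_has_field_derivative:
  assumes "s \<in> {1..T}"
  shows "((\<lambda>\<zeta>. power_sum q T (z(s := \<zeta>)) n) has_field_derivative q s * (of_nat n * z s ^ (n - 1))) (at (z s))"
proof -
  have "((\<lambda>\<zeta>. \<Sum>t\<in>{1..T}. q t * (z(s := \<zeta>)) t ^ n) has_field_derivative
      (\<Sum>t\<in>{1..T}. if t = s then q s * (of_nat n * z s ^ (n - 1)) else 0)) (at (z s))"
  proof (rule DERIV_sum)
    fix t
    show "((\<lambda>\<zeta>. q t * (z(s := \<zeta>)) t ^ n) has_field_derivative
         (if t = s then q s * (of_nat n * z s ^ (n - 1)) else 0)) (at (z s))"
      by (cases "t = s") (auto intro!: derivative_eq_intros)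
  qed
  then show ?thesis using assms by (simp add: power_sum_def)
qed

text \<open>The exponent depends on \<open>z s\<close> through \<open>q s * z s ^ n / n\<close>.
  Differentiation cancels the \<open>1 / n\<close> and leaves the coefficients of the current at
  \<open>z s\<close>.\<close>

lemma coh_pt_has_field_derivative:
  assumes "s \<in> {1..T}"
  shows "((\<lambda>\<zeta>. coh_pt q T (z(s := \<zeta>)) p) has_field_derivative q s * current (z s) (coh_pt q T z) p) (at (z s))"
proof -
  define c' where "c' n = (if n = 0 then 0 else q s * z s ^ (n - 1))" for n
  have "((\<lambda>\<zeta>. coh_pt q T (z(s := \<zeta>)) p) has_field_derivative
     (\<Sum>n\<in>set_mset p. c' n * coh (\<lambda>n. 1 / of_nat n * power_sum q T (z(s := z s)) n) (p - {#n#}))) (at (z s))"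
    unfolding coh_pt_def
  proof (rule coh_has_field_derivative)
    fix n
    show "((\<lambda>\<zeta>. 1 / of_nat n * power_sum q T (z(s := \<zeta>)) n) has_field_derivative c' n) (at (z s))"
      using DERIV_cmult[OF power_sum_has_field_derivative[OF assms, of q z n], of "1 / of_nat n"]
      by (cases "n = 0") (simp_all add: c'_def)
  qed
  also have "(\<Sum>n\<in>set_mset p. c' n * coh (\<lambda>n. 1 / of_nat n * power_sum q T (z(s := z s)) n) (p - {#n#}))
    = (\<Sum>n\<in>{1..sum_mset p}. q s * (z s ^ (n - 1) * create n (coh_pt q T z) p))"
  proof (rule sum.mono_neutral_cong)
    show "finite (set_mset p)" "finite {1..sum_mset p}" by auto
  next
    fix n assume "n \<in> set_mset p - {1..sum_mset p}"
    then have "n = 0" using sum_mset.remove[of n p] by auto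
    then show "c' n * coh (\<lambda>n. 1 / of_nat n * power_sum q T (z(s := z s)) n) (p - {#n#}) = 0" by (simp add: c'_def)
  next
    fix n assume "n \<in> {1..sum_mset p} - set_mset p"
    then show "q s * (z s ^ (n - 1) * create n (coh_pt q T z) p) = 0" by (simp add: create_apply)
  next
    fix n assume "n \<in> set_mset p \<inter> {1..sum_mset p}"
    then show "c' n * coh (\<lambda>n. 1 / of_nat n * power_sum q T (z(s := z s)) n) (p - {#n#}) = q s * (z s ^ (n - 1) * create n (coh_pt q T z) p)"
      by (simp add: c'_def create_apply coh_pt_def)
  qed
  finally show ?thesis by (simp add: current_def sum_distrib_left fun_upd_def)
qed

lemma current_coh_pt_has_field_derivative:
  assumes "s \<in> {1..T}"
  shows "((\<lambda>\<zeta>. current \<zeta> (coh_pt q T (z(s := \<zeta>))) p) has_field_derivative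
     dcurrent (z s) (coh_pt q T z) p + q s * current (z s) (current (z s) (coh_pt q T z)) p) (at (z s))"
proof -
  let ?e = "coh_pt q T z"
  let ?d = "\<lambda>p. q s * current (z s) ?e p"
  have "((\<lambda>\<zeta>. \<zeta> ^ (n - 1) * create n (coh_pt q T (z(s := \<zeta>))) p) has_field_derivative
      of_nat (n - 1) * z s ^ (n - 2) * create n ?e p + z s ^ (n - 1) * create n ?d p) (at (z s))" for n
  proof -
    have 1: "((\<lambda>\<zeta>. create n (coh_pt q T (z(s := \<zeta>))) p) has_field_derivative create n ?d p) (at (z s))"
      by (rule fin_lin_has_field_derivative[OF fin_lin_create coh_pt_has_field_derivative[OF assms]])
    have 2: "((\<lambda>\<zeta>. \<zeta> ^ (n - 1)) has_field_derivative of_nat (n - 1) * z s ^ (n - 2)) (at (z s))"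
      by (auto intro!: derivative_eq_intros simp: numeral_2_eq_2)
    show ?thesis using DERIV_mult[OF 2 1] by (simp add: add.commute mult.commute)
  qed
  then have "((\<lambda>\<zeta>. current \<zeta> (coh_pt q T (z(s := \<zeta>))) p) has_field_derivative
     (\<Sum>n\<in>{1..sum_mset p}. of_nat (n - 1) * z s ^ (n - 2) * create n ?e p + z s ^ (n - 1) * create n ?d p)) (at (z s))"
    unfolding current_def[of _ "coh_pt q T _"] by (rule DERIV_sum)
  also have "(\<Sum>n\<in>{1..sum_mset p}. of_nat (n - 1) * z s ^ (n - 2) * create n ?e p + z s ^ (n - 1) * create n ?d p)
    = dcurrent (z s) ?e p + current (z s) ?d p"
    by (simp add: dcurrent_def current_def[of _ ?d] sum.distrib)
  also have "current (z s) ?d p = q s * current (z s) (current (z s) ?e) p"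
    using fin_lin_linear2[OF fin_lin_current[of "z s" p], of "q s" "current (z s) ?e" 0 ?e] by simp
  finally show ?thesis .
qed

lemma continuous_on_coh_pt: "continuous_on A (\<lambda>z. coh_pt q T z p)"
  unfolding coh_pt_def coh_def power_sum_def
  by (intro continuous_intros) auto

lemma continuous_on_current:
  assumes "continuous_on A h" "\<And>p. continuous_on A (\<lambda>z. \<Phi> z p)"
  shows "continuous_on A (\<lambda>z. current (h z) (\<Phi> z) p)"
  unfolding current_def
  by (intro continuous_intros assms fin_lin_continuous_on[OF fin_lin_create])

lemma continuous_on_dcurrent:
  assumes "continuous_on A h" "\<And>p. continuous_on A (\<lambda>z. \<Phi> z p)"
  shows "continuous_on A (\<lambda>z. dcurrent (h z) (\<Phi> z) p)"
  unfolding dcurrent_def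
  by (intro continuous_intros assms fin_lin_continuous_on[OF fin_lin_create])

lemma dlog_has_field_derivative:
  assumes "\<And>t. t \<in> {1..T} - {s} \<Longrightarrow> z s \<noteq> z t"
  shows "((\<lambda>\<zeta>. dlog q T (z(s := \<zeta>)) s) has_field_derivative ddlog q T z s) (at (z s))"
proof -
  have "((\<lambda>\<zeta>. \<Sum>t\<in>{1..T} - {s}. 2 * q s * q t / (\<zeta> - z t)) has_field_derivative
      (\<Sum>t\<in>{1..T} - {s}. - (2 * q s * q t / (z s - z t)\<^sup>2))) (at (z s))"
    by (rule DERIV_sum) (use assms in \<open>auto intro!: derivative_eq_intros simp: power2_eq_square\<close>)
  moreover have "dlog q T (z(s := \<zeta>)) s = (\<Sum>t\<in>{1..T} - {s}. 2 * q s * q t / (\<zeta> - z t))" for \<zeta>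
    unfolding dlog_def by (rule sum.cong) auto
  ultimately show ?thesis by (simp add: ddlog_def sum_negf)
qed

text \<open>The logarithm of \<open>h(z) / h(c)\<close>, for \<open>z\<close> near the configuration \<open>c\<close>.\<close>

definition branch_exponent :: "(nat \<Rightarrow> complex) \<Rightarrow> nat \<Rightarrow> (nat \<Rightarrow> complex) \<Rightarrow> (nat \<Rightarrow> complex) \<Rightarrow> complex" where
  "branch_exponent q T c z = (\<Sum>b\<in>{1..T}. \<Sum>a\<in>{1..<b}. 2 * q a * q b * Ln ((z b - z a) / (c b - c a)))"

text \<open>In the right half-plane \<open>Ln\<close> is holomorphic and additive on products of two
  factors. Positivity also makes all differences nonzero, as a quotient by zero would be 0.\<close>

definition close_to :: "nat \<Rightarrow> (nat \<Rightarrow> complex) \<Rightarrow> (nat \<Rightarrow> complex) \<Rightarrow> bool" where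
  "close_to T c z \<longleftrightarrow> (\<forall>b\<in>{1..T}. \<forall>a\<in>{1..<b}. Re ((z b - z a) / (c b - c a)) > 0)"

lemma close_to_distinct: "close_to T c z \<Longrightarrow> a \<in> {1..T} \<Longrightarrow> b \<in> {1..T} \<Longrightarrow> a \<noteq> b \<Longrightarrow> z a \<noteq> z b"
proof -
  assume cl: "close_to T c z" and ab: "a \<in> {1..T}" "b \<in> {1..T}" "a \<noteq> b"
  have "z k \<noteq> z l" if "l \<in> {1..T}" "k \<in> {1..<l}" for k l
  proof
    assume "z k = z l"
    then show False using cl that unfolding close_to_def by (metis diff_self div_0 zero_complex.sel(1) less_irrefl)
  qed
  from this[of a b] this[of b a] show "z a \<noteq> z b" using ab by (cases a b rule: linorder_cases) auto
qed

lemma Ln_times_Re_pos: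
  assumes "Re a > 0" "Re b > 0" shows "Ln (a * b) = Ln a + Ln b"
proof -
  have "a \<noteq> 0" "b \<noteq> 0" using assms by auto
  moreover have "\<bar>Im (Ln a)\<bar> < pi / 2" "\<bar>Im (Ln b)\<bar> < pi / 2"
    using assms Re_Ln_pos_lt_imp \<open>a \<noteq> 0\<close> \<open>b \<noteq> 0\<close> by (auto simp: Re_Ln_pos_lt)
  ultimately show ?thesis by (intro Ln_times_simple) auto
qed

text \<open>Serves to compare local branches centred at neighbouring configurations: they differ by
  the constant factor \<open>exp (branch_exponent q T c c')\<close>.\<close>

lemma branch_exponent_cocycle:
  assumes "close_to T c c'" "close_to T c' z"
  shows "branch_exponent q T c z = branch_exponent q T c c' + branch_exponent q T c' z"
proof -
  have "Ln ((z b - z a) / (c b - c a)) = Ln ((c' b - c' a) / (c b - c a)) + Ln ((z b - z a) / (c' b - c' a))"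
    if "b \<in> {1..T}" "a \<in> {1..<b}" for a b
  proof -
    have r: "Re ((c' b - c' a) / (c b - c a)) > 0" "Re ((z b - z a) / (c' b - c' a)) > 0"
      using assms that by (auto simp: close_to_def)
    have "c' b - c' a \<noteq> 0" using r(1) by auto
    then have "(z b - z a) / (c b - c a) = ((c' b - c' a) / (c b - c a)) * ((z b - z a) / (c' b - c' a))" by simp
    then show ?thesis using Ln_times_Re_pos[OF r] by simp
  qed
  then show ?thesis
    unfolding branch_exponent_def sum.distrib[symmetric]
    by (intro sum.cong refl) (simp add: distrib_left)
qed

lemma branch_exponent_has_field_derivative:
  assumes s: "s \<in> {1..T}" and cl: "close_to T c z"
  shows "((\<lambda>\<zeta>. branch_exponent q T c (z(s := \<zeta>))) has_field_derivative dlog q T z s) (at (z s))"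
proof -
  define d where "d a b = 2 * q a * q b / (z b - z a)" for a b
  have "((\<lambda>\<zeta>. branch_exponent q T c (z(s := \<zeta>))) has_field_derivative
     (\<Sum>b\<in>{1..T}. \<Sum>a\<in>{1..<b}. (if b = s then d a s else 0) + (if a = s then - d s b else 0))) (at (z s))"
    unfolding branch_exponent_def
  proof (intro DERIV_sum)
    fix b a assume b: "b \<in> {1..T}" and a: "a \<in> {1..<b}"
    let ?w = "(z b - z a) / (c b - c a)"
    have w: "Re ?w > 0" using cl a b by (auto simp: close_to_def)
    then have nz: "c b - c a \<noteq> 0" "z b - z a \<noteq> 0" by auto
    define e where "e = (if b = s then 1 else 0 :: complex) - (if a = s then 1 else 0)"
    have "((\<lambda>\<zeta>. ((z(s := \<zeta>)) b - (z(s := \<zeta>)) a) / (c b - c a)) has_field_derivative e / (c b - c a)) (at (z s))"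
    proof (rule DERIV_cdivide)
      show "((\<lambda>\<zeta>. (z(s := \<zeta>)) b - (z(s := \<zeta>)) a) has_field_derivative e) (at (z s))"
        using a by (cases "b = s"; cases "a = s") (auto simp: e_def intro!: derivative_eq_intros)
    qed
    moreover have "(Ln has_field_derivative inverse ?w) (at (((z(s := z s)) b - (z(s := z s)) a) / (c b - c a)))"
    proof -
      have "?w \<notin> \<real>\<^sub>\<le>\<^sub>0" using w by (auto simp: complex_nonpos_Reals_iff)
      from has_field_derivative_Ln[OF this] show ?thesis by simp
    qed
    ultimately have "((\<lambda>\<zeta>. Ln (((z(s := \<zeta>)) b - (z(s := \<zeta>)) a) / (c b - c a))) has_field_derivative
        inverse ?w * (e / (c b - c a))) (at (z s))"
      by (rule DERIV_chain2[rotated])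
    also have "inverse ?w * (e / (c b - c a)) = e / (z b - z a)" using nz by simp
    finally have "((\<lambda>\<zeta>. Ln (((z(s := \<zeta>)) b - (z(s := \<zeta>)) a) / (c b - c a))) has_field_derivative e / (z b - z a)) (at (z s))" .
    from DERIV_cmult[OF this, of "2 * q a * q b"]
    show "((\<lambda>\<zeta>. 2 * q a * q b * Ln (((z(s := \<zeta>)) b - (z(s := \<zeta>)) a) / (c b - c a))) has_field_derivative
         ((if b = s then d a s else 0) + (if a = s then - d s b else 0))) (at (z s))"
      using a by (auto simp: e_def d_def)
  qed
  also have "(\<Sum>b\<in>{1..T}. \<Sum>a\<in>{1..<b}. (if b = s then d a s else 0) + (if a = s then - d s b else 0))
    = (\<Sum>a\<in>{1..<s}. d a s) + (\<Sum>b\<in>{s<..T}. - d s b)"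
  proof -
    have 1: "(\<Sum>b\<in>{1..T}. \<Sum>a\<in>{1..<b}. (if b = s then d a s else 0)) = (\<Sum>b\<in>{1..T}. if b = s then (\<Sum>a\<in>{1..<s}. d a s) else 0)"
      by (rule sum.cong) auto
    have "(\<Sum>b\<in>{1..T}. \<Sum>a\<in>{1..<b}. (if a = s then - d s b else 0)) = (\<Sum>b\<in>{1..T}. if b \<in> {s<..T} then - d s b else 0)"
      using s by (intro sum.cong refl) auto
    also have "\<dots> = (\<Sum>b\<in>{s<..T}. - d s b)"
      using s by (intro sum.mono_neutral_cong_right) auto
    finally show ?thesis using 1 s by (simp add: sum.distrib)
  qed
  also have "(\<Sum>b\<in>{s<..T}. - d s b) = (\<Sum>b\<in>{s<..T}. 2 * q s * q b / (z s - z b))"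
    by (rule sum.cong) (auto simp: d_def minus_divide_right)
  also have "(\<Sum>a\<in>{1..<s}. d a s) = (\<Sum>a\<in>{1..<s}. 2 * q s * q a / (z s - z a))"
    by (rule sum.cong) (auto simp: d_def mult_ac)
  also have "(\<Sum>a\<in>{1..<s}. 2 * q s * q a / (z s - z a)) + (\<Sum>b\<in>{s<..T}. 2 * q s * q b / (z s - z b))
     = dlog q T z s"
  proof -
    have "{1..T} - {s} = {1..<s} \<union> {s<..T}" using s by auto
    moreover have "{1..<s} \<inter> {s<..T} = {}" by auto
    ultimately show ?thesis
      unfolding dlog_def by (simp only: sum.union_disjoint finite_atLeastLessThan finite_greaterThanAtMost)
  qed
  finally show ?thesis .
qed

lemma continuous_on_branch_exponent:
  assumes "\<And>z. z \<in> A \<Longrightarrow> close_to T c z"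
  shows "continuous_on A (branch_exponent q T c)"
  unfolding branch_exponent_def[abs_def]
proof (intro continuous_on_sum continuous_on_mult_left continuous_on_Ln')
  fix b a assume ba: "b \<in> {1..T}" "a \<in> {1..<b}"
  show "continuous_on A (\<lambda>z. (z b - z a) / (c b - c a))"
    unfolding divide_inverse by (intro continuous_intros)
  fix z assume "z \<in> A"
  then have "Re ((z b - z a) / (c b - c a)) > 0"
    using assms ba by (auto simp: close_to_def)
  then show "(z b - z a) / (c b - c a) \<notin> \<real>\<^sub>\<le>\<^sub>0"
    by (auto simp: complex_nonpos_Reals_iff)
qed

text \<open>The difference of the two logarithms is continuous with values in the multiples of
  \<open>2 * pi * \<i>\<close>, hence constant on a connected set, and it vanishes at
  \<open>s0\<close>. Unknown continuous logarithms are thereby replaced by principal ones.\<close>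

lemma log_along_connected:
  fixes l g :: "'a::topological_space \<Rightarrow> complex"
  assumes S: "connected S" "s0 \<in> S" "s \<in> S" and l: "continuous_on S l"
    and e: "\<And>s. s \<in> S \<Longrightarrow> exp (l s) = g s" and pos: "\<And>s. s \<in> S \<Longrightarrow> Re (g s / g s0) > 0"
  shows "l s = l s0 + Ln (g s / g s0)"
proof -
  define f where "f s = l s - l s0 - Ln (g s / g s0)" for s
  have nz: "g s \<noteq> 0" if "s \<in> S" for s using e[OF that] by (metis exp_not_eq_zero)
  have "continuous_on S g" using continuous_on_exp[OF l] e by (metis continuous_on_cong)
  then have "continuous_on S (\<lambda>s. g s / g s0)" unfolding divide_inverse by (intro continuous_intros)
  moreover have "g s / g s0 \<notin> \<real>\<^sub>\<le>\<^sub>0" if "s \<in> S" for s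
    using pos[OF that] by (auto simp: complex_nonpos_Reals_iff)
  ultimately have "continuous_on S (\<lambda>s. Ln (g s / g s0))" by (intro continuous_on_Ln') auto
  then have "continuous_on S f" unfolding f_def by (intro continuous_on_diff continuous_on_const l)
  moreover have ef: "exp (f s) = 1" if "s \<in> S" for s
    using nz[OF that] nz[OF S(2)] e[OF that] e[OF S(2)] by (simp add: f_def exp_diff)
  have "\<exists>d>0. \<forall>y. y \<in> S \<and> f y \<noteq> f t \<longrightarrow> d \<le> norm (f y - f t)" if t: "t \<in> S" for t
  proof (intro exI[of _ "2 * pi"] conjI allI impI)
    fix y assume y: "y \<in> S \<and> f y \<noteq> f t"
    then obtain k :: int where k: "f y = f t + (of_int (2 * k) * pi) * \<i>"
      using ef[OF t] ef[of y] exp_eq[of "f y" "f t"] by auto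
    then have "k \<noteq> 0" using y by auto
    then have "1 \<le> \<bar>real_of_int k\<bar>" by linarith
    then have "2 * pi * 1 \<le> 2 * pi * \<bar>real_of_int k\<bar>" by (intro mult_left_mono) auto
    also have "\<dots> = norm (f y - f t)" using k by (simp add: norm_mult)
    finally show "2 * pi \<le> norm (f y - f t)" by simp
  qed simp
  ultimately have "f constant_on S"
    using S(1) by (intro continuous_discrete_range_constant) auto
  then have "f s = f s0" using S unfolding constant_on_def by metis
  also have "f s0 = 0" using nz[OF S(2)] by (simp add: f_def)
  finally show ?thesis by (simp add: f_def algebra_simps)
qed

section \<open>The integrand on the polydiscs\<close>

text \<open>Moving both ends by less than \<open>\<delta>\<close> changes the difference by less
  than its length, so the quotient stays within distance 1 of 1.\<close>

lemma Re_quotient_pos: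
  fixes a b c d :: complex
  assumes "dist c a < \<delta>" "dist d b < \<delta>" "2 * \<delta> \<le> dist c d"
  shows "Re ((b - a) / (d - c)) > 0"
proof -
  have e: "(b - a) - (d - c) = (b - d) + (c - a)" by simp
  have "norm ((b - a) - (d - c)) \<le> norm (b - d) + norm (c - a)"
    unfolding e by (rule norm_triangle_ineq)
  also have "\<dots> < norm (d - c)" using assms by (simp add: dist_norm norm_minus_commute)
  finally have 1: "norm ((b - a) - (d - c)) < norm (d - c)" .
  then have nz: "d - c \<noteq> 0" by auto
  have "(b - a) / (d - c) = 1 + ((b - a) - (d - c)) / (d - c)" using nz by (simp add: field_simps)
  moreover have "norm (((b - a) - (d - c)) / (d - c)) < 1" using 1 nz by (simp add: norm_divide)
  then have "\<bar>Re (((b - a) - (d - c)) / (d - c))\<bar> < 1" using abs_Re_le_cmod le_less_trans by blast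
  ultimately show ?thesis by simp
qed

lemma prod_split_config:
  "(\<Prod>s\<in>{1..L + N}. g s) = (\<Prod>r\<in>{1..L}. g r) * (\<Prod>i\<in>{1..N}. g (L + i))" for g :: "nat \<Rightarrow> complex"
proof -
  have "{1..L + N} = {1..L} \<union> (\<lambda>i. L + i) ` {1..N}"
    by (auto simp: image_iff intro!: bexI[of _ "_ - L"])
  moreover have "{1..L} \<inter> (\<lambda>i. L + i) ` {1..N} = {}" by auto
  moreover have "prod g ((\<lambda>i. L + i) ` {1..N}) = (\<Prod>i\<in>{1..N}. g (L + i))"
    by (subst prod.reindex) auto
  ultimately show ?thesis
    by (simp only: prod.union_disjoint finite_atLeastAtMost finite_imageI)
qed

text \<open>The factor 2 in \<open>separated\<close> lets both points of a pair move inside their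
  discs while the quotient of differences stays in the right half-plane. \<open>uniform\<close>
  keeps the path over one cell inside one disc, and \<open>\<delta> \<le> \<epsilon>\<close> keeps
  the real points where the branch is given.\<close>

locale screening_cells =
  fixes \<kappa> \<epsilon> \<delta> :: real and N L n :: nat and x :: "nat \<Rightarrow> real" and \<gamma> :: "nat \<Rightarrow> real \<Rightarrow> complex"
    and H :: "(nat \<Rightarrow> real) \<Rightarrow> (nat \<Rightarrow> real) \<Rightarrow> complex" and pt :: "nat \<Rightarrow> real \<Rightarrow> complex"
  defines "pt \<equiv> \<lambda>s u. if s \<in> {1..L} then \<gamma> s u else of_real (x (s - L))"
  assumes \<kappa>_pos: "\<kappa> > 0" and N_pos: "N \<ge> 1" and n_gt_0: "n > 0" and \<delta>_gt_0: "\<delta> > 0" and \<delta>_le: "\<delta> \<le> \<epsilon>"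
    and valid_\<gamma>: "r \<in> {1..L} \<Longrightarrow> valid_path (\<gamma> r)"
    and separated: "s \<in> {1..L + N} \<Longrightarrow> t \<in> {1..L + N} \<Longrightarrow> s \<noteq> t \<Longrightarrow> u \<in> {0..1} \<Longrightarrow> v \<in> {0..1} \<Longrightarrow> 2 * \<delta> \<le> dist (pt s u) (pt t v)"
    and uniform: "r \<in> {1..L} \<Longrightarrow> u \<in> {0..1} \<Longrightarrow> v \<in> {0..1} \<Longrightarrow> \<bar>u - v\<bar> \<le> 1 / real n \<Longrightarrow> dist (\<gamma> r u) (\<gamma> r v) < \<delta>"
    and branch: "h_branch \<kappa> N L x \<epsilon> \<gamma> H"
    and endpoints: "same_at_endpoints N L x \<epsilon> H"
begin

definition c :: "nat \<Rightarrow> nat \<Rightarrow> complex" where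
  "c s k = pt s (real k / real n)"

lemma cell_unit: "k < n \<Longrightarrow> u \<in> {real k / real n..real (Suc k) / real n} \<Longrightarrow> u \<in> {0..1} \<and> \<bar>real k / real n - u\<bar> \<le> 1 / real n"
proof -
  assume k: "k < n" and u: "u \<in> {real k / real n..real (Suc k) / real n}"
  have "real (Suc k) / real n \<le> 1" using k by simp
  moreover have "0 \<le> u" using u order_trans[of 0 "real k / real n" u] by simp
  moreover have "real (Suc k) / real n = real k / real n + 1 / real n" by (simp add: add_divide_distrib)
  ultimately show ?thesis using u by auto
qed

sublocale path_cells "L + N" L n \<delta> c \<gamma>
proof
  fix s k assume s: "s \<in> {1..L}" and k: "k < n"
  show *: "\<gamma> s u \<in> ball (c s k) \<delta>" if u: "u \<in> {real k / real n..real (Suc k) / real n}" for u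
    using uniform[OF s, of "real k / real n" u] cell_unit[OF k u] k s by (auto simp: c_def pt_def)
  have "real (Suc k) / real n \<in> {real k / real n..real (Suc k) / real n}"
    by (simp add: divide_right_mono)
  from *[OF this] show "dist (c s k) (c s (Suc k)) < \<delta>" using s by (simp add: c_def pt_def)
qed (use n_gt_0 \<delta>_gt_0 valid_\<gamma> in \<open>auto simp: c_def pt_def\<close>)

abbreviation T :: nat where "T \<equiv> L + N"
abbreviation q :: "nat \<Rightarrow> complex" where "q \<equiv> charge \<kappa> L"
abbreviation e :: "(nat \<Rightarrow> complex) \<Rightarrow> fock" where "e \<equiv> coh_pt q T"

lemma c_x: "s \<notin> {1..L} \<Longrightarrow> c s k = of_real (x (s - L))"
  by (auto simp: c_def pt_def)

lemma c_separated:
  assumes "K \<in> cells" "s \<in> {1..T}" "t \<in> {1..T}" "s \<noteq> t"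
  shows "2 * \<delta> \<le> dist (c s (K s)) (c t (K t))"
proof -
  have "\<exists>u\<in>{0..1}. c s (K s) = pt s u" for s
  proof (cases "s \<in> {1..L}")
    case True
    then have "K s < n" using assms(1) by (auto simp: cells_def)
    then have "real (K s) / real n \<in> {0..1}" by simp
    then show ?thesis unfolding c_def by blast
  next
    case False
    then show ?thesis by (intro bexI[of _ 0]) (auto simp: c_def pt_def)
  qed
  then show ?thesis using separated[OF assms(2-4)] by metis
qed

lemma Re_disc:
  assumes "K \<in> cells" "a \<in> {1..T}" "b \<in> {1..T}" "a \<noteq> b" "w \<in> ball (c a (K a)) \<delta>" "w' \<in> ball (c b (K b)) \<delta>"
  shows "Re ((w' - w) / (c b (K b) - c a (K a))) > 0"
  using assms c_separated[OF assms(1-4)] by (intro Re_quotient_pos) auto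

lemma disc_close: "K \<in> cells \<Longrightarrow> z \<in> disc K \<Longrightarrow> close_to T (\<lambda>s. c s (K s)) z"
  unfolding close_to_def disc_def by (auto intro!: Re_disc)

lemma disc_distinct: "K \<in> cells \<Longrightarrow> z \<in> disc K \<Longrightarrow> a \<in> {1..T} \<Longrightarrow> b \<in> {1..T} \<Longrightarrow> a \<noteq> b \<Longrightarrow> z a \<noteq> z b"
  using disc_close close_to_distinct by blast

text \<open>The value of the given branch at the initial corner of the cells, that is, at the centre
  of the polydisc; it normalises the local branch \<open>W\<close>.\<close>

definition A :: "(nat \<Rightarrow> nat) \<Rightarrow> complex" where
  "A K = H x (\<lambda>r. real (K r) / real n)"

definition W :: "branch_family" where
  "W K z = A K * exp (branch_exponent q T (\<lambda>s. c s (K s)) z)"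

lemma charge_products:
  "2 * charge \<kappa> L (L + Suc i) * charge \<kappa> L (L + Suc j) = of_real (2 / \<kappa>)"
  "r \<le> L \<Longrightarrow> s \<le> L \<Longrightarrow> 2 * charge \<kappa> L r * charge \<kappa> L s = of_real (8 / \<kappa>)"
  "r \<le> L \<Longrightarrow> 2 * charge \<kappa> L r * charge \<kappa> L (L + Suc i) = of_real (- 4 / \<kappa>)"
proof -
  have a: "alpha \<kappa> * alpha \<kappa> = 1 / \<kappa>" using \<kappa>_pos by (simp add: alpha_def)
  have "2 * alpha \<kappa> * alpha \<kappa> = 2 / \<kappa>" "2 * alpha_minus \<kappa> * alpha_minus \<kappa> = 8 / \<kappa>" "2 * alpha_minus \<kappa> * alpha \<kappa> = - 4 / \<kappa>"
    unfolding alpha_facts(2)[OF \<kappa>_pos] using a by (simp_all add: algebra_simps)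
  note * = this[THEN arg_cong[where f=complex_of_real]]
  show "2 * charge \<kappa> L (L + Suc i) * charge \<kappa> L (L + Suc j) = of_real (2 / \<kappa>)"
    using *(1) by (simp add: charge_def)
  show "2 * charge \<kappa> L r * charge \<kappa> L s = of_real (8 / \<kappa>)" if "r \<le> L" "s \<le> L"
    using *(2) that by (simp add: charge_def)
  show "2 * charge \<kappa> L r * charge \<kappa> L (L + Suc i) = of_real (- 4 / \<kappa>)" if "r \<le> L"
    using *(3) that by (simp add: charge_def)
qed

lemma t_cube_cells:
  assumes "K \<in> cells" "\<And>r. r \<in> {1..L} \<Longrightarrow> t r \<in> cell (K r)"
  shows "t \<in> t_cube L"
  unfolding t_cube_def
proof (intro CollectI ballI)
  fix r assume r: "r \<in> {1..L}"
  then have "K r < n" using assms(1) by (auto simp: cells_def)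
  then show "t r \<in> {0..1}" using cell_unit assms(2)[OF r] by blast
qed

lemma grid_cells: "real (K r) / real n \<in> cell (K r)"
  by (simp add: divide_right_mono)

text \<open>On the connected product of its two parameter ranges, each given logarithm is its value
  at the centre plus a principal logarithm, by \<open>log_along_connected\<close>. The exponentials
  of the former multiply to \<open>A K\<close>, those of the latter to the exponential of
  \<open>branch_exponent\<close>.\<close>

lemma H_local:
  assumes K: "K \<in> cells" and t: "\<And>r. r \<in> {1..L} \<Longrightarrow> t r \<in> cell (K r)"
    and y: "y \<in> x_box N x \<delta>"
  shows "H y t = W K (config L y (\<lambda>r. \<gamma> r (t r)))" "H y t \<noteq> 0"
proof -
  obtain lxx lww lxw where
      xx: "\<forall>i\<in>{1..N}. \<forall>j\<in>{1..N}. i < j \<longrightarrow>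
         continuous_on (ball (x i) \<epsilon> \<times> ball (x j) \<epsilon>) (\<lambda>(a, b). lxx i j a b) \<and>
         (\<forall>a\<in>ball (x i) \<epsilon>. \<forall>b\<in>ball (x j) \<epsilon>. exp (lxx i j a b) = of_real b - of_real a)"
    and ww: "\<forall>r\<in>{1..L}. \<forall>s\<in>{1..L}. r < s \<longrightarrow>
         continuous_on ({0..1} \<times> {0..1}) (\<lambda>(u, v). lww r s u v) \<and>
         (\<forall>u\<in>{0..1}. \<forall>v\<in>{0..1}. exp (lww r s u v) = \<gamma> s v - \<gamma> r u)"
    and xw: "\<forall>i\<in>{1..N}. \<forall>r\<in>{1..L}.
         continuous_on (ball (x i) \<epsilon> \<times> {0..1}) (\<lambda>(a, u). lxw i r a u) \<and>
         (\<forall>a\<in>ball (x i) \<epsilon>. \<forall>u\<in>{0..1}. exp (lxw i r a u) = of_real a - \<gamma> r u)"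
    and HH: "\<forall>y\<in>x_box N x \<epsilon>. \<forall>t\<in>t_cube L.
         H y t =
           (\<Prod>j=1..N. \<Prod>i\<in>{1..<j}. exp (of_real (2 / \<kappa>) * lxx i j (y i) (y j)))
         * (\<Prod>s=1..L. \<Prod>r\<in>{1..<s}. exp (of_real (8 / \<kappa>) * lww r s (t r) (t s)))
         * (\<Prod>i=1..N. \<Prod>r=1..L. exp (of_real (- 4 / \<kappa>) * lxw i r (y i) (t r)))"
    using branch unfolding h_branch_def by - (elim exE conjE, rule that)
  note Heq = HH[rule_format]
  \<comment> \<open>One indexing for the three families of logarithms. Since screening points
    precede the \<open>x\<close>, an ordered pair \<open>a < b\<close> never has an \<open>x\<close>
    before a screening point, in accordance with the factor \<open>x - w\<close> of
    \<open>h\<close>.\<close>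
  define lg :: "nat \<Rightarrow> nat \<Rightarrow> (nat \<Rightarrow> real) \<Rightarrow> (nat \<Rightarrow> real) \<Rightarrow> complex" where
    "lg a b y t = (if b \<le> L then lww a b (t a) (t b) else if a \<le> L then lxw (b - L) a (y (b - L)) (t a)
       else lxx (a - L) (b - L) (y (a - L)) (y (b - L)))" for a b y t
  define tK where "tK r = real (K r) / real n" for r
  have Hlg: "H y t = (\<Prod>b\<in>{1..T}. \<Prod>a\<in>{1..<b}. exp (2 * q a * q b * lg a b y t))"
    if yt: "y \<in> x_box N x \<epsilon>" "t \<in> t_cube L" for y t
  proof -
    have "(\<Prod>b\<in>{1..T}. \<Prod>a\<in>{1..<b}. exp (2 * q a * q b * lg a b y t))
      = (\<Prod>s=1..L. \<Prod>r\<in>{1..<s}. exp (of_real (8 / \<kappa>) * lww r s (t r) (t s)))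
       * (\<Prod>j=1..N. (\<Prod>r=1..L. exp (of_real (- 4 / \<kappa>) * lxw j r (y j) (t r))) * (\<Prod>i\<in>{1..<j}. exp (of_real (2 / \<kappa>) * lxx i j (y i) (y j))))"
      unfolding prod_split_config
    proof (intro arg_cong2[where f="(*)"] prod.cong refl)
      fix s r assume "s \<in> {1..L}" "r \<in> {1..<s}"
      then show "exp (2 * q r * q s * lg r s y t) = exp (of_real (8 / \<kappa>) * lww r s (t r) (t s))"
        using charge_products(2)[of r s] by (simp add: lg_def)
    next
      fix j assume j: "j \<in> {1..N}"
      then obtain j' where j': "j = Suc j'" by (cases j) auto
      have "{1..<L + j} = {1..L + (j - 1)}" using j by auto
      then have "(\<Prod>a\<in>{1..<L + j}. exp (2 * q a * q (L + j) * lg a (L + j) y t))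
        = (\<Prod>r\<in>{1..L}. exp (2 * q r * q (L + j) * lg r (L + j) y t))
          * (\<Prod>i\<in>{1..j - 1}. exp (2 * q (L + i) * q (L + j) * lg (L + i) (L + j) y t))"
        by (simp only: prod_split_config)
      also have "(\<Prod>r\<in>{1..L}. exp (2 * q r * q (L + j) * lg r (L + j) y t)) = (\<Prod>r=1..L. exp (of_real (- 4 / \<kappa>) * lxw j r (y j) (t r)))"
        using charge_products(3)[of _ j'] by (intro prod.cong refl) (simp add: lg_def j')
      also have "(\<Prod>i\<in>{1..j - 1}. exp (2 * q (L + i) * q (L + j) * lg (L + i) (L + j) y t)) = (\<Prod>i\<in>{1..<j}. exp (of_real (2 / \<kappa>) * lxx i j (y i) (y j)))"
      proof (rule prod.cong)
        fix i assume "i \<in> {1..<j}"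
        then obtain i' where i': "i = Suc i'" by (cases i) auto
        show "exp (2 * q (L + i) * q (L + j) * lg (L + i) (L + j) y t) = exp (of_real (2 / \<kappa>) * lxx i j (y i) (y j))"
          using charge_products(1)[of i' j'] by (simp add: lg_def j' i')
      qed (use j in auto)
      finally show "(\<Prod>a\<in>{1..<L + j}. exp (2 * q a * q (L + j) * lg a (L + j) y t))
        = (\<Prod>r=1..L. exp (of_real (- 4 / \<kappa>) * lxw j r (y j) (t r))) * (\<Prod>i\<in>{1..<j}. exp (of_real (2 / \<kappa>) * lxx i j (y i) (y j)))" .
    qed
    then show ?thesis using Heq[OF yt] by (simp add: prod.distrib mult_ac)
  qed
  have bal: "ball (x i) \<delta> \<subseteq> ball (x i) \<epsilon>" for i using \<delta>_le by auto
  have yb: "y i \<in> ball (x i) \<delta>" if "i \<in> {1..N}" for i using y that by (auto simp: x_box_def)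
  have y\<epsilon>: "y \<in> x_box N x \<epsilon>" and x\<epsilon>: "x \<in> x_box N x \<epsilon>"
    using y bal \<delta>_gt_0 \<delta>_le by (auto simp: x_box_def)
  have tc: "t \<in> t_cube L" by (rule t_cube_cells[OF K t])
  have tKc: "tK \<in> t_cube L" by (rule t_cube_cells[OF K]) (simp only: tK_def grid_cells)
  have Kn: "K r < n" if "r \<in> {1..L}" for r using K that by (auto simp: cells_def)
  let ?z = "config L y (\<lambda>r. \<gamma> r (t r))"
  have rb: "complex_of_real v \<in> ball (c s (K s)) \<delta>" if "v \<in> ball (x (s - L)) \<delta>" "s \<notin> {1..L}" for v s
    unfolding c_x[OF that(2)] using that(1) by (simp add: dist_of_real)
  have wb: "\<gamma> r u \<in> ball (c r (K r)) \<delta>" if "r \<in> {1..L}" "u \<in> cell (K r)" for r u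
    using cell_ball[OF that(1) Kn[OF that(1)] that(2)] .
  have cw: "c r (K r) = \<gamma> r (tK r)" if "r \<in> {1..L}" for r using that by (simp add: c_def pt_def tK_def)
  have cellsub: "cell (K r) \<subseteq> {0..1}" if "r \<in> {1..L}" for r
    using cell_unit[OF Kn[OF that]] by auto
  have ldiff: "lg a b y t = lg a b x tK + Ln ((?z b - ?z a) / (c b (K b) - c a (K a)))"
    if b: "b \<in> {1..T}" and a: "a \<in> {1..<b}" for a b
  proof -
    have ab: "a \<in> {1..T}" "a \<noteq> b" using a b by auto
    note pos = Re_disc[OF K ab(1) b ab(2)]
    consider "b \<le> L" | "b > L" "a \<le> L" | "b > L" "a > L" by linarith
    then show ?thesis
    proof cases
      case 1
      then have aL: "a \<in> {1..L}" "b \<in> {1..L}" "a < b" using a by auto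
      define S where "S = cell (K a) \<times> cell (K b)"
      have S: "S \<subseteq> {0..1} \<times> {0..1}" using cellsub aL unfolding S_def by blast
      have "(\<lambda>(u, v). lww a b u v) (t a, t b) = (\<lambda>(u, v). lww a b u v) (tK a, tK b)
         + Ln ((\<lambda>(u, v). \<gamma> b v - \<gamma> a u) (t a, t b) / (\<lambda>(u, v). \<gamma> b v - \<gamma> a u) (tK a, tK b))"
      proof (rule log_along_connected[where S=S])
        show "connected S" unfolding S_def by (intro connected_Times) auto
        show "(tK a, tK b) \<in> S" "(t a, t b) \<in> S" using t aL grid_cells by (auto simp: S_def tK_def)
        show "continuous_on S (\<lambda>(u, v). lww a b u v)"
          using ww aL S continuous_on_subset by blast
        show "exp ((\<lambda>(u, v). lww a b u v) s) = (\<lambda>(u, v). \<gamma> b v - \<gamma> a u) s" if "s \<in> S" for s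
          using ww aL S that by fastforce
        show "Re ((\<lambda>(u, v). \<gamma> b v - \<gamma> a u) s / (\<lambda>(u, v). \<gamma> b v - \<gamma> a u) (tK a, tK b)) > 0" if "s \<in> S" for s
          using pos[OF wb[OF aL(1), of "fst s"] wb[OF aL(2), of "snd s"]] that aL
          by (auto simp: S_def cw case_prod_unfold)
      qed
      then show ?thesis using 1 aL by (simp add: lg_def config_def cw)
    next
      case 2
      define i where "i = b - L"
      have i: "i \<in> {1..N}" and aL: "a \<in> {1..L}" and bL: "b \<notin> {1..L}" using 2 b a by (auto simp: i_def)
      define S where "S = ball (x i) \<delta> \<times> cell (K a)"
      have S: "S \<subseteq> ball (x i) \<epsilon> \<times> {0..1}" using cellsub[OF aL] bal[of i] unfolding S_def by blast
      have "(\<lambda>(p, u). lxw i a p u) (y i, t a) = (\<lambda>(p, u). lxw i a p u) (x i, tK a)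
         + Ln ((\<lambda>(p, u). of_real p - \<gamma> a u) (y i, t a) / (\<lambda>(p, u). of_real p - \<gamma> a u) (x i, tK a))"
      proof (rule log_along_connected[where S=S])
        show "connected S" unfolding S_def by (intro connected_Times) auto
        show "(x i, tK a) \<in> S" "(y i, t a) \<in> S" using t[OF aL] yb[OF i] \<delta>_gt_0 grid_cells by (auto simp: S_def tK_def)
        show "continuous_on S (\<lambda>(p, u). lxw i a p u)"
          using xw i aL S continuous_on_subset by blast
        show "exp ((\<lambda>(p, u). lxw i a p u) s) = (\<lambda>(p, u). of_real p - \<gamma> a u) s" if "s \<in> S" for s
          using xw i aL S that by fastforce
        show "Re ((\<lambda>(p, u). of_real p - \<gamma> a u) s / (\<lambda>(p, u). of_real p - \<gamma> a u) (x i, tK a)) > 0" if "s \<in> S" for s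
          using pos[OF wb[OF aL, of "snd s"] rb[of "fst s" b]] that aL bL c_x[OF bL]
          by (auto simp: S_def cw case_prod_unfold i_def)
      qed
      then show ?thesis using 2 aL bL by (simp add: lg_def config_def cw c_x i_def)
    next
      case 3
      define i j where "i = a - L" and "j = b - L"
      have i: "i \<in> {1..N}" "j \<in> {1..N}" "i < j" and aL: "a \<notin> {1..L}" and bL: "b \<notin> {1..L}"
        using 3 b a by (auto simp: i_def j_def)
      define S where "S = ball (x i) \<delta> \<times> ball (x j) \<delta>"
      have S: "S \<subseteq> ball (x i) \<epsilon> \<times> ball (x j) \<epsilon>" using bal unfolding S_def by blast
      have "(\<lambda>(p, u). lxx i j p u) (y i, y j) = (\<lambda>(p, u). lxx i j p u) (x i, x j)
         + Ln ((\<lambda>(p, u). of_real u - of_real p) (y i, y j) / (\<lambda>(p, u). of_real u - of_real p) (x i, x j))"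
      proof (rule log_along_connected[where S=S])
        show "connected S" unfolding S_def by (intro connected_Times) auto
        show "(x i, x j) \<in> S" "(y i, y j) \<in> S" using yb i \<delta>_gt_0 by (auto simp: S_def)
        show "continuous_on S (\<lambda>(p, u). lxx i j p u)"
          using xx i S continuous_on_subset by blast
        show "exp ((\<lambda>(p, u). lxx i j p u) s) = (\<lambda>(p, u). of_real u - of_real p) s" if "s \<in> S" for s
          using xx i S that by fastforce
        show "Re ((\<lambda>(p, u). of_real u - of_real p) s / (\<lambda>(p, u). of_real u - of_real p) (x i, x j)) > 0" if "s \<in> S" for s
          using pos[OF rb[of "fst s" a] rb[of "snd s" b]] that aL bL c_x[OF bL] c_x[OF aL]
          by (auto simp: S_def case_prod_unfold i_def j_def)
      qed
      then show ?thesis using 3 aL bL by (simp add: lg_def config_def c_x i_def j_def)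
    qed
  qed
  show "H y t \<noteq> 0" unfolding Hlg[OF y\<epsilon> tc] by simp
  have "H y t = (\<Prod>b\<in>{1..T}. \<Prod>a\<in>{1..<b}. exp (2 * q a * q b * lg a b x tK)
      * exp (2 * q a * q b * Ln ((?z b - ?z a) / (c b (K b) - c a (K a)))))"
    unfolding Hlg[OF y\<epsilon> tc]
    by (intro prod.cong refl) (simp add: ldiff exp_add distrib_left)
  also have "\<dots> = H x tK * (\<Prod>b\<in>{1..T}. \<Prod>a\<in>{1..<b}. exp (2 * q a * q b * Ln ((?z b - ?z a) / (c b (K b) - c a (K a)))))"
    unfolding Hlg[OF x\<epsilon> tKc] by (simp add: prod.distrib)
  also have "(\<Prod>b\<in>{1..T}. \<Prod>a\<in>{1..<b}. exp (2 * q a * q b * Ln ((?z b - ?z a) / (c b (K b) - c a (K a)))))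
    = exp (branch_exponent q T (\<lambda>s. c s (K s)) ?z)"
    unfolding branch_exponent_def by (simp add: exp_sum)
  finally show "H y t = W K ?z" by (simp add: W_def A_def tK_def[abs_def])
qed


section \<open>Calculus of the local branches\<close>

lemma cont_cells_W: "cont_cells W"
  unfolding cont_cells_def W_def[abs_def]
proof
  fix K assume "K \<in> cells"
  then have "continuous_on (disc K) (branch_exponent q T (\<lambda>s. c s (K s)))"
    by (intro continuous_on_branch_exponent disc_close)
  then show "continuous_on (disc K) (\<lambda>z. A K * exp (branch_exponent q T (\<lambda>s. c s (K s)) z))"
    by (intro continuous_intros)
qed

lemma pderiv_W: "s \<in> {1..T} \<Longrightarrow> pderiv_on s W (\<lambda>K z. W K z * dlog q T z s)"
  unfolding pderiv_on_def
proof (intro ballI)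
  fix K z assume s: "s \<in> {1..T}" and K: "K \<in> cells" and z: "z \<in> disc K"
  let ?b = "branch_exponent q T (\<lambda>s. c s (K s))"
  have "((\<lambda>\<zeta>. ?b (z(s := \<zeta>))) has_field_derivative dlog q T z s) (at (z s))"
    by (rule branch_exponent_has_field_derivative[OF s disc_close[OF K z]])
  then have "((\<lambda>\<zeta>. A K * exp (?b (z(s := \<zeta>)))) has_field_derivative A K * (exp (?b (z(s := z s))) * dlog q T z s)) (at (z s))"
    by (intro DERIV_cmult DERIV_chain2[where f=exp]) (auto intro: DERIV_exp)
  then show "((\<lambda>\<zeta>. W K (z(s := \<zeta>))) has_field_derivative W K z * dlog q T z s) (at (z s))"
    by (simp add: W_def mult.assoc)
qed

lemma cont_cells_W_mult:
  assumes "\<And>K. K \<in> cells \<Longrightarrow> continuous_on (disc K) \<phi>"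
  shows "cont_cells (\<lambda>K z. W K z * \<phi> z)"
  using cont_cells_W assms unfolding cont_cells_def by (auto intro!: continuous_on_mult)

lemma pderiv_W_mult:
  assumes "s \<in> {1..T}"
    and "\<And>K z. K \<in> cells \<Longrightarrow> z \<in> disc K \<Longrightarrow> ((\<lambda>\<zeta>. \<phi> (z(s := \<zeta>))) has_field_derivative \<phi>' z) (at (z s))"
  shows "pderiv_on s (\<lambda>K z. W K z * \<phi> z) (\<lambda>K z. W K z * (dlog q T z s * \<phi> z + \<phi>' z))"
  unfolding pderiv_on_def
proof (intro ballI)
  fix K z assume K: "K \<in> cells" and z: "z \<in> disc K"
  have "((\<lambda>\<zeta>. W K (z(s := \<zeta>)) * \<phi> (z(s := \<zeta>))) has_field_derivative
     W K z * dlog q T z s * \<phi> (z(s := z s)) + \<phi>' z * W K (z(s := z s))) (at (z s))"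
    using pderiv_W[OF assms(1)] K z unfolding pderiv_on_def by (intro DERIV_mult assms(2)) blast+
  then show "((\<lambda>\<zeta>. W K (z(s := \<zeta>)) * \<phi> (z(s := \<zeta>))) has_field_derivative W K z * (dlog q T z s * \<phi> z + \<phi>' z)) (at (z s))"
    by (simp add: algebra_simps)
qed

text \<open>Two local branches differ by a constant factor, so one common point decides whether they
  agree. Here this is the centre of \<open>K'\<close>, reached by the path parameter
  \<open>t\<close> within the cells of \<open>K\<close>.\<close>

lemma W_change:
  assumes K: "K \<in> cells" "K' \<in> cells" and t: "\<And>r. r \<in> {1..L} \<Longrightarrow> t r \<in> cell (K r)"
    and ct: "\<And>r. r \<in> {1..L} \<Longrightarrow> \<gamma> r (t r) = c r (K' r)" and H: "H x t = A K'"
    and z: "z \<in> disc K'"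
  shows "W K z = W K' z"
proof -
  let ?c = "\<lambda>K s. c s (K s)"
  have x: "x \<in> x_box N x \<delta>" using \<delta>_pos by (simp add: x_box_def)
  have e: "config L x (\<lambda>r. \<gamma> r (t r)) = ?c K'"
    using ct by (auto simp: fun_eq_iff config_def c_x)
  have "?c K' \<in> disc K"
    unfolding disc_def
  proof (intro CollectI ballI)
    fix s assume "s \<in> {1..T}"
    show "?c K' s \<in> ball (c s (K s)) \<delta>"
    proof (cases "s \<in> {1..L}")
      case True
      then have "K s < n" using K by (auto simp: cells_def)
      then show ?thesis using cell_ball[OF True _ t[OF True]] ct[OF True] by simp
    next
      case False
      then show ?thesis using \<delta>_pos by (simp add: c_x)
    qed
  qed
  then have "close_to T (?c K) (?c K')" by (rule disc_close[OF K(1)])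
  then have "branch_exponent q T (?c K) z = branch_exponent q T (?c K) (?c K') + branch_exponent q T (?c K') z"
    using disc_close[OF K(2) z] by (rule branch_exponent_cocycle)
  moreover have "A K' = A K * exp (branch_exponent q T (?c K) (?c K'))"
    using H_local(1)[OF K(1) t x] H by (simp add: e W_def)
  ultimately show ?thesis by (simp add: W_def exp_add)
qed

text \<open>The entries \<open>c r 0\<close> are dummies: the integration overwrites the first
  \<open>L\<close> coordinates. They only have to lie in the discs of the zero multi-index.\<close>

definition base :: "(nat \<Rightarrow> real) \<Rightarrow> nat \<Rightarrow> complex" where
  "base y = config L y (\<lambda>r. c r 0)"

lemma zero_cells: "(\<lambda>_. 0) \<in> cells"
  using n_pos by (simp add: cells_def)

lemma config_upd: "j \<in> {1..N} \<Longrightarrow> config L (y(j := s)) w = (config L y w)(L + j := of_real s)"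
  by (auto simp: config_def fun_eq_iff)

lemma base_upd: "j \<in> {1..N} \<Longrightarrow> base (y(j := s)) = (base y)(L + j := of_real s)"
  unfolding base_def by (rule config_upd)

lemma base_at: "j \<in> {1..N} \<Longrightarrow> base y (L + j) = of_real (y j)"
  by (simp add: base_def config_def)

lemma config_path_disc:
  assumes K: "K \<in> cells" and t: "\<And>r. r \<in> {1..L} \<Longrightarrow> t r \<in> cell (K r)"
    and y: "y \<in> x_box N x \<delta>"
  shows "config L y (\<lambda>r. \<gamma> r (t r)) \<in> disc K"
  unfolding disc_def
proof (intro CollectI ballI)
  fix s assume s: "s \<in> {1..T}"
  show "config L y (\<lambda>r. \<gamma> r (t r)) s \<in> ball (c s (K s)) \<delta>"
  proof (cases "s \<in> {1..L}")
    case True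
    then have "K s < n" using K by (auto simp: cells_def)
    then show ?thesis using cell_ball[OF True _ t[OF True]] True by (simp add: config_def)
  next
    case False
    then have "s - L \<in> {1..N}" using s by auto
    then have "y (s - L) \<in> ball (x (s - L)) \<delta>" using y by (auto simp: x_box_def)
    moreover have "config L y (\<lambda>r. \<gamma> r (t r)) s = of_real (y (s - L))" using False by (auto simp: config_def)
    ultimately show ?thesis unfolding c_x[OF False] by simp
  qed
qed

lemma base_disc: "y \<in> x_box N x \<delta> \<Longrightarrow> base y \<in> disc (\<lambda>_. 0)"
proof -
  assume y: "y \<in> x_box N x \<delta>"
  have "base y = config L y (\<lambda>r. \<gamma> r 0)"
    by (auto simp: base_def config_def c_def pt_def fun_eq_iff)
  then show ?thesis using config_path_disc[OF zero_cells _ y, of "\<lambda>_. 0"] by simp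
qed

section \<open>Closedness of the contours and matching of the branches\<close>

lemma H_has_vector_derivative:
  assumes K: "K \<in> cells" and t: "\<And>r. r \<in> {1..L} \<Longrightarrow> t r \<in> cell (K r)"
    and j: "j \<in> {1..N}"
  shows "((\<lambda>s. H (x(j := s)) t) has_vector_derivative H x t * dlog q T (config L x (\<lambda>r. \<gamma> r (t r))) (L + j)) (at (x j))"
proof -
  let ?z = "config L x (\<lambda>r. \<gamma> r (t r))"
  have x: "x(j := s) \<in> x_box N x \<delta>" if "s \<in> ball (x j) \<delta>" for s
    using that \<delta>_pos by (auto simp: x_box_def)
  have xx: "x \<in> x_box N x \<delta>" using \<delta>_pos by (simp add: x_box_def)
  have zj: "?z (L + j) = of_real (x j)" using j by (simp add: config_def)
  have "pderiv_on (L + j) W (\<lambda>K z. W K z * dlog q T z (L + j))" using j by (intro pderiv_W) auto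
  then have "((\<lambda>\<zeta>. W K (?z(L + j := \<zeta>))) has_field_derivative W K ?z * dlog q T ?z (L + j)) (at (?z (L + j)))"
    using K config_path_disc[OF K t xx] unfolding pderiv_on_def by blast
  then have "((\<lambda>\<zeta>. W K (?z(L + j := \<zeta>))) has_field_derivative W K ?z * dlog q T ?z (L + j)) (at (of_real (x j)))"
    unfolding zj .
  from field_vector_diff_chain_at[OF has_vector_derivative_of_real[OF DERIV_ident[unfolded has_real_derivative_iff_has_vector_derivative]] this]
  have "((\<lambda>s. W K (?z(L + j := of_real s))) has_vector_derivative W K ?z * dlog q T ?z (L + j)) (at (x j))"
    by (simp add: o_def)
  moreover have "W K ?z = H x t" using H_local(1)[OF K t xx] by simp
  ultimately have "((\<lambda>s. W K (?z(L + j := of_real s))) has_vector_derivative H x t * dlog q T ?z (L + j)) (at (x j))" by simp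
  then show ?thesis
  proof (rule has_vector_derivative_transform_within_open[of _ _ _ "ball (x j) \<delta>"])
    fix s assume "s \<in> ball (x j) \<delta>"
    from H_local(1)[OF K t x[OF this]] show "W K (?z(L + j := of_real s)) = H (x(j := s)) t"
      using config_upd[OF j] by simp
  qed (use \<delta>_pos in auto)
qed

text \<open>
  Compare the logarithmic derivatives in \<open>x\<^sub>1\<close> of \<open>h\<close> at both endpoints of the \<open>r\<close>-th path: they
  differ only in the term of the point \<open>w\<^sub>r\<close>.
\<close>

lemma path_closed:
  assumes r: "r \<in> {1..L}" shows "\<gamma> r 0 = \<gamma> r 1"
proof -
  define t0 t1 :: "nat \<Rightarrow> real" where "t0 = (\<lambda>_. 0)(r := 0)" and "t1 = (\<lambda>_. 0)(r := 1)"
  define z0 z1 where "z0 = config L x (\<lambda>r. \<gamma> r (t0 r))" and "z1 = config L x (\<lambda>r. \<gamma> r (t1 r))"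
  have j: "1 \<in> {1..N}" using N_pos by auto
  have D0: "((\<lambda>s. H (x(1 := s)) t0) has_vector_derivative H x t0 * dlog q T z0 (L + 1)) (at (x 1))"
    unfolding z0_def using n_pos by (intro H_has_vector_derivative[OF zero_cells _ j]) (auto simp: t0_def)
  have K1: "(\<lambda>_. 0)(r := n - 1) \<in> cells" using n_pos by (auto simp: cells_def)
  have t1: "t1 s \<in> cell (((\<lambda>_. 0)(r := n - 1)) s)" for s
    using n_pos by (auto simp: t1_def)
  have D1: "((\<lambda>s. H (x(1 := s)) t1) has_vector_derivative H x t1 * dlog q T z1 (L + 1)) (at (x 1))"
    unfolding z1_def by (rule H_has_vector_derivative[OF K1 t1 j])
  have E: "H y t0 = H y t1" if "y \<in> x_box N x \<epsilon>" for y
  proof -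
    have "(\<lambda>_. 0) \<in> t_cube L" by (simp add: t_cube_def)
    then show ?thesis using endpoints r that unfolding same_at_endpoints_def t0_def t1_def by blast
  qed
  have xx: "x \<in> x_box N x \<epsilon>" "x \<in> x_box N x \<delta>" using \<delta>_pos \<delta>_le by (auto simp: x_box_def)
  have "((\<lambda>s. H (x(1 := s)) t0) has_vector_derivative H x t1 * dlog q T z1 (L + 1)) (at (x 1))"
  proof (rule has_vector_derivative_transform_within_open[OF D1, of "ball (x 1) \<epsilon>"])
    fix s assume "s \<in> ball (x 1) \<epsilon>"
    then have "x(1 := s) \<in> x_box N x \<epsilon>" using \<delta>_pos \<delta>_le by (auto simp: x_box_def)
    then show "H (x(1 := s)) t1 = H (x(1 := s)) t0" using E by simp
  qed (use \<delta>_pos \<delta>_le in auto)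
  then have "H x t0 * dlog q T z0 (L + 1) = H x t1 * dlog q T z1 (L + 1)"
    using D0 vector_derivative_unique_at by blast
  moreover have "H x t0 = H x t1" by (rule E[OF xx(1)])
  moreover have "H x t1 \<noteq> 0" by (rule H_local(2)[OF K1 t1 xx(2)])
  ultimately have dl: "dlog q T z0 (L + 1) = dlog q T z1 (L + 1)" by simp
  have rT: "r \<in> {1..T} - {L + 1}" "finite ({1..T} - {L + 1})" using r by auto
  have other: "z0 s = z1 s" if "s \<noteq> r" for s using that by (simp add: z0_def z1_def config_def t0_def t1_def)
  have "(\<Sum>t\<in>{1..T} - {L + 1} - {r}. 2 * q (L + 1) * q t / (z0 (L + 1) - z0 t))
     = (\<Sum>t\<in>{1..T} - {L + 1} - {r}. 2 * q (L + 1) * q t / (z1 (L + 1) - z1 t))"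
    using r by (intro sum.cong refl) (auto simp: other)
  then have "2 * q (L + 1) * q r / (z0 (L + 1) - z0 r) = 2 * q (L + 1) * q r / (z1 (L + 1) - z1 r)"
    using dl unfolding dlog_def sum.remove[OF rT(2,1)] by simp
  moreover have "2 * q (L + 1) * q r \<noteq> 0"
    using charge_products(3)[of r 0] \<kappa>_pos r by (auto simp: mult_ac)
  moreover have "z0 (L + 1) = z1 (L + 1)" using r by (intro other) auto
  moreover have "z0 (L + 1) \<noteq> z0 r" "z1 (L + 1) \<noteq> z1 r"
    using disc_distinct[OF zero_cells config_path_disc[OF zero_cells _ xx(2), of t0], of "L + 1" r]
      disc_distinct[OF K1 config_path_disc[OF K1 t1 xx(2)], of "L + 1" r] r N_pos n_pos
    unfolding z0_def z1_def by (auto simp: t0_def)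
  ultimately have "z0 r = z1 r" by (simp add: field_simps)
  then show ?thesis using r by (simp add: z0_def z1_def config_def t0_def t1_def)
qed

lemma c_cyc:
  assumes "r \<in> {1..L}" "k < n" shows "c r (cyc k) = c r (Suc k)"
proof (cases "Suc k < n")
  case False
  then have "Suc k = n" using assms(2) by simp
  then have "real (Suc k) / real n = 1" using n_pos by simp
  then have "c r (Suc k) = \<gamma> r 1" using assms(1) by (simp only: c_def pt_def if_True)
  moreover have "c r (cyc k) = \<gamma> r 0" using False assms(1) by (simp add: cyc_def c_def pt_def)
  ultimately show ?thesis using path_closed[OF assms(1)] by simp
qed (simp add: cyc_def)

text \<open>Inside the path the next grid point belongs to both cells, so the two branches continue
  the same \<open>H\<close>. At the passage from the last cell to the first,
  \<open>same_at_endpoints\<close> supplies the equality. The factor \<open>\<phi>\<close> is a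
  single function of the points and causes no jump.\<close>

lemma matching_W:
  assumes M: "M \<in> {1..L}" shows "matching M (\<lambda>K z. W K z * \<phi> z)"
  unfolding matching_def
proof (intro ballI allI impI)
  fix K z k assume K: "K \<in> cells" and z: "z \<in> disc K" and k: "k < n"
  let ?K = "K(M := k)" and ?K' = "K(M := cyc k)"
  have ck: "cyc k < n" using n_pos by (auto simp: cyc_def)
  have cc: "c M (Suc k) = c M (cyc k)" using c_cyc[OF M k] by simp
  have "W ?K (z(M := c M (cyc k))) = W ?K' (z(M := c M (cyc k)))"
  proof (rule W_change[OF cells_upd[OF K k] cells_upd[OF K ck]])
    \<comment> \<open>The variable \<open>M\<close> stands at the end of its cell \<open>k\<close>,
      every other one at the start of its own; the resulting configuration is the centre for
      \<open>?K'\<close>.\<close>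
    let ?t = "\<lambda>r. if r = M then real (Suc k) / real n else real (K r) / real n"
    fix r assume r: "r \<in> {1..L}"
    show "?t r \<in> cell (?K r)"
      by (auto simp: divide_right_mono)
    show "\<gamma> r (?t r) = c r (?K' r)"
      using r cc by (auto simp: c_def pt_def)
  next
    let ?t = "\<lambda>r. if r = M then real (Suc k) / real n else real (K r) / real n"
    show "H x ?t = A ?K'"
    proof (cases "Suc k < n")
      case True
      then have "?t = (\<lambda>r. real (?K' r) / real n)" by (auto simp: cyc_def)
      then show ?thesis by (simp add: A_def)
    next
      case False
      then have kn: "Suc k = n" using k by simp
      let ?s = "\<lambda>r. real (K r) / real n"
      have "?t = ?s(M := 1)" using kn n_pos by auto
      moreover have "(\<lambda>r. real (?K' r) / real n) = ?s(M := 0)" using False by (auto simp: cyc_def)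
      moreover have "?s \<in> t_cube L" by (rule t_cube_cells[OF K]) (rule grid_cells)
      moreover have "x \<in> x_box N x \<epsilon>" using \<delta>_pos \<delta>_le by (simp add: x_box_def)
      ultimately show ?thesis
        using endpoints M unfolding same_at_endpoints_def A_def by metis
    qed
  next
    show "z(M := c M (cyc k)) \<in> disc ?K'" using disc_upd[OF z] \<delta>_pos by simp
  qed
  then show "W ?K (z(M := c M (Suc k))) * \<phi> (z(M := c M (Suc k))) = W ?K' (z(M := c M (cyc k))) * \<phi> (z(M := c M (cyc k)))"
    using cc by simp
qed


section \<open>The integrand, its derivatives and the integrated null vector identity\<close>

definition integrand :: "nat multiset \<Rightarrow> branch_family" where
  "integrand p = (\<lambda>K z. W K z * e z p)"

definition integrand_deriv :: "nat \<Rightarrow> nat multiset \<Rightarrow> branch_family" where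
  "integrand_deriv s p = (\<lambda>K z. W K z * (dlog q T z s * e z p + q s * current (z s) (e z) p))"

definition integrand_deriv2 :: "nat \<Rightarrow> nat multiset \<Rightarrow> branch_family" where
  "integrand_deriv2 s p = (\<lambda>K z. W K z * (((dlog q T z s)\<^sup>2 + ddlog q T z s) * e z p
        + 2 * dlog q T z s * (q s * current (z s) (e z) p)
        + q s * (dcurrent (z s) (e z) p + q s * current (z s) (current (z s) (e z)) p)))"

lemma continuous_on_dlog: "K \<in> cells \<Longrightarrow> s \<in> {1..T} \<Longrightarrow> continuous_on (disc K) (\<lambda>z. dlog q T z s)"
  unfolding dlog_def by (intro continuous_intros) (use disc_distinct in force)

lemma continuous_on_ddlog: "K \<in> cells \<Longrightarrow> s \<in> {1..T} \<Longrightarrow> continuous_on (disc K) (\<lambda>z. ddlog q T z s)"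
  unfolding ddlog_def by (intro continuous_intros) (use disc_distinct in force)

lemma cont_cells_integrand: "cont_cells (integrand p)"
  unfolding integrand_def by (intro cont_cells_W_mult continuous_on_coh_pt)

lemma cont_cells_integrand_deriv: "s \<in> {1..T} \<Longrightarrow> cont_cells (integrand_deriv s p)"
  unfolding integrand_deriv_def
  by (intro cont_cells_W_mult continuous_on_add continuous_on_mult continuous_on_const continuous_on_dlog
      continuous_on_coh_pt continuous_on_current continuous_on_coord)

lemma cont_cells_integrand_deriv2: "s \<in> {1..T} \<Longrightarrow> cont_cells (integrand_deriv2 s p)"
  unfolding integrand_deriv2_def
  by (intro cont_cells_W_mult continuous_on_add continuous_on_mult continuous_on_power continuous_on_const continuous_on_dlog continuous_on_ddlog
      continuous_on_coh_pt continuous_on_current continuous_on_dcurrent continuous_on_coord)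

lemma pderiv_integrand: "s \<in> {1..T} \<Longrightarrow> pderiv_on s (integrand p) (integrand_deriv s p)"
  unfolding integrand_def integrand_deriv_def by (intro pderiv_W_mult coh_pt_has_field_derivative)

lemma pderiv_integrand_deriv: assumes s: "s \<in> {1..T}" shows "pderiv_on s (integrand_deriv s p) (integrand_deriv2 s p)"
proof -
  let ?\<phi> = "\<lambda>z. dlog q T z s * e z p + q s * current (z s) (e z) p"
  let ?\<phi>' = "\<lambda>z. (ddlog q T z s * e z p + dlog q T z s * (q s * current (z s) (e z) p))
     + q s * (dcurrent (z s) (e z) p + q s * current (z s) (current (z s) (e z)) p)"
  have "pderiv_on s (\<lambda>K z. W K z * ?\<phi> z) (\<lambda>K z. W K z * (dlog q T z s * ?\<phi> z + ?\<phi>' z))"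
  proof (rule pderiv_W_mult[OF s])
    fix K z assume K: "K \<in> cells" and z: "z \<in> disc K"
    have 1: "((\<lambda>\<zeta>. dlog q T (z(s := \<zeta>)) s) has_field_derivative ddlog q T z s) (at (z s))"
      by (rule dlog_has_field_derivative) (use disc_distinct[OF K z] s in auto)
    have "((\<lambda>\<zeta>. dlog q T (z(s := \<zeta>)) s * e (z(s := \<zeta>)) p + q s * current \<zeta> (e (z(s := \<zeta>))) p)
      has_field_derivative ((ddlog q T z s * e (z(s := z s)) p + (q s * current (z s) (e z) p) * dlog q T (z(s := z s)) s)
     + q s * (dcurrent (z s) (e z) p + q s * current (z s) (current (z s) (e z)) p))) (at (z s))"
      by (intro DERIV_add DERIV_cmult DERIV_mult 1 coh_pt_has_field_derivative current_coh_pt_has_field_derivative s)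
    then show "((\<lambda>\<zeta>. ?\<phi> (z(s := \<zeta>))) has_field_derivative ?\<phi>' z) (at (z s))"
      by (simp add: mult_ac)
  qed
  moreover have "(\<lambda>K z. W K z * (dlog q T z s * ?\<phi> z + ?\<phi>' z)) = integrand_deriv2 s p"
    unfolding integrand_deriv2_def by (intro ext arg_cong2[where f="(*)"] refl) (simp add: algebra_simps power2_eq_square)
  ultimately show ?thesis by (simp add: integrand_deriv_def)
qed

lemma screened_iter_int:
  assumes y: "y \<in> x_box N x \<delta>"
  shows "screened \<kappa> N L \<gamma> H y p = iter_int L (integrand p) (\<lambda>_. 0) (base y)"
  unfolding screened_def
proof (rule iter_integral_eq_iter_int[OF order_refl cont_cells_integrand _ zero_cells base_disc[OF y]])
  fix s assume "s \<in> {1..L}"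
  then have "s \<in> {1..T}" by auto
  then show "\<exists>E'. cont_cells E' \<and> pderiv_on s (integrand p) E'" using cont_cells_integrand_deriv pderiv_integrand by blast
next
  fix K t assume K: "K \<in> cells" and t: "\<And>s. s \<in> {1..L} \<Longrightarrow> t s \<in> cell (K s)"
  have "config L y (\<lambda>r. \<gamma> r (t r)) = (\<lambda>s. if s \<in> {1..L} then \<gamma> s (t s) else base y s)"
    by (auto simp: config_def base_def fun_eq_iff)
  then show "H y t * U_minus \<kappa> N L y (\<lambda>r. \<gamma> r (t r)) vac p = integrand p K (\<lambda>s. if s \<in> {1..L} then \<gamma> s (t s) else base y s)"
    using H_local(1)[OF K t y] by (simp add: integrand_def U_minus_coh)
qed

lemma iter_int_has_vector_derivative:
  assumes "cont_cells E" "cont_cells E'" "pderiv_on (L + j) E E'" and j: "j \<in> {1..N}" and y: "y \<in> x_box N x \<delta>"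
  shows "((\<lambda>s. iter_int L E (\<lambda>_. 0) (base (y(j := s)))) has_vector_derivative iter_int L E' (\<lambda>_. 0) (base y)) (at (y j))"
proof -
  have "pderiv_on (L + j) (iter_int L E) (iter_int L E')"
    using j by (intro pderiv_iter_int assms) auto
  then have "((\<lambda>\<zeta>. iter_int L E (\<lambda>_. 0) ((base y)(L + j := \<zeta>))) has_field_derivative iter_int L E' (\<lambda>_. 0) (base y)) (at (base y (L + j)))"
    using zero_cells base_disc[OF y] unfolding pderiv_on_def by blast
  then have "((\<lambda>\<zeta>. iter_int L E (\<lambda>_. 0) ((base y)(L + j := \<zeta>))) has_field_derivative iter_int L E' (\<lambda>_. 0) (base y)) (at (of_real (y j)))"
    unfolding base_at[OF j] .
  from field_vector_diff_chain_at[OF has_vector_derivative_of_real[OF DERIV_ident[unfolded has_real_derivative_iff_has_vector_derivative]] this]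
  show ?thesis by (simp add: o_def base_upd[OF j])
qed

lemma box_upd: "y \<in> x_box N x \<delta> \<Longrightarrow> s \<in> ball (x j) \<delta> \<Longrightarrow> y(j := s) \<in> x_box N x \<delta>"
  by (auto simp: x_box_def)

lemma screened_has_vector_derivative:
  assumes j: "j \<in> {1..N}" and y: "y \<in> x_box N x \<delta>"
  shows "((\<lambda>s. screened \<kappa> N L \<gamma> H (y(j := s)) p) has_vector_derivative iter_int L (integrand_deriv (L + j) p) (\<lambda>_. 0) (base y)) (at (y j))"
proof (rule has_vector_derivative_transform_within_open[of _ _ _ "ball (x j) \<delta>"])
  have s: "L + j \<in> {1..T}" using j by auto
  show "((\<lambda>s. iter_int L (integrand p) (\<lambda>_. 0) (base (y(j := s)))) has_vector_derivative iter_int L (integrand_deriv (L + j) p) (\<lambda>_. 0) (base y)) (at (y j))"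
    by (rule iter_int_has_vector_derivative[OF cont_cells_integrand cont_cells_integrand_deriv[OF s] pderiv_integrand[OF s] j y])
  show "y j \<in> ball (x j) \<delta>" using y j by (auto simp: x_box_def)
qed (auto simp: screened_iter_int box_upd[OF y])

text \<open>A finitary functional is a finite linear combination of coefficients and therefore
  passes through the integral; this moves the Virasoro generators under the integral sign.\<close>

lemma iter_int_fin_lin:
  assumes "fin_lin F"
  shows "F (\<lambda>p. iter_int L (integrand p) (\<lambda>_. 0) (base x)) = iter_int L (\<lambda>K z. W K z * F (e z)) (\<lambda>_. 0) (base x)"
proof -
  obtain Q a where Q: "finite Q" "\<And>\<Phi>. F \<Phi> = (\<Sum>p\<in>Q. a p * \<Phi> p)"
    using assms unfolding fin_lin_def by blast
  have "x \<in> x_box N x \<delta>" using \<delta>_pos by (simp add: x_box_def)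
  then have "F (\<lambda>p. iter_int L (integrand p) (\<lambda>_. 0) (base x)) = iter_int L (\<lambda>K z. \<Sum>p\<in>Q. a p * integrand p K z) (\<lambda>_. 0) (base x)"
    unfolding Q(2) by (intro iter_int_sum[symmetric] cont_cells_integrand zero_cells base_disc Q(1)) auto
  also have "(\<lambda>K z. \<Sum>p\<in>Q. a p * integrand p K z) = (\<lambda>K z. W K z * F (e z))"
    unfolding Q(2) by (intro ext) (simp add: integrand_def sum_distrib_left mult_ac)
  finally show ?thesis .
qed

text \<open>The derivative of \<open>2 / (z r - z i) * W K z * e z p\<close> in the screening point
  \<open>z r\<close>, expanded with \<open>W\<close> as a common factor.\<close>

definition total_deriv :: "nat \<Rightarrow> nat \<Rightarrow> nat multiset \<Rightarrow> branch_family" where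
  "total_deriv r i p = (\<lambda>K z. W K z * (dlog q T z r * (2 / (z r - z i) * e z p)
      + (2 / (z r - z i) * (q r * current (z r) (e z) p) - 2 / (z r - z i)\<^sup>2 * e z p)))"

lemma continuous_on_inverse_diff:
  "K \<in> cells \<Longrightarrow> r \<in> {1..T} \<Longrightarrow> i \<in> {1..T} \<Longrightarrow> r \<noteq> i \<Longrightarrow> continuous_on (disc K) (\<lambda>z. 2 / (z r - z i) ^ m)"
  by (intro continuous_intros) (use disc_distinct in force)

lemma cont_cells_total_deriv:
  assumes "r \<in> {1..L}" "i \<in> {L + 1..T}" shows "cont_cells (total_deriv r i p)"
  unfolding total_deriv_def
proof (rule cont_cells_W_mult)
  fix K assume K: "K \<in> cells"
  have ri: "r \<in> {1..T}" "i \<in> {1..T}" "r \<noteq> i" using assms by auto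
  note c1 = continuous_on_inverse_diff[OF K ri, of 1, simplified] and c2 = continuous_on_inverse_diff[OF K ri, of 2]
  show "continuous_on (disc K) (\<lambda>z. dlog q T z r * (2 / (z r - z i) * e z p)
      + (2 / (z r - z i) * (q r * current (z r) (e z) p) - 2 / (z r - z i)\<^sup>2 * e z p))"
    by (intro continuous_on_add continuous_on_diff continuous_on_mult continuous_on_const c1 c2 continuous_on_dlog K ri
      continuous_on_coh_pt continuous_on_current continuous_on_coord)
qed

lemma iter_int_total_derivative:
  assumes r: "r \<in> {1..L}" and i: "i \<in> {L + 1..T}" and K: "K \<in> cells" and z: "z \<in> disc K"
  shows "iter_int L (total_deriv r i p) K z = 0"
proof (rule iter_int_total[OF r order_refl K z])
  have ri: "r \<in> {1..T}" "i \<in> {1..T}" "r \<noteq> i" using r i by auto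
  let ?\<phi> = "\<lambda>z. 2 / (z r - z i) * e z p"
  show "cont_cells (\<lambda>K z. W K z * ?\<phi> z)"
    by (intro cont_cells_W_mult continuous_on_mult continuous_on_inverse_diff[where m=1, simplified] continuous_on_coh_pt)
      (use ri in auto)
  show "cont_cells (total_deriv r i p)" by (rule cont_cells_total_deriv[OF r i])
  show "matching r (\<lambda>K z. W K z * ?\<phi> z)" by (rule matching_W[OF r])
  show "pderiv_on r (\<lambda>K z. W K z * ?\<phi> z) (total_deriv r i p)"
    unfolding total_deriv_def
  proof (rule pderiv_W_mult[OF ri(1)])
    fix K z assume K: "K \<in> cells" and z: "z \<in> disc K"
    have nz: "z r - z i \<noteq> 0" using disc_distinct[OF K z ri] by simp
    have "((\<lambda>\<zeta>. 2 / (\<zeta> - z i)) has_field_derivative - 2 / (z r - z i)\<^sup>2) (at (z r))"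
      using nz by (auto intro!: derivative_eq_intros simp: power2_eq_square)
    from DERIV_mult[OF this coh_pt_has_field_derivative[OF ri(1), of q z p]]
    show "((\<lambda>\<zeta>. ?\<phi> (z(r := \<zeta>))) has_field_derivative
       (2 / (z r - z i) * (q r * current (z r) (e z) p) - 2 / (z r - z i)\<^sup>2 * e z p)) (at (z r))"
      using ri(3) by (simp add: algebra_simps)
  qed
qed

text \<open>All terms are gathered under one integral. There the pointwise identity turns the
  integrand into minus a sum of total derivatives, each with vanishing integral.\<close>

lemma null_vector_iter_int:
  assumes i: "i \<in> {1..N}" and B: "sum_mset p \<le> B"
  shows "of_real (\<kappa> / 2) * iter_int L (integrand_deriv2 (L + i) p) (\<lambda>_. 0) (base x)
     + (\<Sum>j\<in>{1..N} - {i}. of_real (2 / (x j - x i)) * iter_int L (integrand_deriv (L + j) p) (\<lambda>_. 0) (base x)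
          + of_real (((\<kappa> - 6) / \<kappa>) / (x j - x i)\<^sup>2) * iter_int L (integrand p) (\<lambda>_. 0) (base x))
     - 2 * (\<Sum>k\<in>{- int B..-2}. of_real (x i) ^ nat (- 2 - k) * vir \<kappa> (beta \<kappa> N L) k (\<lambda>p. iter_int L (integrand p) (\<lambda>_. 0) (base x)) p) = 0"
proof -
  let ?K = "\<lambda>_::nat. 0::nat" and ?I = "L + i"
  have I: "?I \<in> {1..T}" "?I \<in> {L + 1..T}" using i by auto
  have jT: "L + j \<in> {1..T}" if "j \<in> {1..N} - {i}" for j using that by auto
  have b: "base x \<in> disc ?K" using \<delta>_pos by (intro base_disc) (simp add: x_box_def)
  define V where "V k = (\<lambda>K z. W K z * vir \<kappa> (beta \<kappa> N L) k (e z) p)" for k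
  have nV: "cont_cells (V k)" if "k \<in> {- int B..-2}" for k
    unfolding V_def using that
    by (intro cont_cells_W_mult fin_lin_continuous_on[OF fin_lin_vir] continuous_on_coh_pt) auto
  have JV: "vir \<kappa> (beta \<kappa> N L) k (\<lambda>p. iter_int L (integrand p) ?K (base x)) p = iter_int L (V k) ?K (base x)" if "k \<in> {- int B..-2}" for k
    unfolding V_def using that by (intro iter_int_fin_lin fin_lin_vir) auto
  define a1 a2 a3 where "a1 j = (of_real (2 / (x j - x i)) :: complex)" and "a2 j = (of_real (((\<kappa> - 6) / \<kappa>) / (x j - x i)\<^sup>2) :: complex)"
    and "a3 k = (of_real (x i) ^ nat (- 2 - k) :: complex)" for j k
  define F where "F j = (\<lambda>K z. a1 j * integrand_deriv (L + j) p K z + a2 j * integrand p K z)" for j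
  have nF: "cont_cells (F j)" if "j \<in> {1..N} - {i}" for j
    unfolding F_def by (intro cont_cells_lin2 cont_cells_integrand cont_cells_integrand_deriv jT that)
  define S1 where "S1 = (\<lambda>K z. \<Sum>j\<in>{1..N} - {i}. 1 * F j K z)"
  define S2 where "S2 = (\<lambda>K z. \<Sum>k\<in>{- int B..-2}. a3 k * V k K z)"
  have n1: "cont_cells S1" unfolding S1_def by (intro cont_cells_sum nF)
  have n2: "cont_cells S2" unfolding S2_def by (intro cont_cells_sum nV)
  have J1: "iter_int L S1 ?K (base x) = (\<Sum>j\<in>{1..N} - {i}. a1 j * iter_int L (integrand_deriv (L + j) p) ?K (base x) + a2 j * iter_int L (integrand p) ?K (base x))"
  proof -
    have "iter_int L S1 ?K (base x) = (\<Sum>j\<in>{1..N} - {i}. 1 * iter_int L (F j) ?K (base x))"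
      unfolding S1_def by (intro iter_int_sum nF zero_cells b) auto
    also have "\<dots> = (\<Sum>j\<in>{1..N} - {i}. a1 j * iter_int L (integrand_deriv (L + j) p) ?K (base x) + a2 j * iter_int L (integrand p) ?K (base x))"
      unfolding F_def mult_1 by (intro sum.cong refl iter_int_lin2 cont_cells_integrand cont_cells_integrand_deriv jT zero_cells b order_refl)
    finally show ?thesis .
  qed
  have J2: "iter_int L S2 ?K (base x) = (\<Sum>k\<in>{- int B..-2}. a3 k * vir \<kappa> (beta \<kappa> N L) k (\<lambda>p. iter_int L (integrand p) ?K (base x)) p)"
  proof -
    have "iter_int L S2 ?K (base x) = (\<Sum>k\<in>{- int B..-2}. a3 k * iter_int L (V k) ?K (base x))"
      unfolding S2_def by (intro iter_int_sum nV zero_cells b) auto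
    then show ?thesis using JV by simp
  qed
  define S3 where "S3 = (\<lambda>K z. of_real (\<kappa> / 2) * integrand_deriv2 ?I p K z + 1 * S1 K z)"
  have n3: "cont_cells S3" unfolding S3_def by (intro cont_cells_lin2 cont_cells_integrand_deriv2 I n1)
  have J3: "iter_int L S3 ?K (base x) = of_real (\<kappa> / 2) * iter_int L (integrand_deriv2 ?I p) ?K (base x) + 1 * iter_int L S1 ?K (base x)"
    unfolding S3_def by (intro iter_int_lin2 cont_cells_integrand_deriv2 I n1 zero_cells b) auto
  have "iter_int L (\<lambda>K z. 1 * S3 K z + (- 2) * S2 K z) ?K (base x) = 1 * iter_int L S3 ?K (base x) + (- 2) * iter_int L S2 ?K (base x)"
    by (intro iter_int_lin2 n3 n2 zero_cells b) auto
  moreover have "iter_int L (\<lambda>K z. 1 * S3 K z + (- 2) * S2 K z) ?K (base x)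
     = iter_int L (\<lambda>K z. \<Sum>r\<in>{1..L}. (- 1) * total_deriv r ?I p K z) ?K (base x)"
  \<comment> \<open>During the integration the last \<open>N\<close> coordinates stay at the real
    \<open>x j\<close>, so the prefactors \<open>a1\<close>, \<open>a2\<close>, \<open>a3\<close>,
    taken at \<open>x\<close>, agree with the functions of \<open>z\<close> in the pointwise
    identity.\<close>
  proof (rule iter_int_cong[OF _ zero_cells b order_refl])
    fix K z assume K: "K \<in> cells" and z: "z \<in> disc K" and zb: "\<And>s. s \<notin> {1..L} \<Longrightarrow> z s = base x s"
    have zx: "z (L + j) = of_real (x j)" if "j \<in> {1..N}" for j
      using zb[of "L + j"] base_at[OF that] that by auto
    let ?e = "e z"
    have inj: "inj_on z {1..T}" unfolding inj_on_def using disc_distinct[OF K z] by blast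
    note nv = null_vector_identity[OF \<kappa>_pos refl I(2) inj B]
    have s1: "S1 K z = W K z * (\<Sum>j\<in>{L + 1..T} - {?I}. 2 / (z j - z ?I) * (dlog q T z j * ?e p + q j * current (z j) ?e p)
          + of_real ((\<kappa> - 6) / \<kappa>) / (z j - z ?I)\<^sup>2 * ?e p)"
    proof -
      have "(\<Sum>j\<in>{L + 1..T} - {?I}. 2 / (z j - z ?I) * (dlog q T z j * ?e p + q j * current (z j) ?e p)
          + of_real ((\<kappa> - 6) / \<kappa>) / (z j - z ?I)\<^sup>2 * ?e p)
       = (\<Sum>j\<in>{1..N} - {i}. 2 / (z (L + j) - z ?I) * (dlog q T z (L + j) * ?e p + q (L + j) * current (z (L + j)) ?e p)
          + of_real ((\<kappa> - 6) / \<kappa>) / (z (L + j) - z ?I)\<^sup>2 * ?e p)"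
        by (rule sum.reindex_bij_witness[of _ "\<lambda>j. L + j" "\<lambda>j. j - L"]) auto
      also have "\<dots> = (\<Sum>j\<in>{1..N} - {i}. a1 j * (dlog q T z (L + j) * ?e p + q (L + j) * current (z (L + j)) ?e p) + a2 j * ?e p)"
        using zx[OF i] by (intro sum.cong refl) (simp add: zx a1_def a2_def)
      finally show ?thesis
        unfolding S1_def F_def integrand_deriv_def integrand_def by (simp add: sum_distrib_left algebra_simps)
    qed
    have s2: "S2 K z = W K z * (\<Sum>k\<in>{- int B..-2}. z ?I ^ nat (- 2 - k) * vir \<kappa> (beta \<kappa> N L) k ?e p)"
      unfolding S2_def V_def a3_def zx[OF i] by (simp add: sum_distrib_left mult_ac)
    have s4: "(\<Sum>r\<in>{1..L}. (- 1) * total_deriv r ?I p K z) = W K z * - (\<Sum>r\<in>{1..L}. 2 / (z r - z ?I) * (dlog q T z r * ?e p + q r * current (z r) ?e p)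
          - 2 / (z r - z ?I)\<^sup>2 * ?e p)"
      unfolding total_deriv_def sum_distrib_left sum_negf[symmetric] by (intro sum.cong refl) (simp add: algebra_simps)
    have "1 * S3 K z + (- 2) * S2 K z = W K z * - (\<Sum>r\<in>{1..L}. 2 / (z r - z ?I) * (dlog q T z r * ?e p + q r * current (z r) ?e p)
          - 2 / (z r - z ?I)\<^sup>2 * ?e p)"
      unfolding nv[symmetric] S3_def s1 s2 integrand_deriv2_def by (simp add: right_diff_distrib distrib_left mult.left_commute mult.assoc)
    then show "1 * S3 K z + (- 2) * S2 K z = (\<Sum>r\<in>{1..L}. (- 1) * total_deriv r ?I p K z)"
      unfolding s4 .
  qed
  moreover have "iter_int L (\<lambda>K z. \<Sum>r\<in>{1..L}. (- 1) * total_deriv r ?I p K z) ?K (base x) = 0"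
  proof -
    have "iter_int L (\<lambda>K z. \<Sum>r\<in>{1..L}. (- 1) * total_deriv r ?I p K z) ?K (base x) = (\<Sum>r\<in>{1..L}. (- 1) * iter_int L (total_deriv r ?I p) ?K (base x))"
      by (intro iter_int_sum cont_cells_total_deriv I zero_cells b) auto
    also have "\<dots> = 0" using iter_int_total_derivative[OF _ I(2) zero_cells b] by simp
    finally show ?thesis .
  qed
  ultimately show ?thesis unfolding J3 J1 J2 by (simp add: a1_def a2_def a3_def)
qed


text \<open>For fixed \<open>f\<close> and \<open>p\<close> the action of \<open>G f\<close> is one
  finitary functional with constants \<open>a\<close>. Derivatives in the \<open>x j\<close> pass
  through it, and the derivatives in the indeterminates become the same functional applied to
  Virasoro images. The claim thus reduces to the integrated null vector identity at each index in
  \<open>Q\<close>.\<close>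

lemma A_op_screened:
  assumes G: "is_G G" and i: "i \<in> {1..N}"
  shows "A_op \<kappa> N i (\<lambda>x f. uvir_act \<kappa> (beta \<kappa> N L) (G f) (screened \<kappa> N L \<gamma> H x) p) x f = 0"
proof -
  let ?F = "\<lambda>x f. uvir_act \<kappa> (beta \<kappa> N L) (G f) (screened \<kappa> N L \<gamma> H x) p"
  let ?K = "\<lambda>_::nat. 0::nat"
  obtain Q a where Q: "finite Q" "\<And>\<Phi>. uvir_act \<kappa> (beta \<kappa> N L) (G f) \<Phi> p = (\<Sum>p\<in>Q. a p * \<Phi> p)"
    using fin_lin_uvir_act[of \<kappa> "beta \<kappa> N L" "G f" p] unfolding fin_lin_def by blast
  \<comment> \<open>One cutoff is needed at two places: for \<open>p\<close> in the sum over the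
    indeterminates, and for every index in \<open>Q\<close> in the null vector identity.\<close>
  define B where "B = sum_mset p + (\<Sum>p\<in>Q. sum_mset p)"
  have Bp: "wt p \<le> int B" unfolding wt_def of_nat_le_iff B_def by simp
  have BQ: "sum_mset p' \<le> B" if "p' \<in> Q" for p'
    using member_le_sum[OF that _ Q(1), of sum_mset] by (simp add: B_def)
  have x: "x \<in> x_box N x \<delta>" using \<delta>_pos by (simp add: x_box_def)
  have dx: "d_x j ?F y f = (\<Sum>p\<in>Q. a p * iter_int L (integrand_deriv (L + j) p) ?K (base y))" if "j \<in> {1..N}" "y \<in> x_box N x \<delta>" for j y
    unfolding d_x_def Q(2)
    by (intro vector_derivative_at has_vector_derivative_sum has_vector_derivative_mult_right screened_has_vector_derivative that)
  have I: "L + i \<in> {1..T}" using i by auto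
  have dxx: "d_x i (d_x i ?F) x f = (\<Sum>p\<in>Q. a p * iter_int L (integrand_deriv2 (L + i) p) ?K (base x))"
    unfolding d_x_def[of i "d_x i ?F"]
  \<comment> \<open>The second derivative needs the formula for the first one in a neighbourhood of
    \<open>x\<close>, not only at \<open>x\<close>.\<close>
  proof (rule vector_derivative_at, rule has_vector_derivative_transform_within_open[of _ _ _ "ball (x i) \<delta>"])
    show "((\<lambda>s. \<Sum>p\<in>Q. a p * iter_int L (integrand_deriv (L + i) p) ?K (base (x(i := s)))) has_vector_derivative
        (\<Sum>p\<in>Q. a p * iter_int L (integrand_deriv2 (L + i) p) ?K (base x))) (at (x i))"
      by (intro has_vector_derivative_sum has_vector_derivative_mult_right iter_int_has_vector_derivative cont_cells_integrand_deriv cont_cells_integrand_deriv2 pderiv_integrand_deriv I i x)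
    show "(\<Sum>p\<in>Q. a p * iter_int L (integrand_deriv (L + i) p) ?K (base (x(i := s)))) = d_x i ?F (x(i := s)) f" if "s \<in> ball (x i) \<delta>" for s
      by (rule dx[OF i box_upd[OF x that], symmetric])
  qed (use \<delta>_pos in auto)
  define \<Phi> where "\<Phi> = (\<lambda>p. iter_int L (integrand p) ?K (base x))"
  have scr: "screened \<kappa> N L \<gamma> H x = \<Phi>"
    unfolding \<Phi>_def by (rule ext) (rule screened_iter_int[OF x])
  have F: "?F x f = (\<Sum>p\<in>Q. a p * \<Phi> p)" unfolding Q(2) scr ..
  have fsum: "(\<Sum>\<^sub>\<infinity>m\<in>{..- 2}. p_poly m (x i) f * d_f m (?F x) f)
    = - (\<Sum>p\<in>Q. a p * (\<Sum>k\<in>{- int B..-2}. of_real (x i) ^ nat (- 2 - k) * vir \<kappa> (beta \<kappa> N L) k \<Phi> p))"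
    unfolding f_derivative_sum[OF G Bp] scr Q(2)
    by (simp add: sum_distrib_left mult_ac sum.swap[of _ Q])
  have "A_op \<kappa> N i ?F x f = (\<Sum>p\<in>Q. a p * (of_real (\<kappa> / 2) * iter_int L (integrand_deriv2 (L + i) p) ?K (base x)
     + (\<Sum>j\<in>{1..N} - {i}. of_real (2 / (x j - x i)) * iter_int L (integrand_deriv (L + j) p) ?K (base x)
          + of_real (((\<kappa> - 6) / \<kappa>) / (x j - x i)\<^sup>2) * \<Phi> p)
     - 2 * (\<Sum>k\<in>{- int B..-2}. of_real (x i) ^ nat (- 2 - k) * vir \<kappa> (beta \<kappa> N L) k \<Phi> p)))"
  proof -
    have "(\<Sum>j\<in>{1..N} - {i}. of_real (2 / (x j - x i)) * d_x j ?F x f + of_real (((\<kappa> - 6) / \<kappa>) / (x j - x i)\<^sup>2) * ?F x f)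
      = (\<Sum>p\<in>Q. a p * (\<Sum>j\<in>{1..N} - {i}. of_real (2 / (x j - x i)) * iter_int L (integrand_deriv (L + j) p) ?K (base x)
          + of_real (((\<kappa> - 6) / \<kappa>) / (x j - x i)\<^sup>2) * \<Phi> p))"
    proof -
      have "(\<Sum>j\<in>{1..N} - {i}. of_real (2 / (x j - x i)) * d_x j ?F x f + of_real (((\<kappa> - 6) / \<kappa>) / (x j - x i)\<^sup>2) * ?F x f)
        = (\<Sum>j\<in>{1..N} - {i}. \<Sum>p\<in>Q. a p * (of_real (2 / (x j - x i)) * iter_int L (integrand_deriv (L + j) p) ?K (base x)
          + of_real (((\<kappa> - 6) / \<kappa>) / (x j - x i)\<^sup>2) * \<Phi> p))"
      proof (rule sum.cong[OF refl])
        fix j assume "j \<in> {1..N} - {i}"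
        then have j: "j \<in> {1..N}" by simp
        show "of_real (2 / (x j - x i)) * d_x j ?F x f + of_real (((\<kappa> - 6) / \<kappa>) / (x j - x i)\<^sup>2) * ?F x f
          = (\<Sum>p\<in>Q. a p * (of_real (2 / (x j - x i)) * iter_int L (integrand_deriv (L + j) p) ?K (base x)
          + of_real (((\<kappa> - 6) / \<kappa>) / (x j - x i)\<^sup>2) * \<Phi> p))"
          unfolding dx[OF j x] F sum_distrib_left sum.distrib[symmetric]
          by (rule sum.cong[OF refl]) (simp only: distrib_left mult_ac)
      qed
      then show ?thesis by (simp only: sum_distrib_left sum.swap[of _ Q])
    qed
    then show ?thesis
      unfolding A_op_def dxx fsum
      by (simp add: sum_distrib_left sum.distrib sum_subtractf distrib_left right_diff_distrib mult_ac)
  qed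
  also have "\<dots> = 0"
    using null_vector_iter_int[OF i BQ] by (intro sum.neutral) (simp add: \<Phi>_def)
  finally show ?thesis .
qed

end

theorem theorem5p4:
  fixes \<kappa> \<epsilon> :: real and N L i :: nat
    and x :: "nat \<Rightarrow> real"
    and \<gamma> :: "nat \<Rightarrow> real \<Rightarrow> complex"
    and H :: "(nat \<Rightarrow> real) \<Rightarrow> (nat \<Rightarrow> real) \<Rightarrow> complex"
    and G :: "(int \<Rightarrow> complex) \<Rightarrow> uvir"
    and f :: "int \<Rightarrow> complex"
    and p :: "nat multiset"
  assumes "0 < \<kappa>" "\<kappa> < 8"
    and "N \<ge> 2" "real L \<le> real N / 2"
    and "inj_on x {1..N}"
    and "\<And>r. r \<in> {1..L} \<Longrightarrow> valid_path (\<gamma> r)"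
    and "\<And>r j. r \<in> {1..L} \<Longrightarrow> j \<in> {1..N} \<Longrightarrow> of_real (x j) \<notin> path_image (\<gamma> r)"
    and "\<And>r s. r \<in> {1..L} \<Longrightarrow> s \<in> {1..L} \<Longrightarrow> r \<noteq> s \<Longrightarrow> path_image (\<gamma> r) \<inter> path_image (\<gamma> s) = {}"
    and "\<epsilon> > 0"
    and "h_branch \<kappa> N L x \<epsilon> \<gamma> H"
    and "same_at_endpoints N L x \<epsilon> H"
    and "is_G G"
    and "i \<in> {1..N}"
    and "\<forall>n\<in>#p. n \<ge> 1"
  shows "A_op \<kappa> N i
           (\<lambda>x f. uvir_act \<kappa> (beta \<kappa> N L) (G f) (screened \<kappa> N L \<gamma> H x) p) x f = 0"
proof -
  define pt where "pt = (\<lambda>s u. if s \<in> {1..L} then \<gamma> s u else of_real (x (s - L)))"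
  have cont: "continuous_on {0..1} (\<gamma> r)" if "r \<in> {1..L}" for r
    using valid_path_imp_path[OF assms(6)[OF that]] by (simp add: path_def)
  have ptcont: "continuous_on {0..1} (pt s)" for s
    using cont[of s] by (cases "s \<in> {1..L}") (auto simp: pt_def)
  have disj: "pt s ` {0..1} \<inter> pt t ` {0..1} = {}" if st: "s \<in> {1..L + N}" "t \<in> {1..L + N}" "s \<noteq> t" for s t
  proof -
    have xs: "of_real (x (s - L)) \<noteq> \<gamma> r u" if "s \<notin> {1..L}" "s \<in> {1..L + N}" "r \<in> {1..L}" "u \<in> {0..1}" for s r u
    proof -
      have "s - L \<in> {1..N}" using that(1,2) by auto
      from assms(7)[OF that(3) this] show ?thesis using that(4) by (auto simp: path_image_def)
    qed
    have "pt s u \<noteq> pt t v" if uv: "u \<in> {0..1}" "v \<in> {0..1}" for u v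
    proof (cases "s \<in> {1..L}"; cases "t \<in> {1..L}")
      assume "s \<in> {1..L}" "t \<in> {1..L}"
      moreover from this have "path_image (\<gamma> s) \<inter> path_image (\<gamma> t) = {}" using assms(8) st(3) by blast
      moreover have "\<gamma> s u \<in> path_image (\<gamma> s)" "\<gamma> t v \<in> path_image (\<gamma> t)" using uv by (auto simp: path_image_def)
      ultimately show ?thesis by (auto simp: pt_def)
    next
      assume "s \<in> {1..L}" "t \<notin> {1..L}"
      then show ?thesis using xs[of t s u] st uv unfolding pt_def by (metis (mono_tags))
    next
      assume "s \<notin> {1..L}" "t \<in> {1..L}"
      then show ?thesis using xs[of s t v] st uv unfolding pt_def by (metis (mono_tags))
    next
      assume "s \<notin> {1..L}" "t \<notin> {1..L}"
      moreover from this have "s - L \<in> {1..N}" "t - L \<in> {1..N}" "s - L \<noteq> t - L" using st by auto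
      then have "x (s - L) \<noteq> x (t - L)" using assms(5) by (meson inj_onD)
      ultimately show ?thesis by (auto simp: pt_def)
    qed
    then show ?thesis by blast
  qed
  \<comment> \<open>Distinct contours and points are disjoint compact sets and have positive
    distance. Only finitely many pairs occur, so all sufficiently small \<open>\<delta>\<close> meet
    every requirement together.\<close>
  have "eventually (\<lambda>\<delta>. \<forall>s\<in>{1..L + N}. \<forall>t\<in>{1..L + N}. s \<noteq> t \<longrightarrow>
      (\<forall>u\<in>{0..1}. \<forall>v\<in>{0..1}. 2 * \<delta> \<le> dist (pt s u) (pt t v))) (at_right 0)"
  proof (intro eventually_ball_finite ballI)
    fix s t assume st: "s \<in> {1..L + N}" "t \<in> {1..L + N}"
    show "eventually (\<lambda>\<delta>. s \<noteq> t \<longrightarrow> (\<forall>u\<in>{0..1}. \<forall>v\<in>{0..1}. 2 * \<delta> \<le> dist (pt s u) (pt t v))) (at_right 0)"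
    proof (cases "s = t")
      case False
      have "compact (pt s ` {0..1})" "closed (pt t ` {0..1})"
        using compact_continuous_image[OF ptcont] compact_imp_closed by auto
      then obtain d where d: "d > 0" "\<And>a b. a \<in> pt s ` {0..1} \<Longrightarrow> b \<in> pt t ` {0..1} \<Longrightarrow> d \<le> dist a b"
        using separate_compact_closed[OF _ _ disj[OF st False]] by blast
      have "2 * \<delta> \<le> dist (pt s u) (pt t v)" if "\<delta> < d / 2" "u \<in> {0..1}" "v \<in> {0..1}" for \<delta> u v
        using d(2)[of "pt s u" "pt t v"] that by auto
      then show ?thesis
        unfolding eventually_at_right_field using d(1) by (intro exI[of _ "d / 2"]) auto
    qed simp
  qed auto
  moreover have "eventually (\<lambda>\<delta>. \<delta> < \<epsilon>) (at_right 0)" "eventually (\<lambda>\<delta>::real. 0 < \<delta>) (at_right 0)"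
    using assms(9) by (auto simp: eventually_at_right_field)
  ultimately have "eventually (\<lambda>\<delta>. (\<forall>s\<in>{1..L + N}. \<forall>t\<in>{1..L + N}. s \<noteq> t \<longrightarrow>
      (\<forall>u\<in>{0..1}. \<forall>v\<in>{0..1}. 2 * \<delta> \<le> dist (pt s u) (pt t v))) \<and> \<delta> < \<epsilon> \<and> 0 < \<delta>) (at_right 0)"
    by (intro eventually_conj)
  then obtain \<delta> where \<delta>: "\<delta> > 0" "\<delta> < \<epsilon>" and sep: "\<forall>s\<in>{1..L + N}. \<forall>t\<in>{1..L + N}. s \<noteq> t \<longrightarrow>
      (\<forall>u\<in>{0..1}. \<forall>v\<in>{0..1}. 2 * \<delta> \<le> dist (pt s u) (pt t v))"
    using eventually_happens'[OF trivial_limit_at_right_real] by blast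
  \<comment> \<open>With \<open>\<delta>\<close> fixed, uniform continuity of the finitely many
    paths provides a mesh fine enough for all of them.\<close>
  have "eventually (\<lambda>n. \<forall>r\<in>{1..L}. \<forall>u\<in>{0..1}. \<forall>v\<in>{0..1}. \<bar>u - v\<bar> \<le> 1 / real n \<longrightarrow> dist (\<gamma> r u) (\<gamma> r v) < \<delta>) sequentially"
  proof (rule eventually_ball_finite, simp, rule ballI)
    fix r assume r: "r \<in> {1..L}"
    have "uniformly_continuous_on {0..1} (\<gamma> r)"
      by (rule compact_uniformly_continuous[OF cont[OF r]]) simp
    then obtain \<eta> where \<eta>: "\<eta> > 0" "\<And>u v. u \<in> {0..1} \<Longrightarrow> v \<in> {0..1} \<Longrightarrow> dist u v < \<eta> \<Longrightarrow> dist (\<gamma> r u) (\<gamma> r v) < \<delta>"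
      using \<delta>(1) unfolding uniformly_continuous_on_def by metis
    have "eventually (\<lambda>n. 1 / real n < \<eta>) sequentially"
      using order_tendstoD(2)[OF lim_1_over_n \<eta>(1)] by simp
    then show "eventually (\<lambda>n. \<forall>u\<in>{0..1}. \<forall>v\<in>{0..1}. \<bar>u - v\<bar> \<le> 1 / real n \<longrightarrow> dist (\<gamma> r u) (\<gamma> r v) < \<delta>) sequentially"
      by eventually_elim (auto intro!: \<eta>(2) simp: dist_real_def)
  qed
  then have "eventually (\<lambda>n. (\<forall>r\<in>{1..L}. \<forall>u\<in>{0..1}. \<forall>v\<in>{0..1}. \<bar>u - v\<bar> \<le> 1 / real n \<longrightarrow> dist (\<gamma> r u) (\<gamma> r v) < \<delta>) \<and> n > 0) sequentially"
    using eventually_gt_at_top by (intro eventually_conj) auto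
  then obtain n :: nat where n: "n > 0"
    and uni: "\<forall>r\<in>{1..L}. \<forall>u\<in>{0..1}. \<forall>v\<in>{0..1}. \<bar>u - v\<bar> \<le> 1 / real n \<longrightarrow> dist (\<gamma> r u) (\<gamma> r v) < \<delta>"
    using eventually_happens'[OF sequentially_bot] by blast
  interpret screening_cells \<kappa> \<epsilon> \<delta> N L n x \<gamma> H pt
    using assms(1,3,6,10,11) \<delta> n sep uni by unfold_locales (auto simp: pt_def)
  show ?thesis by (rule A_op_screened[OF assms(12,13)])
qed

end
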